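(* Let $V=\mathbb R^n$ and let $G\subset GL(V)$ be a linear Lie group of type 1, with Lie algebra $\mathfrak g$, such that the $G$-module $V\otimes\Lambda^2V^*$ admits a decomposition $V\otimes\Lambda^2V^*=\delta(\mathfrak g\otimes V^* )\oplus\mathfrak d$ with $\mathfrak d$ a $G$-submodule. Then for any $G$-structure $(P,p,M,G,\theta)$ the displacement form $\theta^1$ of the first prolongation $p^1:P^1\to P$ defines (via the diffeomorphism $p^1:P^1\to P$) a Cartan connection on $P$ of type $(\mathfrak g\ltimes V)/\mathfrak g$.
   Context: $G\subset GL(V)$ is of type 1 if its first prolongation $G^1:=(\mathfrak g\otimes V^* )\cap(V\otimes S^2V^* )\subset\mathrm{Hom}(V,\mathfrak g)$ is trivial ($=0$). $\delta:V\otimes V^*\otimes V^*\to V\otimes\Lambda^2V^*$ is the Spencer alternation operator, $\delta(A)(v,w)=A(v)w-A(w)v$ for $A\in\mathrm{Hom}(V,\mathfrak g)$ (up to a constant factor). $G$-structure: a principal $G$-bundle $p:P\to M$, $\dim M=n$, with displacement form $\theta\in\Omega^1(P;V)$ that is $G$-equivariant ($(r^g)^*\theta=g^{-1}\circ\theta$, $r^g(u)=u.g$) with $\ker\theta=VP$ the vertical bundle. $\zeta^P:\mathfrak g\to\mathfrak X(P)$ is the fundamental vector field mapping. $J^1P$ is identified with the bundle over $P$ of all horizontal linear subspaces $H\subset T_uP$, $u\in P$ (complements of $V_uP$). The torsion function is $t:J^1P\to V\otimes\Lambda^2V^*$, $t(H)(v,w)=d\theta((\theta|_H)^{-1}(v),(\theta|_H)^{-1}(w))$.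 The first prolongation is $P^1:=t^{-1}(\mathfrak d)\subset J^1P$ with natural projection $p^1:P^1\to P$; when $G^1=0$ the map $p^1$ is a diffeomorphism. For horizontal $H\subset T_uP$ let $\Phi_H:T_uP\to V_uP$ be the projection along $H$; define $\omega\in\Omega^1(P^1;\mathfrak g)$ by $\zeta^P_{\omega_H(\xi)}(p^1(H))=\Phi_H(T_H(p^1).\xi)$ for $\xi\in T_HP^1$, and $\theta^1=\omega+\theta\circ T(p^1):TP^1\to\mathfrak g\ltimes V$. Here $\mathfrak g\ltimes V$ is the semidirect product Lie algebra with $V$ an abelian ideal and $[X,v]=X(v)$ for $X\in\mathfrak g$, $v\in V$. Cartan connection of type $\mathfrak h/\mathfrak g$ on a manifold $P$ with $\dim P=\dim\mathfrak h$, for a Lie subalgebra $\mathfrak g\subset\mathfrak h$: a 1-form $\kappa\in\Omega^1(P;\mathfrak h)$ such that $\kappa_x:T_xP\to\mathfrak h$ is a linear isomorphism for every $x$ and the vector fields $\zeta_X(x)=(\kappa_x)^{-1}(X)$, $X\in\mathfrak h$, satisfy $[\zeta_X,\zeta_Y]=\zeta_{[X,Y]}$ for $X\in\mathfrak h$, $Y\in\mathfrak g$. *)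

theory Defs
  imports "HOL-Analysis.Analysis"
begin

section \<open>Calculus on subsets of Euclidean spaces\<close>

primrec Ck_on :: "nat \<Rightarrow> 'a::real_normed_vector set \<Rightarrow> ('a \<Rightarrow> 'b::real_normed_vector) \<Rightarrow> bool" where
  "Ck_on 0 U f \<longleftrightarrow> continuous_on U f"
| "Ck_on (Suc k) U f \<longleftrightarrow> (\<forall>x\<in>U. f differentiable (at x)) \<and>
      (\<forall>v. Ck_on k U (\<lambda>x. frechet_derivative f (at x) v))"

text \<open>Smoothness on an arbitrary set means that locally there is a smooth extension to an open
  set. It is used on relatively open subsets of linear subspaces, where it is the usual notion.\<close>

definition smooth_on :: "'a::euclidean_space set \<Rightarrow> ('a \<Rightarrow> 'b::real_normed_vector) \<Rightarrow> bool" where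
  "smooth_on S f \<longleftrightarrow> (\<forall>x\<in>S. \<exists>U g. open U \<and> x \<in> U \<and> (\<forall>k. Ck_on k U g) \<and> (\<forall>y\<in>S \<inter> U. f y = g y))"

definition dderiv :: "('a::real_normed_vector \<Rightarrow> 'b::real_normed_vector) \<Rightarrow> 'a \<Rightarrow> 'a \<Rightarrow> 'b" where
  "dderiv f x v = vector_derivative (\<lambda>s. f (x + s *\<^sub>R v)) (at 0)"

definition lin_on :: "'a::real_vector set \<Rightarrow> ('a \<Rightarrow> 'b::real_vector) \<Rightarrow> bool" where
  "lin_on E f \<longleftrightarrow> (\<forall>x\<in>E. \<forall>y\<in>E. \<forall>a b. f (a *\<^sub>R x + b *\<^sub>R y) = a *\<^sub>R f x + b *\<^sub>R f y)"


section \<open>Smooth manifolds\<close>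

text \<open>The model space of a manifold is a linear subspace of a Euclidean space rather than a whole
  type of class euclidean_space, because types of that class have positive dimension and
  discrete Lie groups have to be included. The topology is the one induced by the atlas.\<close>

type_synonym ('a, 'e) chart = "'a set \<times> ('a \<Rightarrow> 'e)"

record ('a, 'e) mfd =
  model :: "'e set"
  atlas :: "('a, 'e) chart set"

definition pts :: "('a, 'e) mfd \<Rightarrow> 'a set" where
  "pts M = (\<Union>c\<in>atlas M. fst c)"

definition cinv :: "('a, 'e) chart \<Rightarrow> 'e \<Rightarrow> 'a" where
  "cinv c = inv_into (fst c) (snd c)"

definition chart_on :: "'e::euclidean_space set \<Rightarrow> ('a, 'e) chart \<Rightarrow> bool" where
  "chart_on E c \<longleftrightarrow> inj_on (snd c) (fst c) \<and> openin (top_of_set E) (snd c ` fst c)"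

definition compat ::
  "'e::euclidean_space set \<Rightarrow> ('a, 'e) chart \<Rightarrow> 'f::euclidean_space set \<Rightarrow> ('a, 'f) chart \<Rightarrow> bool" where
  "compat E c F c' \<longleftrightarrow>
     openin (top_of_set E) (snd c ` (fst c \<inter> fst c')) \<and>
     openin (top_of_set F) (snd c' ` (fst c \<inter> fst c')) \<and>
     smooth_on (snd c ` (fst c \<inter> fst c')) (snd c' \<circ> cinv c) \<and>
     smooth_on (snd c' ` (fst c \<inter> fst c')) (snd c \<circ> cinv c')"

definition mtop :: "('a, 'e::euclidean_space) mfd \<Rightarrow> 'a topology" where
  "mtop M = topology (\<lambda>U. U \<subseteq> pts M \<and>
     (\<forall>c\<in>atlas M. openin (top_of_set (model M)) (snd c ` (U \<inter> fst c))))"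

definition smooth_manifold :: "('a, 'e::euclidean_space) mfd \<Rightarrow> bool" where
  "smooth_manifold M \<longleftrightarrow> subspace (model M) \<and>
     (\<forall>c\<in>atlas M. chart_on (model M) c) \<and>
     (\<forall>c\<in>atlas M. \<forall>c'\<in>atlas M. compat (model M) c (model M) c') \<and>
     Hausdorff_space (mtop M) \<and> second_countable (mtop M)"

text \<open>The smooth charts of M with values in F; for F = model M this is the maximal atlas.\<close>

definition charts_in :: "('a, 'e::euclidean_space) mfd \<Rightarrow> 'f::euclidean_space set \<Rightarrow> ('a, 'f) chart set" where
  "charts_in M F = {c. fst c \<subseteq> pts M \<and> chart_on F c \<and> (\<forall>c'\<in>atlas M. compat F c (model M) c')}"

definition smooth_map ::
  "('a, 'e::euclidean_space) mfd \<Rightarrow> ('b, 'f::euclidean_space) mfd \<Rightarrow> ('a \<Rightarrow> 'b) \<Rightarrow> bool" where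
  "smooth_map M N f \<longleftrightarrow> f ` pts M \<subseteq> pts N \<and>
     (\<forall>c\<in>atlas M. \<forall>c'\<in>atlas N.
        openin (top_of_set (model M)) (snd c ` (fst c \<inter> f -` fst c')) \<and>
        smooth_on (snd c ` (fst c \<inter> f -` fst c')) (snd c' \<circ> f \<circ> cinv c))"

definition diffeo ::
  "('a, 'e::euclidean_space) mfd \<Rightarrow> ('b, 'f::euclidean_space) mfd \<Rightarrow> ('a \<Rightarrow> 'b) \<Rightarrow> bool" where
  "diffeo M N f \<longleftrightarrow> bij_betw f (pts M) (pts N) \<and> smooth_map M N f \<and>
     smooth_map N M (the_inv_into (pts M) f)"

definition smooth_fun :: "('a, 'e::euclidean_space) mfd \<Rightarrow> ('a \<Rightarrow> 'w::real_normed_vector) \<Rightarrow> bool" where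
  "smooth_fun M f \<longleftrightarrow> (\<forall>c\<in>atlas M. smooth_on (snd c ` fst c) (f \<circ> cinv c))"

definition prod_mfd ::
  "('a, 'e::euclidean_space) mfd \<Rightarrow> ('b, 'f::euclidean_space) mfd \<Rightarrow> ('a \<times> 'b, 'e \<times> 'f) mfd" where
  "prod_mfd M N = \<lparr>model = model M \<times> model N,
     atlas = {(fst c \<times> fst c', map_prod (snd c) (snd c')) |c c'. c \<in> atlas M \<and> c' \<in> atlas N}\<rparr>"

definition open_sub :: "('a, 'e::euclidean_space) mfd \<Rightarrow> 'a set \<Rightarrow> ('a, 'e) mfd" where
  "open_sub M W = \<lparr>model = model M, atlas = {(fst c \<inter> W, snd c) |c. c \<in> atlas M}\<rparr>"

text \<open>Embedded submanifolds: around each point of S there is a chart of the maximal atlas that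
  maps S onto the part of its image lying in K.\<close>

definition slice_charts ::
  "('a, 'e::euclidean_space) mfd \<Rightarrow> 'a set \<Rightarrow> 'e set \<Rightarrow> ('a, 'e) chart set" where
  "slice_charts N S K = {(fst c \<inter> S, snd c) |c. c \<in> charts_in N (model N) \<and>
     snd c ` (fst c \<inter> S) = snd c ` fst c \<inter> K}"

definition slice_model :: "('a, 'e::euclidean_space) mfd \<Rightarrow> 'a set \<Rightarrow> 'e set \<Rightarrow> bool" where
  "slice_model N S K \<longleftrightarrow> subspace K \<and> K \<subseteq> model N \<and> S \<subseteq> (\<Union>c\<in>slice_charts N S K. fst c)"

definition embedded_submanifold :: "('a, 'e::euclidean_space) mfd \<Rightarrow> 'a set \<Rightarrow> bool" where
  "embedded_submanifold N S \<longleftrightarrow> S \<subseteq> pts N \<and> (\<exists>K. slice_model N S K)"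

definition sub_mfd :: "('a, 'e::euclidean_space) mfd \<Rightarrow> 'a set \<Rightarrow> ('a, 'e) mfd" where
  "sub_mfd N S = (let K = (SOME K. slice_model N S K) in
     \<lparr>model = K, atlas = slice_charts N S K\<rparr>)"


section \<open>Tangent vectors, forms and vector fields\<close>

text \<open>A tangent vector at x is represented by its coordinates in one chart chosen once and for
  all for each x. Thus every tangent space of M is (a copy of) model M; coords and uncoords
  convert between a tangent vector at x and its coordinates in an arbitrary chart around x.\<close>

definition chart_at :: "('a, 'e) mfd \<Rightarrow> 'a \<Rightarrow> ('a, 'e) chart" where
  "chart_at M x = (SOME c. c \<in> atlas M \<and> x \<in> fst c)"

definition tder :: "('a, 'e::euclidean_space) mfd \<Rightarrow> ('a \<Rightarrow> 'w::real_normed_vector) \<Rightarrow> 'a \<Rightarrow> 'e \<Rightarrow> 'w" where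
  "tder M f x v = dderiv (f \<circ> cinv (chart_at M x)) (snd (chart_at M x) x) v"

definition tmap ::
  "('a, 'e::euclidean_space) mfd \<Rightarrow> ('b, 'f::euclidean_space) mfd \<Rightarrow> ('a \<Rightarrow> 'b) \<Rightarrow> 'a \<Rightarrow> 'e \<Rightarrow> 'f" where
  "tmap M N f x v = tder M (snd (chart_at N (f x)) \<circ> f) x v"

definition coords ::
  "('a, 'e::euclidean_space) mfd \<Rightarrow> ('a, 'f::euclidean_space) chart \<Rightarrow> 'a \<Rightarrow> 'e \<Rightarrow> 'f" where
  "coords M c x v = tder M (snd c) x v"

definition uncoords ::
  "('a, 'e::euclidean_space) mfd \<Rightarrow> ('a, 'f::euclidean_space) chart \<Rightarrow> 'a \<Rightarrow> 'f \<Rightarrow> 'e" where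
  "uncoords M c x w = dderiv (snd (chart_at M x) \<circ> cinv c) (snd c x) w"

definition one_form :: "('a, 'e::euclidean_space) mfd \<Rightarrow> ('a \<Rightarrow> 'e \<Rightarrow> 'w::real_normed_vector) \<Rightarrow> bool" where
  "one_form M \<alpha> \<longleftrightarrow> (\<forall>x\<in>pts M. lin_on (model M) (\<alpha> x)) \<and>
     (\<forall>c\<in>atlas M. \<forall>v\<in>model M.
        smooth_on (snd c ` fst c) (\<lambda>y. \<alpha> (cinv c y) (uncoords M c (cinv c y) v)))"

text \<open>In local coordinates, d alpha (v, w) = v(alpha(w)) - w(alpha(v)) for constant v, w; there
  is no factor 1/2.\<close>

definition ext_deriv ::
  "('a, 'e::euclidean_space) mfd \<Rightarrow> ('a \<Rightarrow> 'e \<Rightarrow> 'w::real_normed_vector) \<Rightarrow> 'a \<Rightarrow> 'e \<Rightarrow> 'e \<Rightarrow> 'w" where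
  "ext_deriv M \<alpha> x v w =
     (let c = chart_at M x;
          a = (\<lambda>z y. \<alpha> (cinv c y) (uncoords M c (cinv c y) z))
      in dderiv (a w) (snd c x) v - dderiv (a v) (snd c x) w)"

definition lie_bracket ::
  "('a, 'e::euclidean_space) mfd \<Rightarrow> ('a \<Rightarrow> 'e) \<Rightarrow> ('a \<Rightarrow> 'e) \<Rightarrow> 'a \<Rightarrow> 'e" where
  "lie_bracket M X Y x =
     (let c = chart_at M x;
          loc = (\<lambda>Z y. coords M c (cinv c y) (Z (cinv c y)))
      in dderiv (loc Y) (snd c x) (X x) - dderiv (loc X) (snd c x) (Y x))"

definition pullback_form ::
  "('a, 'e::euclidean_space) mfd \<Rightarrow> ('b, 'f::euclidean_space) mfd \<Rightarrow> ('a \<Rightarrow> 'b) \<Rightarrow>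
   ('b \<Rightarrow> 'f \<Rightarrow> 'w) \<Rightarrow> 'a \<Rightarrow> 'e \<Rightarrow> 'w" where
  "pullback_form M N f \<alpha> x v = \<alpha> (f x) (tmap M N f x v)"


section \<open>Linear Lie groups and Cartan connections\<close>

text \<open>Linear Lie groups are Lie subgroups of GL(V), V = real ^ 'n, not necessarily closed: the
  manifold structure is part of the data, and the inclusion is an immersion.\<close>

definition linear_lie_group :: "(real^'n^'n, 'k::euclidean_space) mfd \<Rightarrow> bool" where
  "linear_lie_group G \<longleftrightarrow> smooth_manifold G \<and>
     pts G \<subseteq> {A. invertible A} \<and> mat 1 \<in> pts G \<and>
     (\<forall>A\<in>pts G. \<forall>B\<in>pts G. A ** B \<in> pts G) \<and> (\<forall>A\<in>pts G. matrix_inv A \<in> pts G) \<and>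
     smooth_map (prod_mfd G G) G (\<lambda>(A, B). A ** B) \<and> smooth_map G G matrix_inv \<and>
     smooth_fun G (\<lambda>A. A) \<and> (\<forall>A\<in>pts G. inj_on (tder G (\<lambda>A. A) A) (model G))"

definition lie_alg :: "(real^'n^'n, 'k::euclidean_space) mfd \<Rightarrow> (real^'n^'n) set" where
  "lie_alg G = tder G (\<lambda>A. A) (mat 1) ` model G"

definition lie_algebra :: "'w::real_vector set \<Rightarrow> ('w \<Rightarrow> 'w \<Rightarrow> 'w) \<Rightarrow> bool" where
  "lie_algebra L br \<longleftrightarrow> subspace L \<and> (\<forall>x\<in>L. \<forall>y\<in>L. br x y \<in> L) \<and>
     (\<forall>x\<in>L. lin_on L (br x)) \<and> (\<forall>y\<in>L. lin_on L (\<lambda>x. br x y)) \<and> (\<forall>x\<in>L. br x x = 0) \<and>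
     (\<forall>x\<in>L. \<forall>y\<in>L. \<forall>z\<in>L. br x (br y z) + br y (br z x) + br z (br x y) = 0)"

definition lie_subalgebra :: "'w::real_vector set \<Rightarrow> 'w set \<Rightarrow> ('w \<Rightarrow> 'w \<Rightarrow> 'w) \<Rightarrow> bool" where
  "lie_subalgebra K L br \<longleftrightarrow> K \<subseteq> L \<and> subspace K \<and> (\<forall>x\<in>K. \<forall>y\<in>K. br x y \<in> K)"

definition semidirect_br ::
  "(real^'n^'n) \<times> (real^'n) \<Rightarrow> (real^'n^'n) \<times> (real^'n) \<Rightarrow> (real^'n^'n) \<times> (real^'n)" where
  "semidirect_br = (\<lambda>(X, v) (Y, w). (X ** Y - Y ** X, X *v w - Y *v v))"

text \<open>The model space, and hence the dimension, is only meaningful for nonempty P.\<close>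

definition cartan_connection ::
  "('p, 'e::euclidean_space) mfd \<Rightarrow> 'w::euclidean_space set \<Rightarrow> ('w \<Rightarrow> 'w \<Rightarrow> 'w) \<Rightarrow> 'w set \<Rightarrow>
   ('p \<Rightarrow> 'e \<Rightarrow> 'w) \<Rightarrow> bool" where
  "cartan_connection P \<hh> br \<gg> \<kappa> \<longleftrightarrow>
     lie_algebra \<hh> br \<and> lie_subalgebra \<gg> \<hh> br \<and>
     (pts P \<noteq> {} \<longrightarrow> dim (model P) = dim \<hh>) \<and>
     one_form P \<kappa> \<and> (\<forall>x\<in>pts P. bij_betw (\<kappa> x) (model P) \<hh>) \<and>
     (let \<zeta> = (\<lambda>X x. the_inv_into (model P) (\<kappa> x) X)
      in \<forall>X\<in>\<hh>. \<forall>Y\<in>\<gg>. \<forall>x\<in>pts P. lie_bracket P (\<zeta> X) (\<zeta> Y) x = \<zeta> (br X Y) x)"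


section \<open>Type 1 and the Spencer operator\<close>

text \<open>Elements of Hom(V, g) and of Hom(V, Hom(V, V)) = V \<otimes> V^* \<otimes> V^* are linear maps, automatically
  bounded as V is finite-dimensional. The constant bilin turns a bilinear map into such a tensor;
  it is only meaningful on bilinear maps.\<close>

definition hom_alg :: "(real^'n^'n) set \<Rightarrow> ((real^'n) \<Rightarrow>\<^sub>L (real^'n^'n)) set" where
  "hom_alg \<gg> = {A. \<forall>v. blinfun_apply A v \<in> \<gg>}"

definition alg_prolongation :: "(real^'n^'n) set \<Rightarrow> ((real^'n) \<Rightarrow>\<^sub>L (real^'n^'n)) set" where
  "alg_prolongation \<gg> = {A \<in> hom_alg \<gg>. \<forall>v w. blinfun_apply A v *v w = blinfun_apply A w *v v}"

definition type_one :: "(real^'n^'n, 'k::euclidean_space) mfd \<Rightarrow> bool" where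
  "type_one G \<longleftrightarrow> alg_prolongation (lie_alg G) = {0}"

type_synonym 'n bil = "(real^'n) \<Rightarrow>\<^sub>L (real^'n) \<Rightarrow>\<^sub>L (real^'n)"

definition bilin :: "(real^'n \<Rightarrow> real^'n \<Rightarrow> real^'n) \<Rightarrow> 'n::finite bil" where
  "bilin f = Blinfun (\<lambda>v. Blinfun (f v))"

definition torsion_space :: "'n::finite bil set" where
  "torsion_space = {\<tau>. \<forall>v w. blinfun_apply (blinfun_apply \<tau> v) w = - blinfun_apply (blinfun_apply \<tau> w) v}"

definition spencer :: "((real^'n) \<Rightarrow>\<^sub>L (real^'n^'n)) \<Rightarrow> 'n::finite bil" where
  "spencer A = bilin (\<lambda>v w. blinfun_apply A v *v w - blinfun_apply A w *v v)"

definition torsion_act :: "real^'n^'n \<Rightarrow> 'n::finite bil \<Rightarrow> 'n bil" where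
  "torsion_act g \<tau> =
     bilin (\<lambda>v w. g *v blinfun_apply (blinfun_apply \<tau> (matrix_inv g *v v)) (matrix_inv g *v w))"

definition torsion_submodule :: "(real^'n^'n, 'k::euclidean_space) mfd \<Rightarrow> 'n::finite bil set \<Rightarrow> bool" where
  "torsion_submodule G \<dd> \<longleftrightarrow> subspace \<dd> \<and> \<dd> \<subseteq> torsion_space \<and>
     (\<forall>g\<in>pts G. \<forall>\<tau>\<in>\<dd>. torsion_act g \<tau> \<in> \<dd>)"

definition spencer_decomposition :: "(real^'n^'n, 'k::euclidean_space) mfd \<Rightarrow> 'n::finite bil set \<Rightarrow> bool" where
  "spencer_decomposition G \<dd> \<longleftrightarrow>
     torsion_space = {\<sigma> + \<tau> |\<sigma> \<tau>. \<sigma> \<in> spencer ` hom_alg (lie_alg G) \<and> \<tau> \<in> \<dd>} \<and>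
     spencer ` hom_alg (lie_alg G) \<inter> \<dd> = {0}"


section \<open>G-structures\<close>

definition principal_bundle ::
  "('p, 'e::euclidean_space) mfd \<Rightarrow> ('p \<Rightarrow> 'm) \<Rightarrow> ('m, 'f::euclidean_space) mfd \<Rightarrow>
   (real^'n^'n, 'k::euclidean_space) mfd \<Rightarrow> ('p \<Rightarrow> real^'n^'n \<Rightarrow> 'p) \<Rightarrow> bool" where
  "principal_bundle P p M G act \<longleftrightarrow>
     smooth_manifold P \<and> smooth_manifold M \<and> smooth_map P M p \<and>
     smooth_map (prod_mfd P G) P (\<lambda>(u, g). act u g) \<and>
     (\<forall>u\<in>pts P. act u (mat 1) = u) \<and>
     (\<forall>u\<in>pts P. \<forall>g\<in>pts G. \<forall>h\<in>pts G. act (act u g) h = act u (g ** h)) \<and>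
     (\<forall>u\<in>pts P. \<forall>g\<in>pts G. p (act u g) = p u) \<and>
     (\<forall>x\<in>pts M. \<exists>U \<psi>. openin (mtop M) U \<and> x \<in> U \<and>
        diffeo (open_sub P (pts P \<inter> p -` U)) (prod_mfd (open_sub M U) G) (\<lambda>u. (p u, \<psi> u)) \<and>
        (\<forall>u\<in>pts P \<inter> p -` U. \<forall>g\<in>pts G. \<psi> (act u g) = \<psi> u ** g))"

definition vert :: "('p, 'e::euclidean_space) mfd \<Rightarrow> ('p \<Rightarrow> 'm) \<Rightarrow> ('m, 'f::euclidean_space) mfd \<Rightarrow> 'p \<Rightarrow> 'e set" where
  "vert P p M u = {\<xi>\<in>model P. tmap P M p u \<xi> = 0}"

text \<open>That dim M = n is expressed by modelling M on all of real ^ 'n.\<close>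

definition G_structure ::
  "('p, 'e::euclidean_space) mfd \<Rightarrow> ('p \<Rightarrow> 'm) \<Rightarrow> ('m, real^'n) mfd \<Rightarrow>
   (real^'n^'n, 'k::euclidean_space) mfd \<Rightarrow> ('p \<Rightarrow> real^'n^'n \<Rightarrow> 'p) \<Rightarrow>
   ('p \<Rightarrow> 'e \<Rightarrow> real^'n) \<Rightarrow> bool" where
  "G_structure P p M G act \<theta> \<longleftrightarrow>
     principal_bundle P p M G act \<and> model M = UNIV \<and> one_form P \<theta> \<and>
     (\<forall>g\<in>pts G. \<forall>u\<in>pts P. \<forall>\<xi>\<in>model P.
        pullback_form P P (\<lambda>u. act u g) \<theta> u \<xi> = matrix_inv g *v \<theta> u \<xi>) \<and>
     (\<forall>u\<in>pts P. {\<xi>\<in>model P. \<theta> u \<xi> = 0} = vert P p M u)"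

text \<open>The fundamental vector field is the derivative at the identity of the orbit map; the element
  X of the Lie algebra, a matrix, is first converted to a tangent vector of G.\<close>

definition fund_vf ::
  "('p, 'e::euclidean_space) mfd \<Rightarrow> (real^'n^'n, 'k::euclidean_space) mfd \<Rightarrow>
   ('p \<Rightarrow> real^'n^'n \<Rightarrow> 'p) \<Rightarrow> real^'n^'n \<Rightarrow> 'p \<Rightarrow> 'e" where
  "fund_vf P G act X u =
     tmap G P (act u) (mat 1) (the_inv_into (model G) (tder G (\<lambda>A. A) (mat 1)) X)"


section \<open>The first jet bundle and the first prolongation\<close>

text \<open>Since all tangent spaces of P are copies of model P, a horizontal subspace is recorded
  together with its base point u.\<close>

definition J1_set ::
  "('p, 'e::euclidean_space) mfd \<Rightarrow> ('p \<Rightarrow> 'm) \<Rightarrow> ('m, 'f::euclidean_space) mfd \<Rightarrow> ('p \<times> 'e set) set" where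
  "J1_set P p M = {(u, H). u \<in> pts P \<and> subspace H \<and> H \<subseteq> model P \<and>
     H \<inter> vert P p M u = {0} \<and> {h + a |h a. h \<in> H \<and> a \<in> vert P p M u} = model P}"

definition fibred_charts ::
  "('p, 'e::euclidean_space) mfd \<Rightarrow> ('p \<Rightarrow> 'm) \<Rightarrow> ('m, real^'n) mfd \<Rightarrow>
   (real^'n^'n, 'k::euclidean_space) mfd \<Rightarrow> ('p, (real^'n) \<times> 'k) chart set" where
  "fibred_charts P p M G = {c \<in> charts_in P (UNIV \<times> model G).
     \<exists>b\<in>atlas M. p ` fst c \<subseteq> fst b \<and> (\<forall>u\<in>fst c. fst (snd c u) = snd b (p u))}"

text \<open>The standard jet coordinates: in a fibred chart of P a horizontal subspace is the graph of a
  linear map from real ^ 'n to model G, and the coordinates of H are those of its base point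
  together with the values of this map on the standard basis.\<close>

definition jet_chart ::
  "('p, 'e::euclidean_space) mfd \<Rightarrow> ('p \<Rightarrow> 'm) \<Rightarrow> ('m, real^'n) mfd \<Rightarrow>
   ('p, (real^'n) \<times> 'k::euclidean_space) chart \<Rightarrow>
   ('p \<times> 'e set, ((real^'n) \<times> 'k) \<times> ('k^'n)) chart" where
  "jet_chart P p M c =
     ({j \<in> J1_set P p M. fst j \<in> fst c},
      \<lambda>(u, H). (snd c u, \<chi> i. snd (coords P c u
         (THE \<xi>. \<xi> \<in> H \<and> fst (coords P c u \<xi>) = axis i 1))))"

definition J1 ::
  "('p, 'e::euclidean_space) mfd \<Rightarrow> ('p \<Rightarrow> 'm) \<Rightarrow> ('m, real^'n) mfd \<Rightarrow>
   (real^'n^'n, 'k::euclidean_space) mfd \<Rightarrow>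
   ('p \<times> 'e set, ((real^'n) \<times> 'k) \<times> ('k^'n)) mfd" where
  "J1 P p M G = \<lparr>model = (UNIV \<times> model G) \<times> {L. \<forall>i. L $ i \<in> model G},
     atlas = jet_chart P p M ` fibred_charts P p M G\<rparr>"

definition torsion_fun ::
  "('p, 'e::euclidean_space) mfd \<Rightarrow> ('p \<Rightarrow> 'e \<Rightarrow> real^'n) \<Rightarrow> 'p \<times> 'e set \<Rightarrow> 'n::finite bil" where
  "torsion_fun P \<theta> = (\<lambda>(u, H). bilin (\<lambda>v w.
     ext_deriv P \<theta> u (the_inv_into H (\<theta> u) v) (the_inv_into H (\<theta> u) w)))"

definition P1_set ::
  "('p, 'e::euclidean_space) mfd \<Rightarrow> ('p \<Rightarrow> 'm) \<Rightarrow> ('m, real^'n) mfd \<Rightarrow>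
   ('p \<Rightarrow> 'e \<Rightarrow> real^'n) \<Rightarrow> 'n::finite bil set \<Rightarrow> ('p \<times> 'e set) set" where
  "P1_set P p M \<theta> \<dd> = {j \<in> J1_set P p M. torsion_fun P \<theta> j \<in> \<dd>}"

definition P1 ::
  "('p, 'e::euclidean_space) mfd \<Rightarrow> ('p \<Rightarrow> 'm) \<Rightarrow> ('m, real^'n) mfd \<Rightarrow>
   (real^'n^'n, 'k::euclidean_space) mfd \<Rightarrow> ('p \<Rightarrow> 'e \<Rightarrow> real^'n) \<Rightarrow> 'n::finite bil set \<Rightarrow>
   ('p \<times> 'e set, ((real^'n) \<times> 'k) \<times> ('k^'n)) mfd" where
  "P1 P p M G \<theta> \<dd> = sub_mfd (J1 P p M G) (P1_set P p M \<theta> \<dd>)"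

definition p1 :: "'p \<times> 'e set \<Rightarrow> 'p" where
  "p1 = fst"

definition vert_proj ::
  "('p, 'e::euclidean_space) mfd \<Rightarrow> ('p \<Rightarrow> 'm) \<Rightarrow> ('m, 'f::euclidean_space) mfd \<Rightarrow>
   'p \<times> 'e set \<Rightarrow> 'e \<Rightarrow> 'e" where
  "vert_proj P p M = (\<lambda>(u, H) \<xi>. THE a. a \<in> vert P p M u \<and> \<xi> - a \<in> H)"

definition omega ::
  "('p, 'e::euclidean_space) mfd \<Rightarrow> ('p \<Rightarrow> 'm) \<Rightarrow> ('m, real^'n) mfd \<Rightarrow>
   (real^'n^'n, 'k::euclidean_space) mfd \<Rightarrow> ('p \<Rightarrow> real^'n^'n \<Rightarrow> 'p) \<Rightarrow>
   ('p \<Rightarrow> 'e \<Rightarrow> real^'n) \<Rightarrow> 'n::finite bil set \<Rightarrow>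
   'p \<times> 'e set \<Rightarrow> ((real^'n) \<times> 'k) \<times> ('k^'n) \<Rightarrow> real^'n^'n" where
  "omega P p M G act \<theta> \<dd> j \<xi> = (THE X. X \<in> lie_alg G \<and>
     fund_vf P G act X (p1 j) = vert_proj P p M j (tmap (P1 P p M G \<theta> \<dd>) P p1 j \<xi>))"

definition theta1 ::
  "('p, 'e::euclidean_space) mfd \<Rightarrow> ('p \<Rightarrow> 'm) \<Rightarrow> ('m, real^'n) mfd \<Rightarrow>
   (real^'n^'n, 'k::euclidean_space) mfd \<Rightarrow> ('p \<Rightarrow> real^'n^'n \<Rightarrow> 'p) \<Rightarrow>
   ('p \<Rightarrow> 'e \<Rightarrow> real^'n) \<Rightarrow> 'n::finite bil set \<Rightarrow>
   'p \<times> 'e set \<Rightarrow> ((real^'n) \<times> 'k) \<times> ('k^'n) \<Rightarrow> (real^'n^'n) \<times> (real^'n)" where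
  "theta1 P p M G act \<theta> \<dd> j \<xi> =
     (omega P p M G act \<theta> \<dd> j \<xi>, \<theta> (p1 j) (tmap (P1 P p M G \<theta> \<dd>) P p1 j \<xi>))"

end

theory Submission
  imports Defs
begin

text \<open>A horizontal subspace at \<open>u\<close> is a right inverse of \<open>\<theta>\<close> at \<open>u\<close>. By Cartan's formula
  \<open>d\<theta>(\<zeta>_X, \<xi>) = -X \<theta>(\<xi>)\<close>, so adding \<open>\<zeta> \<circ> A\<close> with \<open>A \<in> Hom(V, g)\<close> to it changes the torsion by
  \<open>-\<delta> A\<close>. As \<open>\<delta>\<close> is injective (type 1) with image complementary to \<open>d\<close>, there is exactly one
  horizontal subspace at \<open>u\<close> with torsion in \<open>d\<close>. It depends smoothly on \<open>u\<close>, so \<open>P^1\<close> is the image of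
  a smooth section of \<open>J^1 P\<close>, and equivariantly, because \<open>d\<close> is a \<open>G\<close>-submodule. The form \<open>\<kappa>\<close> on \<open>P\<close>
  corresponding to \<open>\<theta>^1\<close> is therefore pointwise invertible and equivariant for \<open>Ad(g^{-1})\<close> on the
  semidirect product. Cartan's formula for \<open>\<kappa>\<close> gives \<open>d\<kappa>(\<zeta>_Y, .) = -[Y, \<kappa>(.)]\<close> for \<open>Y\<close> in
  the Lie algebra of \<open>G\<close>, which is the bracket condition.\<close>

section \<open>Calculus\<close>

text \<open>Two features of the setting shape the proof. Model spaces are linear subspaces of
  Euclidean spaces, so a smooth function is only locally the restriction of a smooth function on an
  open set, and it determines only the derivatives in directions of the model space; the calculus is
  therefore carried out with \<open>dderiv\<close> in such directions. Tangent vectors are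
  coordinates in a chart chosen arbitrarily at each point, so smoothness is always tested after
  moving to one fixed chart with \<open>coords\<close> and \<open>uncoords\<close>. The horizontal
  subspace with torsion in \<open>\<dd>\<close> is smooth for a reason of linear algebra: the
  correction \<open>A\<close> depends linearly on the torsion of a given horizontal subspace, and a
  local coordinate field of horizontal subspaces has smooth torsion. The form on \<open>P\<close> is
  found through its inverse, a smooth family of isomorphisms. The model space of \<open>P1\<close>
  results from an unspecified choice. Hence nothing is computed in its charts; only its points and
  the smoothness of maps into it and out of it are used.\<close>

lemma Ck_on_cong:
  assumes "Ck_on k U f" "open U" "\<And>x. x \<in> U \<Longrightarrow> f x = g x"
  shows "Ck_on k U g"
  using assms
proof (induction k arbitrary: f g)
  case 0
  then show ?case by (simp cong: continuous_on_cong)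
next
  case (Suc k)
  have fd: "frechet_derivative f (at x) = frechet_derivative g (at x)" if "x \<in> U" for x
    using Suc.prems that by (intro frechet_derivative_transform_within_open[of f x U]) auto
  have "g differentiable (at x)" if "x \<in> U" for x
    using Suc.prems that has_derivative_transform_within_open[of f _ x UNIV U g]
    unfolding differentiable_def by (metis Ck_on.simps(2) differentiable_def)
  then show ?case
    using Suc.IH[of "\<lambda>x. frechet_derivative f (at x) v" "\<lambda>x. frechet_derivative g (at x) v" for v] Suc.prems fd
    by simp
qed

text \<open>\<open>Ck_on\<close> speaks of the chosen \<open>frechet_derivative\<close>; this admits
  an explicit formula \<open>F\<close> instead. On an open set derivatives are unique, so the two
  agree.\<close>

lemma Ck_on_SucI:
  assumes "open U" "\<And>x. x \<in> U \<Longrightarrow> (f has_derivative F x) (at x)" "\<And>v. Ck_on k U (\<lambda>x. F x v)"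
  shows "Ck_on (Suc k) U f"
proof -
  have "frechet_derivative f (at x) = F x" if "x \<in> U" for x
    using assms(2)[OF that] frechet_derivative_at by metis
  then have "Ck_on k U (\<lambda>x. frechet_derivative f (at x) v)" for v
    using Ck_on_cong[OF assms(3)[of v] assms(1)] by simp
  then show ?thesis using assms(2) by (auto simp: differentiable_def)
qed

lemma Ck_on_Suc_deriv:
  assumes "Ck_on (Suc k) U f" "x \<in> U"
  shows "(f has_derivative frechet_derivative f (at x)) (at x)"
  using assms by (simp add: frechet_derivative_works)

lemma Ck_on_SucD: "Ck_on (Suc k) U f \<Longrightarrow> Ck_on k U f"
proof (induction k arbitrary: f)
  case 0
  then show ?case
    by (auto intro!: differentiable_imp_continuous_on differentiable_at_imp_differentiable_on)
next
  case (Suc k)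
  then show ?case by (auto simp del: Ck_on.simps(1))
qed

lemma Ck_on_subset: "Ck_on k U f \<Longrightarrow> V \<subseteq> U \<Longrightarrow> Ck_on k V f"
  by (induction k arbitrary: f) (auto intro: continuous_on_subset)

lemma Ck_on_const: "open U \<Longrightarrow> Ck_on k U (\<lambda>x. c)"
proof (induction k arbitrary: c)
  case (Suc k)
  show ?case by (rule Ck_on_SucI[where F="\<lambda>x v. 0"]) (use Suc in auto)
qed auto

lemma Ck_on_linear:
  assumes "Ck_on k U f" "open U" "bounded_linear L"
  shows "Ck_on k U (\<lambda>x. L (f x))"
  using assms(1)
proof (induction k arbitrary: f)
  case 0
  then show ?case by (simp add: bounded_linear.continuous_on[OF assms(3)])
next
  case (Suc k)
  show ?case
    by (rule Ck_on_SucI[OF assms(2), where F="\<lambda>x v. L (frechet_derivative f (at x) v)"])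
       (use Suc in \<open>auto intro!: bounded_linear.has_derivative[OF assms(3)] simp: frechet_derivative_works[symmetric]\<close>)
qed

lemma Ck_on_add:
  assumes "Ck_on k U f" "Ck_on k U g" "open U"
  shows "Ck_on k U (\<lambda>x. f x + g x)"
  using assms(1,2)
proof (induction k arbitrary: f g)
  case 0
  then show ?case by (simp add: continuous_on_add)
next
  case (Suc k)
  show ?case
    by (rule Ck_on_SucI[OF assms(3), where F="\<lambda>x v. frechet_derivative f (at x) v + frechet_derivative g (at x) v"])
       (use Suc in \<open>auto intro!: has_derivative_add simp: frechet_derivative_works[symmetric]\<close>)
qed

text \<open>Serves for scalar multiples, real products and matrix products alike. The Leibniz rule
  gives two products of the same kind with a factor differentiated, so the induction leaves
  \<open>f\<close> and \<open>g\<close> arbitrary.\<close>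

lemma Ck_on_bilinear:
  assumes "Ck_on k U f" "Ck_on k U g" "open U" "bounded_bilinear b"
  shows "Ck_on k U (\<lambda>x. b (f x) (g x))"
  using assms(1,2)
proof (induction k arbitrary: f g)
  case 0
  then show ?case by (simp add: bounded_bilinear.continuous_on[OF assms(4)])
next
  case (Suc k)
  show ?case
  proof (rule Ck_on_SucI[OF assms(3)])
    show "((\<lambda>x. b (f x) (g x)) has_derivative
      (\<lambda>v. b (f x) (frechet_derivative g (at x) v) + b (frechet_derivative f (at x) v) (g x))) (at x)"
      if "x \<in> U" for x
      using bounded_bilinear.FDERIV[OF assms(4) Ck_on_Suc_deriv[OF Suc.prems(1) that] Ck_on_Suc_deriv[OF Suc.prems(2) that]] .
    show "Ck_on k U (\<lambda>x. b (f x) (frechet_derivative g (at x) v) + b (frechet_derivative f (at x) v) (g x))" for v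
      by (intro Ck_on_add Suc.IH assms(3)) (use Suc.prems Ck_on_SucD in auto)
  qed
qed

lemma Ck_on_sum:
  assumes "finite I" "\<And>i. i \<in> I \<Longrightarrow> Ck_on k U (f i)" "open U"
  shows "Ck_on k U (\<lambda>x. \<Sum>i\<in>I. f i x)"
  using assms
proof (induction I)
  case empty
  then show ?case by (simp add: Ck_on_const)
next
  case (insert i I)
  then show ?case using Ck_on_add[of k U "f i" "\<lambda>x. \<Sum>i\<in>I. f i x"] by simp
qed

lemma linear_Basis_expand:
  fixes D :: "'a::euclidean_space \<Rightarrow> 'b::real_vector"
  assumes "linear D"
  shows "D v = (\<Sum>i\<in>Basis. (v \<bullet> i) *\<^sub>R D i)"
  by (subst euclidean_representation[symmetric, of v]) (simp add: linear_sum[OF assms] linear_scale[OF assms])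

text \<open>\<open>Ck_on\<close> controls derivatives only in fixed directions, whereas the chain
  rule differentiates \<open>g\<close> in a direction that varies with \<open>x\<close>. Expanding
  this direction in the standard basis leaves fixed directions with smooth coefficients.\<close>

lemma Ck_on_compose:
  fixes f :: "'a::real_normed_vector \<Rightarrow> 'b::euclidean_space"
  assumes "Ck_on k V g" "Ck_on k U f" "open U" "open V" "f ` U \<subseteq> V"
  shows "Ck_on k U (\<lambda>x. g (f x))"
  using assms(1,2)
proof (induction k arbitrary: g)
  case 0
  then show ?case using continuous_on_compose2[of V g U f] assms(5) by simp
next
  case (Suc k)
  let ?F = "\<lambda>x v. \<Sum>i\<in>Basis. (frechet_derivative f (at x) v \<bullet> i) *\<^sub>R frechet_derivative g (at (f x)) i"
  show ?case
  proof (rule Ck_on_SucI[OF assms(3), where F="?F"])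
    fix x assume x: "x \<in> U"
    then have fx: "f x \<in> V" using assms(5) by auto
    have g: "(g has_derivative frechet_derivative g (at (f x))) (at (f x))"
      using Ck_on_Suc_deriv[OF Suc.prems(1) fx] .
    have "((\<lambda>x. g (f x)) has_derivative (\<lambda>v. frechet_derivative g (at (f x)) (frechet_derivative f (at x) v))) (at x)"
      by (rule has_derivative_compose[OF Ck_on_Suc_deriv[OF Suc.prems(2) x] g])
    moreover have "(\<lambda>v. frechet_derivative g (at (f x)) (frechet_derivative f (at x) v)) = ?F x"
      by (rule ext, rule linear_Basis_expand[OF has_derivative_linear[OF g]])
    ultimately show "((\<lambda>x. g (f x)) has_derivative ?F x) (at x)" by simp
  next
    fix v
    show "Ck_on k U (\<lambda>x. ?F x v)"
    proof (intro Ck_on_sum assms(3) finite_Basis Ck_on_bilinear[OF _ _ _ bounded_bilinear_scaleR])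
      fix i :: 'b assume "i \<in> Basis"
      show "Ck_on k U (\<lambda>x. frechet_derivative f (at x) v \<bullet> i)"
        using Suc.prems Ck_on_linear[OF _ assms(3) bounded_linear_inner_left, of k "\<lambda>x. frechet_derivative f (at x) v" i]
        by simp
      show "Ck_on k U (\<lambda>x. frechet_derivative g (at (f x)) i)"
        using Suc.IH[of "\<lambda>y. frechet_derivative g (at y) i"] Suc.prems Ck_on_SucD[of k U f] by simp
    qed
  qed
qed

text \<open>The derivative of the inverse is a polynomial in the inverse itself, so the induction
  closes.\<close>

lemma Ck_on_inverse: "Ck_on k (- {0}) (inverse :: real \<Rightarrow> real)"
proof (induction k)
  case 0
  show ?case by (auto intro!: continuous_intros)
next
  case (Suc k)
  show ?case
  proof (rule Ck_on_SucI[where F="\<lambda>x v. v *\<^sub>R - (inverse x * inverse x)"])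
    show "Ck_on k (- {0}) (\<lambda>x::real. v *\<^sub>R - (inverse x * inverse x))" for v :: real
    proof -
      have "Ck_on k (- {0}) (\<lambda>x. inverse x * inverse x :: real)"
        by (rule Ck_on_bilinear[OF Suc Suc _ bounded_bilinear_mult]) (simp add: open_Compl)
      then have "Ck_on k (- {0}) (\<lambda>x. (- v) *\<^sub>R (inverse x * inverse x :: real))"
        by (rule Ck_on_linear[OF _ _ bounded_linear_scaleR_right]) (simp add: open_Compl)
      then show ?thesis by simp
    qed
  qed (auto intro!: derivative_eq_intros)
qed

section \<open>Smooth functions on arbitrary sets\<close>

lemma smooth_onI_Ck: "open U \<Longrightarrow> (\<And>k. Ck_on k U f) \<Longrightarrow> smooth_on U f"
  unfolding smooth_on_def by blast

lemma smooth_on_transfer: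
  assumes "smooth_on S f" "T \<subseteq> S" "\<And>x. x \<in> T \<Longrightarrow> f x = g x"
  shows "smooth_on T g"
  unfolding smooth_on_def
proof
  fix x assume "x \<in> T"
  with assms(1,2) obtain U h where "open U" "x \<in> U" "\<forall>k. Ck_on k U h" "\<forall>y\<in>S \<inter> U. f y = h y"
    unfolding smooth_on_def by (meson subsetD)
  then show "\<exists>U h. open U \<and> x \<in> U \<and> (\<forall>k. Ck_on k U h) \<and> (\<forall>y\<in>T \<inter> U. g y = h y)"
    using assms(2) by (intro exI[of _ U] exI[of _ h]) (auto simp flip: assms(3))
qed

lemma smooth_on_cong: "smooth_on S f \<Longrightarrow> (\<And>x. x \<in> S \<Longrightarrow> f x = g x) \<Longrightarrow> smooth_on S g"
  by (rule smooth_on_transfer[OF _ subset_refl])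

lemma smooth_on_subset: "smooth_on S f \<Longrightarrow> T \<subseteq> S \<Longrightarrow> smooth_on T f"
  by (rule smooth_on_transfer) auto

lemma smooth_on_local:
  assumes "\<And>x. x \<in> S \<Longrightarrow> \<exists>U. open U \<and> x \<in> U \<and> smooth_on (S \<inter> U) f"
  shows "smooth_on S f"
  unfolding smooth_on_def
proof
  fix x assume x: "x \<in> S"
  then obtain U where U: "open U" "x \<in> U" "smooth_on (S \<inter> U) f" using assms by blast
  with x obtain W g where W: "open W" "x \<in> W" "\<forall>k. Ck_on k W g" "\<forall>y\<in>S \<inter> U \<inter> W. f y = g y"
    unfolding smooth_on_def by blast
  then show "\<exists>U g. open U \<and> x \<in> U \<and> (\<forall>k. Ck_on k U g) \<and> (\<forall>y\<in>S \<inter> U. f y = g y)"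
    using U by (intro exI[of _ "U \<inter> W"] exI[of _ g]) (auto intro: Ck_on_subset)
qed

lemma smooth_on_local_openin:
  assumes "\<And>x. x \<in> S \<Longrightarrow> \<exists>U. openin (top_of_set S) U \<and> x \<in> U \<and> smooth_on U f"
  shows "smooth_on S f"
proof (rule smooth_on_local)
  fix x assume "x \<in> S"
  then obtain U where U: "openin (top_of_set S) U" "x \<in> U" "smooth_on U f" using assms by blast
  then obtain W where "open W" "U = S \<inter> W" unfolding openin_open by blast
  then show "\<exists>U. open U \<and> x \<in> U \<and> smooth_on (S \<inter> U) f" using U by blast
qed

lemma smooth_on_const: "smooth_on S (\<lambda>x. c)"
  unfolding smooth_on_def using Ck_on_const[OF open_UNIV] by blast

lemma smooth_on_linear:
  assumes "smooth_on S f" "bounded_linear L"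
  shows "smooth_on S (\<lambda>x. L (f x))"
  unfolding smooth_on_def
proof
  fix x assume "x \<in> S"
  with assms(1) obtain U g where "open U" "x \<in> U" "\<forall>k. Ck_on k U g" "\<forall>y\<in>S \<inter> U. f y = g y"
    unfolding smooth_on_def by meson
  then show "\<exists>U g. open U \<and> x \<in> U \<and> (\<forall>k. Ck_on k U g) \<and> (\<forall>y\<in>S \<inter> U. L (f y) = g y)"
    by (intro exI[of _ U] exI[of _ "\<lambda>x. L (g x)"]) (auto intro!: Ck_on_linear[OF _ _ assms(2)])
qed

lemma Ck_on_ident: "Ck_on k (UNIV :: 'a::real_normed_vector set) (\<lambda>x. x)"
proof (induction k)
  case (Suc k)
  show ?case by (rule Ck_on_SucI[where F="\<lambda>x v. v"]) (auto intro: Ck_on_const)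
qed auto

lemma smooth_on_ident: "smooth_on S (\<lambda>x. x)"
  by (rule smooth_on_subset[OF smooth_onI_Ck[OF open_UNIV]]) (auto intro: Ck_on_ident)

lemma smooth_on_bilinear:
  assumes "smooth_on S f" "smooth_on S g" "bounded_bilinear b"
  shows "smooth_on S (\<lambda>x. b (f x) (g x))"
  unfolding smooth_on_def
proof
  fix x assume x: "x \<in> S"
  with assms(1) obtain U f' where U: "open U" "x \<in> U" "\<forall>k. Ck_on k U f'" "\<forall>y\<in>S \<inter> U. f y = f' y"
    unfolding smooth_on_def by meson
  from x assms(2) obtain W g' where W: "open W" "x \<in> W" "\<forall>k. Ck_on k W g'" "\<forall>y\<in>S \<inter> W. g y = g' y"
    unfolding smooth_on_def by meson
  show "\<exists>U h. open U \<and> x \<in> U \<and> (\<forall>k. Ck_on k U h) \<and> (\<forall>y\<in>S \<inter> U. b (f y) (g y) = h y)"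
  proof (intro exI[of _ "U \<inter> W"] exI[of _ "\<lambda>x. b (f' x) (g' x)"] conjI allI ballI)
    show "Ck_on k (U \<inter> W) (\<lambda>x. b (f' x) (g' x))" for k
      by (rule Ck_on_bilinear[OF Ck_on_subset[of k U f'] Ck_on_subset[of k W g'] _ assms(3)]) (use U W in auto)
  qed (use U W in auto)
qed

lemma smooth_on_add: 
  assumes "smooth_on S f" "smooth_on S g"
  shows "smooth_on S (\<lambda>x. f x + g x)"
  unfolding smooth_on_def
proof
  fix x assume x: "x \<in> S"
  with assms(1) obtain U f' where U: "open U" "x \<in> U" "\<forall>k. Ck_on k U f'" "\<forall>y\<in>S \<inter> U. f y = f' y"
    unfolding smooth_on_def by meson
  from x assms(2) obtain W g' where W: "open W" "x \<in> W" "\<forall>k. Ck_on k W g'" "\<forall>y\<in>S \<inter> W. g y = g' y"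
    unfolding smooth_on_def by meson
  show "\<exists>U h. open U \<and> x \<in> U \<and> (\<forall>k. Ck_on k U h) \<and> (\<forall>y\<in>S \<inter> U. f y + g y = h y)"
  proof (intro exI[of _ "U \<inter> W"] exI[of _ "\<lambda>x. f' x + g' x"] conjI allI ballI)
    show "Ck_on k (U \<inter> W) (\<lambda>x. f' x + g' x)" for k
      by (rule Ck_on_add[OF Ck_on_subset[of k U f'] Ck_on_subset[of k W g']]) (use U W in auto)
  qed (use U W in auto)
qed

lemma smooth_on_scaleR: "smooth_on S f \<Longrightarrow> smooth_on S g \<Longrightarrow> smooth_on S (\<lambda>x. f x *\<^sub>R g x)"
  by (rule smooth_on_bilinear[OF _ _ bounded_bilinear_scaleR])

lemma smooth_on_minus: "smooth_on S f \<Longrightarrow> smooth_on S (\<lambda>x. - f x)"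
  by (rule smooth_on_linear[OF _ bounded_linear_minus[OF bounded_linear_ident]])

lemma smooth_on_diff: "smooth_on S f \<Longrightarrow> smooth_on S g \<Longrightarrow> smooth_on S (\<lambda>x. f x - g x)"
  using smooth_on_add[OF _ smooth_on_minus, of S f g] by simp

lemma smooth_on_sum:
  assumes "finite I" "\<And>i. i \<in> I \<Longrightarrow> smooth_on S (f i)"
  shows "smooth_on S (\<lambda>x. \<Sum>i\<in>I. f i x)"
  using assms
proof (induction I)
  case (insert i I)
  then show ?case using smooth_on_add[of S "f i" "\<lambda>x. \<Sum>i\<in>I. f i x"] by simp
qed (simp add: smooth_on_const)

lemma smooth_on_Pair:
  assumes "smooth_on S f" "smooth_on S g"
  shows "smooth_on S (\<lambda>x. (f x, g x))"
  using smooth_on_add[OF smooth_on_linear[OF assms(1) bounded_linear_Pair[OF bounded_linear_ident bounded_linear_zero]]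
      smooth_on_linear[OF assms(2) bounded_linear_Pair[OF bounded_linear_zero bounded_linear_ident]]]
  by simp

lemma smooth_on_fst: "smooth_on S f \<Longrightarrow> smooth_on S (\<lambda>x. fst (f x))"
  by (rule smooth_on_linear[OF _ bounded_linear_fst])

lemma smooth_on_snd: "smooth_on S f \<Longrightarrow> smooth_on S (\<lambda>x. snd (f x))"
  by (rule smooth_on_linear[OF _ bounded_linear_snd])

lemma smooth_on_continuous: "smooth_on S f \<Longrightarrow> continuous_on S f"
  unfolding continuous_on_eq_continuous_within
proof
  fix x assume "smooth_on S f" and x: "x \<in> S"
  then obtain U g where U: "open U" "x \<in> U" "\<forall>k. Ck_on k U g" "\<forall>y\<in>S \<inter> U. f y = g y"
    unfolding smooth_on_def by meson
  then have "continuous_on U g" by (metis Ck_on.simps(1))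
  then have "continuous (at x within S) g"
    using U(1,2) continuous_at_imp_continuous_within continuous_on_eq_continuous_at by blast
  then show "continuous (at x within S) f"
    using U x by (intro continuous_transform_within_openin[of x S g "S \<inter> U" f]) auto
qed

lemma smooth_on_compose:
  assumes "smooth_on T g" "smooth_on S f" "f ` S \<subseteq> T"
  shows "smooth_on S (\<lambda>x. g (f x))"
  unfolding smooth_on_def
proof
  fix x assume x: "x \<in> S"
  with assms(2) obtain U f' where U: "open U" "x \<in> U" "\<forall>k. Ck_on k U f'" "\<forall>y\<in>S \<inter> U. f y = f' y"
    unfolding smooth_on_def by meson
  have "f x \<in> T" using assms(3) x by auto
  with assms(1) obtain W g' where W: "open W" "f x \<in> W" "\<forall>k. Ck_on k W g'" "\<forall>y\<in>T \<inter> W. g y = g' y"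
    unfolding smooth_on_def by meson
  \<comment> \<open>The two extensions can be composed only where that of \<open>f\<close> lands in
    the domain of that of \<open>g\<close>.\<close>
  have o: "open (U \<inter> f' -` W)"
    using U W by (metis Ck_on.simps(1) continuous_open_preimage)
  have "Ck_on k (U \<inter> f' -` W) (\<lambda>x. g' (f' x))" for k
    by (rule Ck_on_compose[OF _ Ck_on_subset[of k U f'], of W g']) (use U W o in auto)
  then show "\<exists>U h. open U \<and> x \<in> U \<and> (\<forall>k. Ck_on k U h) \<and> (\<forall>y\<in>S \<inter> U. g (f y) = h y)"
    using U W o x assms(3)
    by (intro exI[of _ "U \<inter> f' -` W"] exI[of _ "\<lambda>x. g' (f' x)"] conjI allI ballI) (auto simp: image_subset_iff)
qed

lemma smooth_on_inverse:
  fixes f :: "_ \<Rightarrow> real"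
  assumes "smooth_on S f" "\<And>x. x \<in> S \<Longrightarrow> f x \<noteq> 0"
  shows "smooth_on S (\<lambda>x. inverse (f x))"
  by (rule smooth_on_compose[OF smooth_onI_Ck[OF _ Ck_on_inverse] assms(1)]) (use assms(2) in auto)

section \<open>Directional derivatives on relatively open subsets of a subspace\<close>

definition ropen :: "'e::euclidean_space set \<Rightarrow> 'e set \<Rightarrow> bool" where
  "ropen E S \<longleftrightarrow> subspace E \<and> openin (top_of_set E) S"

lemma ropen_subset: "ropen E S \<Longrightarrow> S \<subseteq> E"
  unfolding ropen_def using openin_imp_subset by blast

lemma ropen_Times: "ropen E S \<Longrightarrow> ropen F T \<Longrightarrow> ropen (E \<times> F) (S \<times> T)"
  unfolding ropen_def by (simp add: openin_Times subspace_Times)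

lemma ropen_Int_open: "ropen E S \<Longrightarrow> open U \<Longrightarrow> ropen E (S \<inter> U)"
  unfolding ropen_def by (simp add: openin_Int_open)

lemma ropen_self: "subspace E \<Longrightarrow> ropen E E"
  unfolding ropen_def by simp

lemma ropen_preimage:
  assumes "ropen E S" "ropen F T" "continuous_on S f" "f ` S \<subseteq> F"
  shows "ropen E (S \<inter> f -` T)"
  using assms continuous_openin_preimage[of S f F T] openin_trans[of S "S \<inter> f -` T" E]
  unfolding ropen_def by (auto simp: image_subset_iff_funcset)

text \<open>A line through \<open>x\<close> in a direction of \<open>E\<close> stays in
  \<open>E\<close>, and in \<open>S\<close> for small parameters. So a derivative within
  \<open>S\<close> determines the two-sided derivative along the line, although \<open>S\<close> may
  have empty interior.\<close>

lemma dderiv_has_vector_derivative: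
  assumes "ropen E S" "x \<in> S" "v \<in> E" "(f has_derivative D) (at x within S)"
  shows "((\<lambda>s. f (x + s *\<^sub>R v)) has_vector_derivative D v) (at 0)"
proof -
  obtain U where U: "open U" "S = E \<inter> U" using assms(1) unfolding ropen_def openin_open by blast
  let ?h = "\<lambda>s. x + s *\<^sub>R v"
  let ?T = "?h -` U"
  have T: "open ?T" by (intro open_vimage U continuous_intros)
  have x: "x \<in> E" "x \<in> U" using assms(2) U by auto
  have E: "subspace E" using assms(1) by (simp add: ropen_def)
  have h: "(?h has_derivative (\<lambda>s. s *\<^sub>R v)) (at 0 within ?T)"
    by (auto intro!: derivative_eq_intros)
  have hT: "?h ` ?T \<subseteq> S" using U x E assms(3) by (auto intro!: subspace_add subspace_scale)
  have "((\<lambda>s. f (?h s)) has_derivative (\<lambda>s. D (s *\<^sub>R v))) (at 0 within ?T)"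
    by (rule has_derivative_in_compose[OF h]) (use has_derivative_subset[OF assms(4) hT] in simp)
  then have "((\<lambda>s. f (?h s)) has_derivative (\<lambda>s. s *\<^sub>R D v)) (at 0)"
    using T x at_within_open[of 0 ?T] linear_scale[OF has_derivative_linear[OF assms(4)]] by simp
  then show ?thesis by (simp add: has_vector_derivative_def)
qed

lemma dderiv_eq:
  assumes "ropen E S" "x \<in> S" "v \<in> E" "(f has_derivative D) (at x within S)"
  shows "dderiv f x v = D v"
  unfolding dderiv_def by (rule vector_derivative_at[OF dderiv_has_vector_derivative[OF assms]])

text \<open>In directions transverse to \<open>E\<close> the derivative of the extension depends on
  the extension; this is the reason for \<open>v \<in> E\<close> in the last conclusion.\<close>

lemma smooth_on_extension:
  assumes "ropen E S" "smooth_on S f" "x \<in> S"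
  obtains U g where "open U" "x \<in> U" "\<And>k. Ck_on k U g" "\<And>y. y \<in> S \<inter> U \<Longrightarrow> f y = g y"
    "\<And>y. y \<in> S \<inter> U \<Longrightarrow> (f has_derivative frechet_derivative g (at y)) (at y within S)"
    "\<And>y v. y \<in> S \<inter> U \<Longrightarrow> v \<in> E \<Longrightarrow> dderiv f y v = frechet_derivative g (at y) v"
proof -
  obtain U g where U: "open U" "x \<in> U" "\<forall>k. Ck_on k U g" "\<forall>y\<in>S \<inter> U. f y = g y"
    using assms(2,3) unfolding smooth_on_def by meson
  have d: "(f has_derivative frechet_derivative g (at y)) (at y within S)" if y: "y \<in> S \<inter> U" for y
  proof -
    have "(g has_derivative frechet_derivative g (at y)) (at y within S)"
      by (rule has_derivative_at_withinI[OF Ck_on_Suc_deriv[OF spec[OF U(3), of "Suc 0"]]]) (use y in simp)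
    moreover obtain e where "e > 0" "ball y e \<subseteq> U" using U(1) y open_contains_ball by (metis IntD2)
    ultimately show ?thesis
      by (intro has_derivative_transform_within[of g _ y S e f]) (use U(4) y in \<open>auto simp: dist_commute subset_iff\<close>)
  qed
  show thesis
  proof (rule that[of U g])
    show "Ck_on k U g" for k using U(3) by blast
  qed (use U(1,2,4) d dderiv_eq[OF assms(1)] in \<open>blast+\<close>)
qed

lemma smooth_on_deriv:
  assumes "ropen E S" "smooth_on S f" "x \<in> S"
  obtains D where "(f has_derivative D) (at x within S)" "linear D" "\<And>v. v \<in> E \<Longrightarrow> dderiv f x v = D v"
proof -
  obtain U g where "open U" "x \<in> U" "\<And>y. y \<in> S \<inter> U \<Longrightarrow> (f has_derivative frechet_derivative g (at y)) (at y within S)"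
    "\<And>y v. y \<in> S \<inter> U \<Longrightarrow> v \<in> E \<Longrightarrow> dderiv f y v = frechet_derivative g (at y) v"
    using smooth_on_extension[OF assms] by metis
  then show thesis using that has_derivative_linear assms(3) by blast
qed

lemma dderiv_lin_on: "ropen E S \<Longrightarrow> smooth_on S f \<Longrightarrow> x \<in> S \<Longrightarrow> lin_on E (dderiv f x)"
  unfolding lin_on_def
  by (rule smooth_on_deriv, assumption+) (auto simp: linear_add linear_scale ropen_def subspace_add subspace_scale)

lemma dderiv_cong:
  assumes "ropen E S" "smooth_on S f" "x \<in> S" "v \<in> E" "\<And>y. y \<in> S \<Longrightarrow> f y = g y"
  shows "dderiv g x v = dderiv f x v"
proof -
  obtain D where "(f has_derivative D) (at x within S)" "dderiv f x v = D v"
    using smooth_on_deriv[OF assms(1-3)] assms(4) by metis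
  then show ?thesis
    using dderiv_eq[OF assms(1,3,4), of g D] has_derivative_transform[of x S g f D] assms(3,5) by simp
qed

text \<open>The difference quotients lie in \<open>F\<close>, and a subspace of a Euclidean space is
  closed. This makes derivatives of chart transitions map one model space into the other.\<close>

lemma dderiv_mem:
  fixes f :: "'a::euclidean_space \<Rightarrow> 'b::euclidean_space"
  assumes "ropen E S" "smooth_on S f" "x \<in> S" "v \<in> E" "subspace F" "f ` S \<subseteq> F"
  shows "dderiv f x v \<in> F"
proof -
  obtain D where D: "(f has_derivative D) (at x within S)" "dderiv f x v = D v"
    using smooth_on_deriv[OF assms(1-3)] assms(4) by metis
  obtain U where U: "open U" "S = E \<inter> U" using assms(1) unfolding ropen_def openin_open by blast
  let ?h = "\<lambda>s. x + s *\<^sub>R v"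
  have T: "open (?h -` U)" "0 \<in> ?h -` U" using assms(3) U by (auto intro!: open_vimage continuous_intros)
  have S: "?h s \<in> S" if "s \<in> ?h -` U" for s
    using that U assms(1,3,4) by (auto intro!: subspace_add subspace_scale simp: ropen_def)
  have "((\<lambda>s. (f (?h s) - f x) /\<^sub>R s) \<longlongrightarrow> D v) (at 0)"
  proof -
    have "((\<lambda>s. (f (?h s) - f x - s *\<^sub>R D v) /\<^sub>R \<bar>s\<bar>) \<longlongrightarrow> 0) (at 0)"
      using dderiv_has_vector_derivative[OF assms(1,3,4) D(1)]
      by (simp add: has_vector_derivative_def has_derivative_def)
    then have lim: "((\<lambda>s. norm ((f (?h s) - f x - s *\<^sub>R D v) /\<^sub>R \<bar>s\<bar>)) \<longlongrightarrow> 0) (at 0)"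
      by (rule tendsto_norm_zero)
    have eq: "norm ((f (?h s) - f x - s *\<^sub>R D v) /\<^sub>R \<bar>s\<bar>) = norm ((f (?h s) - f x) /\<^sub>R s - D v)" if "s \<noteq> 0" for s
    proof -
      have "(f (?h s) - f x) /\<^sub>R s - D v = (f (?h s) - f x - s *\<^sub>R D v) /\<^sub>R s"
        using that by (simp add: scaleR_right_diff_distrib)
      then show ?thesis by simp
    qed
    have "((\<lambda>s. norm ((f (?h s) - f x) /\<^sub>R s - D v)) \<longlongrightarrow> 0) (at 0)"
      by (rule Lim_transform_eventually[OF lim]) (use eq in \<open>auto simp: eventually_at intro!: exI[of _ 1]\<close>)
    then show ?thesis using tendsto_norm_zero_iff LIM_zero_iff by blast
  qed
  moreover have "eventually (\<lambda>s. (f (?h s) - f x) /\<^sub>R s \<in> F) (at 0)"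
    unfolding eventually_at_topological using T S assms(3,5,6)
    by (intro exI[of _ "?h -` U"]) (auto intro!: subspace_diff subspace_scale)
  ultimately show ?thesis
    using Lim_in_closed_set[OF closed_subspace[OF assms(5)]] D(2) by (metis trivial_limit_at)
qed

lemma dderiv_chain:
  assumes "ropen E S" "smooth_on S f" "x \<in> S" "v \<in> E" "ropen F T" "smooth_on T g" "f ` S \<subseteq> T"
  shows "dderiv (\<lambda>x. g (f x)) x v = dderiv g (f x) (dderiv f x v)"
proof -
  obtain D where D: "(f has_derivative D) (at x within S)" "dderiv f x v = D v"
    using smooth_on_deriv[OF assms(1-3)] assms(4) by metis
  have fx: "f x \<in> T" using assms(3,7) by auto
  obtain D' where D': "(g has_derivative D') (at (f x) within T)" "\<And>v. v \<in> F \<Longrightarrow> dderiv g (f x) v = D' v"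
    using smooth_on_deriv[OF assms(5,6) fx] by metis
  have "dderiv f x v \<in> F"
    by (rule dderiv_mem[OF assms(1-4)]) (use assms(5,7) ropen_subset in \<open>auto simp: ropen_def\<close>)
  moreover have "((\<lambda>x. g (f x)) has_derivative (\<lambda>v. D' (D v))) (at x within S)"
    by (rule has_derivative_in_compose[OF D(1) has_derivative_subset[OF D'(1) assms(7)]])
  ultimately show ?thesis using dderiv_eq[OF assms(1,3,4)] D(2) D'(2) by metis
qed

lemma dderiv_Pair:
  assumes "ropen E S" "smooth_on S f" "smooth_on S g" "x \<in> S" "v \<in> E"
  shows "dderiv (\<lambda>x. (f x, g x)) x v = (dderiv f x v, dderiv g x v)"
proof -
  obtain D where D: "(f has_derivative D) (at x within S)" "dderiv f x v = D v"
    using smooth_on_deriv[OF assms(1,2,4)] assms(5) by metis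
  obtain D' where D': "(g has_derivative D') (at x within S)" "dderiv g x v = D' v"
    using smooth_on_deriv[OF assms(1,3,4)] assms(5) by metis
  show ?thesis
    using dderiv_eq[OF assms(1,4,5) has_derivative_Pair[OF D(1) D'(1)]] D(2) D'(2) by simp
qed

lemma dderiv_linear:
  assumes "ropen E S" "smooth_on S f" "x \<in> S" "v \<in> E" "bounded_linear L"
  shows "dderiv (\<lambda>x. L (f x)) x v = L (dderiv f x v)"
proof -
  obtain D where D: "(f has_derivative D) (at x within S)" "dderiv f x v = D v"
    using smooth_on_deriv[OF assms(1-3)] assms(4) by metis
  show ?thesis
    using dderiv_eq[OF assms(1,3,4) bounded_linear.has_derivative[OF assms(5) D(1)]] D(2) by simp
qed

lemma dderiv_bilinear:
  assumes "ropen E S" "smooth_on S f" "smooth_on S g" "x \<in> S" "v \<in> E" "bounded_bilinear b"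
  shows "dderiv (\<lambda>x. b (f x) (g x)) x v = b (f x) (dderiv g x v) + b (dderiv f x v) (g x)"
proof -
  obtain D where D: "(f has_derivative D) (at x within S)" "dderiv f x v = D v"
    using smooth_on_deriv[OF assms(1,2,4)] assms(5) by metis
  obtain D' where D': "(g has_derivative D') (at x within S)" "dderiv g x v = D' v"
    using smooth_on_deriv[OF assms(1,3,4)] assms(5) by metis
  show ?thesis
    using dderiv_eq[OF assms(1,4,5) bounded_bilinear.FDERIV[OF assms(6) D(1) D'(1)]] D(2) D'(2) by simp
qed

lemma dderiv_ident [simp]: "dderiv (\<lambda>x. x) x v = v"
proof -
  have "((\<lambda>s. x + s *\<^sub>R v) has_vector_derivative v) (at 0)"
    unfolding has_vector_derivative_def by (auto intro!: derivative_eq_intros)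
  then show ?thesis unfolding dderiv_def by (rule vector_derivative_at)
qed

lemma dderiv_const [simp]: "dderiv (\<lambda>x. c) x v = 0"
  unfolding dderiv_def by (simp add: vector_derivative_const_at)

text \<open>True for every \<open>f\<close>, smooth or not: both sides differentiate along the same
  line.\<close>

lemma dderiv_fst_slice: "dderiv (\<lambda>y. f (y, z)) x v = dderiv f (x, z) (v, 0)"
  unfolding dderiv_def by simp

lemma dderiv_snd_slice: "dderiv (\<lambda>z. f (y, z)) x v = dderiv f (y, x) (0, v)"
  unfolding dderiv_def by simp

lemma smooth_on_dderiv:
  assumes "ropen E S" "smooth_on S f"
  shows "smooth_on (S \<times> E) (\<lambda>p. dderiv f (fst p) (snd p))"
proof (rule smooth_on_local)
  fix p assume p: "p \<in> S \<times> E"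
  then have "fst p \<in> S" by auto
  then obtain U g where U: "open U" "fst p \<in> U" "\<And>k. Ck_on k U g"
    "\<And>y v. y \<in> S \<inter> U \<Longrightarrow> v \<in> E \<Longrightarrow> dderiv f y v = frechet_derivative g (at y) v"
    using smooth_on_extension[OF assms] by metis
  have lin: "linear (frechet_derivative g (at y))" if "y \<in> U" for y
    using has_derivative_linear[OF Ck_on_Suc_deriv[OF U(3) that]] .
  \<comment> \<open>The standard basis vectors need not lie in \<open>E\<close>. The expansion is
    made for the extension \<open>g\<close>, whose derivative is linear on the whole space, and is
    compared with \<open>dderiv f\<close> only for directions in \<open>E\<close>.\<close>
  have "smooth_on (S \<times> E \<inter> (U \<times> UNIV)) (\<lambda>p. \<Sum>i\<in>Basis. (snd p \<bullet> i) *\<^sub>R frechet_derivative g (at (fst p)) i)"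
  proof (intro smooth_on_sum finite_Basis smooth_on_scaleR)
    fix i :: 'a assume "i \<in> Basis"
    show "smooth_on (S \<times> E \<inter> (U \<times> UNIV)) (\<lambda>p. snd p \<bullet> i)"
      by (rule smooth_on_linear[OF smooth_on_snd[OF smooth_on_ident] bounded_linear_inner_left])
    have "smooth_on U (\<lambda>x. frechet_derivative g (at x) i)"
      using U(3)[of "Suc _"] by (intro smooth_onI_Ck U(1)) auto
    then show "smooth_on (S \<times> E \<inter> (U \<times> UNIV)) (\<lambda>p. frechet_derivative g (at (fst p)) i)"
      by (rule smooth_on_compose[OF _ smooth_on_fst[OF smooth_on_ident]]) auto
  qed
  then have "smooth_on (S \<times> E \<inter> (U \<times> UNIV)) (\<lambda>p. dderiv f (fst p) (snd p))"
    by (rule smooth_on_cong) (use U(4) linear_Basis_expand[OF lin] in \<open>auto simp: \<close>)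
  then show "\<exists>W. open W \<and> p \<in> W \<and> smooth_on (S \<times> E \<inter> W) (\<lambda>p. dderiv f (fst p) (snd p))"
    using U(1,2) p by (intro exI[of _ "U \<times> UNIV"]) (auto simp: open_Times)
qed

lemma smooth_on_dderiv':
  assumes "ropen E S" "smooth_on S f" "smooth_on T g" "smooth_on T h" "g ` T \<subseteq> S" "h ` T \<subseteq> E"
  shows "smooth_on T (\<lambda>x. dderiv f (g x) (h x))"
  using smooth_on_compose[OF smooth_on_dderiv[OF assms(1,2)] smooth_on_Pair[OF assms(3,4)]] assms(5,6)
  by (auto simp: image_subset_iff)

section \<open>Symmetry of second derivatives\<close>

lemma has_derivative_along_line:
  assumes "(F has_derivative F') (at (a + s *\<^sub>R v))"
  shows "((\<lambda>s. F (a + s *\<^sub>R v)) has_derivative (\<lambda>d. d *\<^sub>R F' v)) (at s within T)"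
proof -
  have "((\<lambda>s. a + s *\<^sub>R v) has_derivative (\<lambda>d. d *\<^sub>R v)) (at s within T)"
    by (auto intro!: derivative_eq_intros)
  from has_derivative_compose[OF this assms] show ?thesis
    by (simp add: linear_scale[OF has_derivative_linear[OF assms]])
qed

text \<open>The second difference is the increment, along \<open>v\<close>, of an increment along
  \<open>w\<close>. The mean value theorem in the first direction and then in the second turns it
  into a mixed derivative at a point of the parallelogram.\<close>

lemma second_difference:
  fixes \<phi> :: "'a::real_normed_vector \<Rightarrow> real"
  assumes C: "Ck_on (Suc (Suc 0)) U \<phi>" and h: "h > 0"
    and U: "\<And>s t. s \<in> {0..h} \<Longrightarrow> t \<in> {0..h} \<Longrightarrow> x + s *\<^sub>R v + t *\<^sub>R w \<in> U"
  shows "\<exists>s\<in>{0..h}. \<exists>t\<in>{0..h}. \<phi> (x + h *\<^sub>R v + h *\<^sub>R w) - \<phi> (x + h *\<^sub>R v) - \<phi> (x + h *\<^sub>R w) + \<phi> x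
    = h * h * frechet_derivative (\<lambda>z. frechet_derivative \<phi> (at z) v) (at (x + s *\<^sub>R v + t *\<^sub>R w)) w"
proof -
  let ?D = "\<lambda>y. frechet_derivative \<phi> (at y) v"
  let ?A = "\<lambda>y. frechet_derivative ?D (at y) w"
  have C1: "(\<phi> has_derivative frechet_derivative \<phi> (at y)) (at y)" if "y \<in> U" for y
    using Ck_on_Suc_deriv[OF C that] .
  have C2: "(?D has_derivative frechet_derivative ?D (at y)) (at y)" if "y \<in> U" for y
    using C Ck_on_Suc_deriv[of 0 U ?D y] that by auto
  let ?G = "\<lambda>s. \<phi> ((x + h *\<^sub>R w) + s *\<^sub>R v) - \<phi> (x + s *\<^sub>R v)"
  have "(?G has_derivative (\<lambda>d. d *\<^sub>R ?D ((x + h *\<^sub>R w) + s *\<^sub>R v) - d *\<^sub>R ?D (x + s *\<^sub>R v))) (at s within {0..h})"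
    if "0 \<le> s" "s \<le> h" for s
    using U[of s h] U[of s 0] that h
    by (intro has_derivative_diff has_derivative_along_line C1) (auto simp: algebra_simps)
  from mvt_simple[OF h this] obtain s where s: "s \<in> {0<..<h}"
    "?G h - ?G 0 = h * (?D ((x + h *\<^sub>R w) + s *\<^sub>R v) - ?D (x + s *\<^sub>R v))"
    by (auto simp: algebra_simps)
  have "((\<lambda>t. ?D ((x + s *\<^sub>R v) + t *\<^sub>R w)) has_derivative (\<lambda>d. d *\<^sub>R ?A ((x + s *\<^sub>R v) + t *\<^sub>R w))) (at t within {0..h})"
    if "0 \<le> t" "t \<le> h" for t
    using U[of s t] s that by (intro has_derivative_along_line C2) auto
  from mvt_simple[OF h this] obtain t where t: "t \<in> {0<..<h}"
    "?D ((x + s *\<^sub>R v) + h *\<^sub>R w) - ?D (x + s *\<^sub>R v) = h * ?A (x + s *\<^sub>R v + t *\<^sub>R w)"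
    by auto
  have "?G h - ?G 0 = h * h * ?A (x + s *\<^sub>R v + t *\<^sub>R w)"
    using s(2) t(2) by (simp add: add.commute add.left_commute)
  then show ?thesis
    using s(1) t(1) by (intro bexI[of _ s] bexI[of _ t]) (auto simp: algebra_simps)
qed

text \<open>The second difference is symmetric in \<open>v\<close> and \<open>w\<close>, so the two
  mixed derivatives take a common value at two points of each small parallelogram at
  \<open>x\<close>. By continuity they cannot differ at \<open>x\<close>. Values are real because
  the mean value theorem gives an equality only for real functions.\<close>

lemma frechet_derivative_commute:
  fixes \<phi> :: "'a::real_normed_vector \<Rightarrow> real"
  assumes C: "Ck_on (Suc (Suc 0)) U \<phi>" and U: "open U" "x \<in> U"
  shows "frechet_derivative (\<lambda>z. frechet_derivative \<phi> (at z) v) (at x) w =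
    frechet_derivative (\<lambda>z. frechet_derivative \<phi> (at z) w) (at x) v" (is "?A x = ?B x")
proof (rule ccontr)
  assume neq: "?A x \<noteq> ?B x"
  define e where "e = \<bar>?A x - ?B x\<bar> / 2"
  have e: "e > 0" using neq by (simp add: e_def)
  have "continuous_on U ?A" "continuous_on U ?B" using C by auto
  then have "isCont ?A x" "isCont ?B x" using U continuous_on_eq_continuous_at by blast+
  then obtain d1 d2 where d: "d1 > 0" "\<And>y. dist y x < d1 \<Longrightarrow> dist (?A y) (?A x) < e"
    "d2 > 0" "\<And>y. dist y x < d2 \<Longrightarrow> dist (?B y) (?B x) < e"
    unfolding continuous_at_eps_delta using e by (metis (no_types, lifting))
  obtain d3 where d3: "d3 > 0" "ball x d3 \<subseteq> U" using U open_contains_ball by blast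
  define r where "r = min d1 (min d2 d3)"
  \<comment> \<open>Bounds the size of the parallelogram spanned by \<open>v\<close> and
    \<open>w\<close>; the summand 1 keeps \<open>N\<close> positive if both vanish.\<close>
  define N where "N = norm v + norm w + 1"
  define h where "h = r / (2 * N)"
  have r: "r > 0" using d d3 by (simp add: r_def)
  have nn: "N > 0" using norm_ge_zero[of v] norm_ge_zero[of w] unfolding N_def by linarith
  have h: "h > 0" using r nn by (simp add: h_def)
  have near: "dist (x + s *\<^sub>R v + t *\<^sub>R w) x < r" if "s \<in> {0..h}" "t \<in> {0..h}" for s t
  proof -
    have "dist (x + s *\<^sub>R v + t *\<^sub>R w) x = norm (s *\<^sub>R v + t *\<^sub>R w)"
      by (simp add: dist_norm add.assoc)
    also have "\<dots> \<le> s * norm v + t * norm w"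
      using norm_triangle_ineq[of "s *\<^sub>R v" "t *\<^sub>R w"] that by simp
    also have "\<dots> \<le> h * norm v + h * norm w"
      using that by (intro add_mono mult_right_mono) auto
    also have "\<dots> < h * (2 * N)"
      using h by (simp add: N_def algebra_simps add_nonneg_pos)
    also have "\<dots> = r" using nn by (simp add: h_def)
    finally show ?thesis .
  qed
  then have inU: "x + s *\<^sub>R v + t *\<^sub>R w \<in> U" if "s \<in> {0..h}" "t \<in> {0..h}" for s t
    using that d3 by (force simp: r_def dist_commute)
  then have inU': "x + s *\<^sub>R w + t *\<^sub>R v \<in> U" if "s \<in> {0..h}" "t \<in> {0..h}" for s t
    using that by (metis add.assoc add.commute)
  obtain s t where st: "s \<in> {0..h}" "t \<in> {0..h}"
    "\<phi> (x + h *\<^sub>R v + h *\<^sub>R w) - \<phi> (x + h *\<^sub>R v) - \<phi> (x + h *\<^sub>R w) + \<phi> x = h * h * ?A (x + s *\<^sub>R v + t *\<^sub>R w)"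
    using second_difference[OF C h inU] by blast
  obtain s' t' where st': "s' \<in> {0..h}" "t' \<in> {0..h}"
    "\<phi> (x + h *\<^sub>R w + h *\<^sub>R v) - \<phi> (x + h *\<^sub>R w) - \<phi> (x + h *\<^sub>R v) + \<phi> x = h * h * ?B (x + s' *\<^sub>R w + t' *\<^sub>R v)"
    using second_difference[OF C h inU'] by blast
  have "x + h *\<^sub>R w + h *\<^sub>R v = x + h *\<^sub>R v + h *\<^sub>R w" by (simp add: algebra_simps)
  then have "h * h * ?A (x + s *\<^sub>R v + t *\<^sub>R w) = h * h * ?B (x + s' *\<^sub>R w + t' *\<^sub>R v)"
    using st(3) st'(3) by (metis add.commute add_diff_eq diff_diff_eq)
  then have "?A (x + s *\<^sub>R v + t *\<^sub>R w) = ?B (x + s' *\<^sub>R w + t' *\<^sub>R v)" using h by simp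
  moreover have "dist (?A (x + s *\<^sub>R v + t *\<^sub>R w)) (?A x) < e"
    using near[OF st(1,2)] by (intro d) (simp add: r_def)
  moreover have "dist (?B (x + s' *\<^sub>R w + t' *\<^sub>R v)) (?B x) < e"
    using near[OF st'(2,1)] by (intro d) (simp add: r_def add.commute add.left_commute)
  moreover have "\<bar>?A x - ?B x\<bar> = 2 * e" by (simp add: e_def)
  ultimately show False unfolding dist_real_def by linarith
qed

lemma smooth_on_dderiv_const:
  assumes "ropen E S" "smooth_on S f" "v \<in> E"
  shows "smooth_on S (\<lambda>y. dderiv f y v)"
  by (rule smooth_on_dderiv'[OF assms(1,2) smooth_on_ident smooth_on_const]) (use assms(3) in auto)

lemma dderiv_commute_real:
  fixes f :: "'a::euclidean_space \<Rightarrow> real"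
  assumes S: "ropen E S" "smooth_on S f" "x \<in> S" and v: "v \<in> E" "w \<in> E"
  shows "dderiv (\<lambda>y. dderiv f y v) x w = dderiv (\<lambda>y. dderiv f y w) x v"
proof -
  obtain U g where U: "open U" "x \<in> U" "\<And>k. Ck_on k U g"
    "\<And>y v. y \<in> S \<inter> U \<Longrightarrow> v \<in> E \<Longrightarrow> dderiv f y v = frechet_derivative g (at y) v"
    using smooth_on_extension[OF S] by metis
  have SU: "ropen E (S \<inter> U)" "x \<in> S \<inter> U" using ropen_Int_open[OF S(1) U(1)] S(3) U(2) by auto
  have *: "dderiv (\<lambda>y. dderiv f y a) x b = frechet_derivative (\<lambda>z. frechet_derivative g (at z) a) (at x) b"
    if "a \<in> E" "b \<in> E" for a b
  proof (rule dderiv_eq[OF SU that(2)])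
    let ?D = "\<lambda>z. frechet_derivative g (at z) a"
    have "(?D has_derivative frechet_derivative ?D (at x)) (at x)"
      using Ck_on_Suc_deriv[of 0 U ?D x] U(2) U(3)[of "Suc (Suc 0)"] by auto
    then show "((\<lambda>y. dderiv f y a) has_derivative frechet_derivative ?D (at x)) (at x within S \<inter> U)"
      using U(4)[OF _ that(1)] by (intro has_derivative_transform[OF SU(2) _ has_derivative_at_withinI]) auto
  qed
  show ?thesis
    using *[OF v] *[OF v(2,1)] frechet_derivative_commute[OF U(3) U(1,2), of v w] by simp
qed

text \<open>Taking inner products with a fixed vector commutes with differentiation and reduces the
  claim to real functions; inner products separate vectors.\<close>

lemma dderiv_commute:
  fixes f :: "'a::euclidean_space \<Rightarrow> 'b::real_inner"
  assumes S: "ropen E S" "smooth_on S f" "x \<in> S" and v: "v \<in> E" "w \<in> E"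
  shows "dderiv (\<lambda>y. dderiv f y v) x w = dderiv (\<lambda>y. dderiv f y w) x v"
proof -
  have *: "dderiv (\<lambda>y. dderiv f y a) x b \<bullet> u = dderiv (\<lambda>y. dderiv (\<lambda>z. f z \<bullet> u) y a) x b" if ab: "a \<in> E" "b \<in> E" for a b u
  proof -
    have "dderiv (\<lambda>z. f z \<bullet> u) y a = dderiv f y a \<bullet> u" if "y \<in> S" for y
      by (rule dderiv_linear[OF S(1,2) that ab(1) bounded_linear_inner_left])
    then have "dderiv (\<lambda>y. dderiv (\<lambda>z. f z \<bullet> u) y a) x b = dderiv (\<lambda>y. dderiv f y a \<bullet> u) x b"
      by (intro dderiv_cong[OF S(1) _ S(3) ab(2)] smooth_on_linear[OF _ bounded_linear_inner_left] smooth_on_dderiv_const[OF S(1,2) ab(1)]) auto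
    then show ?thesis
      using dderiv_linear[OF S(1) smooth_on_dderiv_const[OF S(1,2) ab(1)] S(3) ab(2) bounded_linear_inner_left, of u] by simp
  qed
  have "dderiv (\<lambda>y. dderiv f y v) x w \<bullet> u = dderiv (\<lambda>y. dderiv f y w) x v \<bullet> u" for u
    using *[OF v] *[OF v(2,1)] dderiv_commute_real[OF S(1) smooth_on_linear[OF S(2) bounded_linear_inner_left] S(3) v]
    by simp
  then show ?thesis by (metis inner_commute vector_eq_rdot)
qed

section \<open>Smooth families of linear maps\<close>

lemma lin_onD: "lin_on E f \<Longrightarrow> x \<in> E \<Longrightarrow> y \<in> E \<Longrightarrow> f (a *\<^sub>R x + b *\<^sub>R y) = a *\<^sub>R f x + b *\<^sub>R f y"
  by (simp add: lin_on_def)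

lemma lin_on_add: "lin_on E f \<Longrightarrow> x \<in> E \<Longrightarrow> y \<in> E \<Longrightarrow> f (x + y) = f x + f y"
  using lin_onD[of E f x y 1 1] by simp

lemma lin_on_scale: "lin_on E f \<Longrightarrow> x \<in> E \<Longrightarrow> f (a *\<^sub>R x) = a *\<^sub>R f x"
  using lin_onD[of E f x x a 0] by simp

lemma lin_on_diff: "lin_on E f \<Longrightarrow> x \<in> E \<Longrightarrow> y \<in> E \<Longrightarrow> f (x - y) = f x - f y"
  using lin_onD[of E f x y 1 "-1"] by simp

lemma lin_on_0: "lin_on E f \<Longrightarrow> subspace E \<Longrightarrow> f 0 = 0"
  using lin_on_scale[of E f 0 0] subspace_0[of E] by simp

lemma lin_on_sum:
  assumes "lin_on E f" "subspace E" "finite I" "\<And>i. i \<in> I \<Longrightarrow> v i \<in> E"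
  shows "f (\<Sum>i\<in>I. c i *\<^sub>R v i) = (\<Sum>i\<in>I. c i *\<^sub>R f (v i))"
  using assms(3,4)
proof (induction I)
  case empty
  then show ?case using lin_on_0[OF assms(1,2)] by simp
next
  case (insert i I)
  then have "(\<Sum>i\<in>I. c i *\<^sub>R v i) \<in> E" using assms(2) by (intro subspace_sum subspace_scale) auto
  then show ?case using insert lin_on_add[OF assms(1)] lin_on_scale[OF assms(1)] assms(2)
    by (simp add: subspace_scale)
qed

lemma lin_on_expand:
  assumes "lin_on E f" "subspace E" "finite B" "B \<subseteq> E" "v = (\<Sum>b\<in>B. (v \<bullet> b) *\<^sub>R b)"
  shows "f v = (\<Sum>b\<in>B. (v \<bullet> b) *\<^sub>R f b)"
  using lin_on_sum[OF assms(1-3), of "\<lambda>b. b" "\<lambda>b. v \<bullet> b"] assms(4,5) by (simp add: subset_iff)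

lemma linear_imp_lin_on: "linear f \<Longrightarrow> lin_on E f"
  by (simp add: lin_on_def linear_add linear_scale)

lemma subspace_orthonormal_basis:
  fixes E :: "'a::euclidean_space set"
  assumes "subspace E"
  obtains B where "finite B" "B \<subseteq> E" "\<And>v. v \<in> E \<Longrightarrow> v = (\<Sum>b\<in>B. (v \<bullet> b) *\<^sub>R b)"
proof -
  obtain B where B: "B \<subseteq> E" "pairwise orthogonal B" "\<And>x. x \<in> B \<Longrightarrow> norm x = 1" "independent B" "span B = E"
    using orthonormal_basis_subspace[OF assms] by metis
  show thesis
    by (rule that[OF independent_imp_finite[OF B(4)] B(1)])
       (use orthonormal_basis_expand[OF B(2,3)] B(5) independent_imp_finite[OF B(4)] in auto)
qed

text \<open>The extension is \<open>f\<close> after the orthogonal projection onto \<open>E\<close>,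
  written with an orthonormal basis. It makes facts on globally defined linear maps available on
  subspaces.\<close>

lemma lin_on_extend:
  fixes E :: "'a::euclidean_space set"
  assumes "subspace E" "lin_on E f"
  obtains L where "bounded_linear L" "\<And>v. v \<in> E \<Longrightarrow> L v = f v"
proof -
  obtain B where B: "finite B" "B \<subseteq> E" "\<And>v. v \<in> E \<Longrightarrow> v = (\<Sum>b\<in>B. (v \<bullet> b) *\<^sub>R b)"
    using subspace_orthonormal_basis[OF assms(1)] by blast
  show thesis
  proof (rule that)
    show "bounded_linear (\<lambda>v. \<Sum>b\<in>B. (v \<bullet> b) *\<^sub>R f b)"
      by (intro bounded_linear_sum bounded_linear_scaleR_const bounded_linear_inner_left)
    show "(\<Sum>b\<in>B. (v \<bullet> b) *\<^sub>R f b) = f v" if "v \<in> E" for v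
      by (rule lin_on_expand[OF assms(2,1) B(1,2) B(3)[OF that], symmetric])
  qed
qed

lemma lin_on_the_inv_into:
  assumes "subspace E" "lin_on E f" "bij_betw f E F"
  shows "lin_on F (the_inv_into E f)"
  unfolding lin_on_def
proof (intro ballI allI)
  fix x y a b assume "x \<in> F" "y \<in> F"
  then obtain u v where uv: "u \<in> E" "v \<in> E" "x = f u" "y = f v"
    using assms(3) by (auto simp: bij_betw_def)
  have inj: "inj_on f E" using assms(3) by (simp add: bij_betw_def)
  have "the_inv_into E f (a *\<^sub>R x + b *\<^sub>R y) = the_inv_into E f (f (a *\<^sub>R u + b *\<^sub>R v))"
    using uv lin_onD[OF assms(2)] by simp
  also have "\<dots> = a *\<^sub>R u + b *\<^sub>R v"
    using uv assms(1) by (intro the_inv_into_f_f[OF inj] subspace_add subspace_scale)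
  finally show "the_inv_into E f (a *\<^sub>R x + b *\<^sub>R y) = a *\<^sub>R the_inv_into E f x + b *\<^sub>R the_inv_into E f y"
    using uv the_inv_into_f_f[OF inj] by simp
qed

text \<open>Each term of the sum is a rank one update of the identity, inverted by the Sherman-Morrison
  formula, whose denominator is 1 at \<open>x0\<close>.\<close>

lemma rank_one_updates:
  fixes c :: "'b::euclidean_space \<Rightarrow> 'a::euclidean_space \<Rightarrow> 'b"
  assumes "finite B" "\<forall>b\<in>B. smooth_on S (c b)" "x0 \<in> S" "\<forall>b\<in>B. c b x0 = 0"
  shows "\<exists>U R. open U \<and> x0 \<in> U \<and> (\<forall>z. smooth_on (S \<inter> U) (\<lambda>x. R x z)) \<and>
    (\<forall>x\<in>S \<inter> U. linear (R x) \<and> (\<forall>z. R x (z + (\<Sum>b\<in>B. (z \<bullet> b) *\<^sub>R c b x)) = z))"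
  using assms(1,2,4)
proof (induction B)
  case empty
  show ?case
    by (intro exI[of _ UNIV] exI[of _ "\<lambda>x z. z"]) (auto simp: smooth_on_const linear_id[unfolded id_def])
next
  case (insert a B)
  have "\<exists>U R. open U \<and> x0 \<in> U \<and> (\<forall>z. smooth_on (S \<inter> U) (\<lambda>x. R x z)) \<and>
    (\<forall>x\<in>S \<inter> U. linear (R x) \<and> (\<forall>z. R x (z + (\<Sum>b\<in>B. (z \<bullet> b) *\<^sub>R c b x)) = z))"
    by (rule insert.IH) (use insert.prems in auto)
  then obtain U R where U: "open U" "x0 \<in> U" "\<And>z. smooth_on (S \<inter> U) (\<lambda>x. R x z)"
    and R: "\<And>x. x \<in> S \<inter> U \<Longrightarrow> linear (R x)"
    "\<And>x z. x \<in> S \<inter> U \<Longrightarrow> R x (z + (\<Sum>b\<in>B. (z \<bullet> b) *\<^sub>R c b x)) = z"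
    by blast
  define c' where "c' x = R x (c a x)" for x
  have c'_eq: "(\<Sum>i\<in>Basis. (c a x \<bullet> i) *\<^sub>R R x i) = c' x" if "x \<in> S \<inter> U" for x
    unfolding c'_def using linear_Basis_expand[OF R(1)[OF that]] by metis
  have "smooth_on (S \<inter> U) (\<lambda>x. \<Sum>i\<in>Basis. (c a x \<bullet> i) *\<^sub>R R x i)"
    using insert.prems(1)
    by (intro smooth_on_sum finite_Basis smooth_on_scaleR U(3) smooth_on_linear[OF smooth_on_subset[of S "c a"] bounded_linear_inner_left]) auto
  then have c': "smooth_on (S \<inter> U) c'" by (rule smooth_on_cong) (rule c'_eq)
  define d where "d x = 1 + c' x \<bullet> a" for x
  have d: "smooth_on (S \<inter> U) d"
    unfolding d_def by (intro smooth_on_add smooth_on_const smooth_on_linear[OF c' bounded_linear_inner_left])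
  have "c' x0 = 0" using insert.prems(2) R(1)[of x0] U(2) assms(3) by (simp add: c'_def linear_0)
  then have d0: "d x0 \<noteq> 0" by (simp add: d_def)
  have "openin (top_of_set (S \<inter> U)) (S \<inter> U \<inter> d -` (- {0}))"
    by (rule continuous_openin_preimage_gen[OF smooth_on_continuous[OF d]]) auto
  then obtain W where W: "open W" "S \<inter> U \<inter> d -` (- {0}) = (S \<inter> U) \<inter> W" unfolding openin_open by blast
  have x0W: "x0 \<in> W" using d0 W(2) U(2) assms(3) by auto
  have dW: "d x \<noteq> 0" if "x \<in> S \<inter> (U \<inter> W)" for x using that W(2) by auto
  define R' where "R' x z = R x z - ((R x z \<bullet> a) * inverse (d x)) *\<^sub>R c' x" for x z
  show ?case
  proof (intro exI[of _ "U \<inter> W"] exI[of _ R'] conjI allI ballI)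
    fix z
    have s: "smooth_on (S \<inter> (U \<inter> W)) (\<lambda>x. R x z)" "smooth_on (S \<inter> (U \<inter> W)) d" "smooth_on (S \<inter> (U \<inter> W)) c'"
      by (rule smooth_on_subset[OF U(3)], blast, rule smooth_on_subset[OF d], blast, rule smooth_on_subset[OF c'], blast)
    show "smooth_on (S \<inter> (U \<inter> W)) (\<lambda>x. R' x z)"
      unfolding R'_def
      by (intro smooth_on_diff smooth_on_scaleR s smooth_on_bilinear[OF _ _ bounded_bilinear_mult]
          smooth_on_linear[OF s(1) bounded_linear_inner_left] smooth_on_inverse dW)
  next
    fix x assume x: "x \<in> S \<inter> (U \<inter> W)"
    then have xU: "x \<in> S \<inter> U" by auto
    show "linear (R' x)"
      unfolding R'_def using R(1)[OF xU]
      by (intro linearI) (auto simp: linear_add linear_scale inner_add_left algebra_simps)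
    fix z
    have eq: "R x (z + (\<Sum>b\<in>insert a B. (z \<bullet> b) *\<^sub>R c b x)) = z + (z \<bullet> a) *\<^sub>R c' x"
    proof -
      have "z + (\<Sum>b\<in>insert a B. (z \<bullet> b) *\<^sub>R c b x) = (z + (\<Sum>b\<in>B. (z \<bullet> b) *\<^sub>R c b x)) + (z \<bullet> a) *\<^sub>R c a x"
        using insert.hyps by simp
      then show ?thesis
        using R[OF xU] by (simp only: linear_add linear_scale c'_def)
    qed
    have "(z + (z \<bullet> a) *\<^sub>R c' x) \<bullet> a = (z \<bullet> a) * d x"
      by (simp add: d_def inner_add_left algebra_simps)
    then show "R' x (z + (\<Sum>b\<in>insert a B. (z \<bullet> b) *\<^sub>R c b x)) = z"
      unfolding R'_def eq using dW[OF x] by (simp add: field_simps)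
  qed (use U(1,2) W(1) x0W in auto)
qed

section \<open>Linear maps depending smoothly on a point\<close>

definition lform :: "'a::euclidean_space set \<Rightarrow> 'z::euclidean_space set \<Rightarrow> ('a \<Rightarrow> 'z \<Rightarrow> 'w::real_normed_vector) \<Rightarrow> bool" where
  "lform S Z a \<longleftrightarrow> smooth_on (S \<times> Z) (\<lambda>p. a (fst p) (snd p)) \<and> (\<forall>x\<in>S. lin_on Z (a x))"

text \<open>Linearity reduces joint smoothness to the finitely many vectors of an orthonormal basis
  of \<open>Z\<close>. The joint form is the one that allows both arguments to be replaced by smooth
  functions, as in \<open>lform_smooth\<close>.\<close>

lemma lformI:
  assumes "subspace Z" "\<And>z. z \<in> Z \<Longrightarrow> smooth_on S (\<lambda>x. a x z)" "\<And>x. x \<in> S \<Longrightarrow> lin_on Z (a x)"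
  shows "lform S Z a"
  unfolding lform_def
proof (intro conjI ballI assms(3))
  obtain B where B: "finite B" "B \<subseteq> Z" "\<And>v. v \<in> Z \<Longrightarrow> v = (\<Sum>b\<in>B. (v \<bullet> b) *\<^sub>R b)"
    using subspace_orthonormal_basis[OF assms(1)] by blast
  have "smooth_on (S \<times> Z) (\<lambda>p. \<Sum>b\<in>B. (snd p \<bullet> b) *\<^sub>R a (fst p) b)"
    using B(2)
    by (intro smooth_on_sum B(1) smooth_on_scaleR smooth_on_linear[OF smooth_on_snd[OF smooth_on_ident] bounded_linear_inner_left]
        smooth_on_compose[OF assms(2) smooth_on_fst[OF smooth_on_ident]]) auto
  then show "smooth_on (S \<times> Z) (\<lambda>p. a (fst p) (snd p))"
  proof (rule smooth_on_cong)
    fix p assume "p \<in> S \<times> Z"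
    then show "(\<Sum>b\<in>B. (snd p \<bullet> b) *\<^sub>R a (fst p) b) = a (fst p) (snd p)"
      using lin_on_expand[OF assms(3) assms(1) B(1,2) B(3), of "fst p" "snd p"] by auto
  qed
qed

lemma lform_lin: "lform S Z a \<Longrightarrow> x \<in> S \<Longrightarrow> lin_on Z (a x)"
  by (simp add: lform_def)

lemma lform_smooth:
  assumes "lform S Z a" "smooth_on T f" "smooth_on T g" "f ` T \<subseteq> S" "g ` T \<subseteq> Z"
  shows "smooth_on T (\<lambda>y. a (f y) (g y))"
  using smooth_on_compose[OF _ smooth_on_Pair[OF assms(2,3)], of "S \<times> Z" "\<lambda>p. a (fst p) (snd p)"] assms
  by (auto simp: lform_def image_subset_iff)

text \<open>Near \<open>x0\<close>, a fixed left inverse \<open>J\<close> of \<open>a x0\<close>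
  turns \<open>a x\<close> into the identity plus a perturbation that vanishes at \<open>x0\<close>,
  and \<open>rank_one_updates\<close> inverts such a map smoothly. No determinants occur, so
  \<open>E\<close> and \<open>F\<close> may be subspaces of different Euclidean spaces.\<close>

lemma lform_inverse:
  assumes E: "subspace E" and F: "subspace F" and a: "lform S E a" and bij: "\<And>x. x \<in> S \<Longrightarrow> bij_betw (a x) E F"
  shows "lform S F (\<lambda>x. the_inv_into E (a x))"
proof (rule lformI[OF F])
  fix w assume w: "w \<in> F"
  show "smooth_on S (\<lambda>x. the_inv_into E (a x) w)"
  proof (rule smooth_on_local)
    fix x0 assume x0: "x0 \<in> S"
    obtain L where L: "bounded_linear L" "\<And>v. v \<in> E \<Longrightarrow> L v = a x0 v"
      using lin_on_extend[OF E lform_lin[OF a x0]] by metis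
    have "inj_on L E" using bij[OF x0] L(2) by (simp add: bij_betw_def inj_on_def)
    then obtain J where J: "linear J" "\<And>v. v \<in> E \<Longrightarrow> J (L v) = v"
      using real_vector.linear_exists_left_inverse_on[OF bounded_linear.linear[OF L(1)] E] by blast
    obtain B where B: "finite B" "B \<subseteq> E" "\<And>v. v \<in> E \<Longrightarrow> v = (\<Sum>b\<in>B. (v \<bullet> b) *\<^sub>R b)"
      using subspace_orthonormal_basis[OF E] by blast
    define c where "c b x = J (a x b) - b" for b x
    have bJ: "bounded_linear J" using J(1) linear_conv_bounded_linear by blast
    have c: "\<forall>b\<in>B. smooth_on S (c b)"
      unfolding c_def using B(2)
      by (intro ballI smooth_on_diff smooth_on_linear[OF _ bJ] smooth_on_const lform_smooth[OF a] smooth_on_ident) auto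
    have "\<forall>b\<in>B. c b x0 = 0" using B(2) J(2) L(2) by (auto simp: c_def)
    from rank_one_updates[of B S c, OF B(1) c x0 this]
    obtain U R where U: "open U" "x0 \<in> U" "\<forall>z. smooth_on (S \<inter> U) (\<lambda>x. R x z)"
      "\<forall>x\<in>S \<inter> U. linear (R x) \<and> (\<forall>z. R x (z + (\<Sum>b\<in>B. (z \<bullet> b) *\<^sub>R c b x)) = z)"
      by (elim exE conjE) (rule that; assumption)
    have "R x (J w) = the_inv_into E (a x) w" if x: "x \<in> S \<inter> U" for x
    proof -
      let ?v = "the_inv_into E (a x) w"
      have inj: "inj_on (a x) E" "w \<in> a x ` E" using bij[of x] x w by (auto simp: bij_betw_def)
      have v: "?v \<in> E" "a x ?v = w"
        using the_inv_into_into[OF inj subset_refl] f_the_inv_into_f[OF inj] by auto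
      have "w = (\<Sum>b\<in>B. (?v \<bullet> b) *\<^sub>R a x b)"
        using lin_on_expand[OF lform_lin[OF a] E B(1,2) B(3)[OF v(1)], of x] x v(2) by auto
      then have "J w = J (\<Sum>b\<in>B. (?v \<bullet> b) *\<^sub>R a x b)" by (rule arg_cong)
      then have Jw: "J w = (\<Sum>b\<in>B. (?v \<bullet> b) *\<^sub>R J (a x b))"
        by (simp add: linear_sum[OF J(1)] linear_scale[OF J(1)])
      have "(\<Sum>b\<in>B. (?v \<bullet> b) *\<^sub>R c b x) = (\<Sum>b\<in>B. (?v \<bullet> b) *\<^sub>R J (a x b)) - (\<Sum>b\<in>B. (?v \<bullet> b) *\<^sub>R b)"
        by (simp add: c_def scaleR_right_diff_distrib sum_subtractf)
      also have "(\<Sum>b\<in>B. (?v \<bullet> b) *\<^sub>R b) = ?v" by (rule B(3)[OF v(1), symmetric])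
      finally have "J w = ?v + (\<Sum>b\<in>B. (?v \<bullet> b) *\<^sub>R c b x)" using Jw by simp
      then show ?thesis using bspec[OF U(4) x] by metis
    qed
    then show "\<exists>U. open U \<and> x0 \<in> U \<and> smooth_on (S \<inter> U) (\<lambda>x. the_inv_into E (a x) w)"
      using U(1,2) smooth_on_cong[OF spec[OF U(3), of "J w"]] by (intro exI[of _ U]) auto
  qed
next
  show "lin_on F (the_inv_into E (a x))" if "x \<in> S" for x
    by (rule lin_on_the_inv_into[OF E lform_lin[OF a that] bij[OF that]])
qed

text \<open>The chain rule for the two-variable map splits the derivative into a base and a fibre
  direction; in the fibre direction a linear map is its own derivative.\<close>

lemma lform_dderiv:
  assumes S: "ropen E S" and Z: "subspace Z" and T: "ropen F T" and a: "lform S Z a"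
    and f: "smooth_on T f" "f ` T \<subseteq> S" and g: "smooth_on T g" "g ` T \<subseteq> Z" and y: "y \<in> T" "v \<in> F"
  shows "dderiv (\<lambda>y. a (f y) (g y)) y v = dderiv (\<lambda>x. a x (g y)) (f y) (dderiv f y v) + a (f y) (dderiv g y v)"
proof -
  let ?a = "\<lambda>p. a (fst p) (snd p)"
  have SZ: "ropen (E \<times> Z) (S \<times> Z)" by (rule ropen_Times[OF S ropen_self[OF Z]])
  have sm: "smooth_on (S \<times> Z) ?a" using a by (simp add: lform_def)
  have fy: "f y \<in> S" "g y \<in> Z" using f g y by auto
  have E: "subspace E" "S \<subseteq> E" using S ropen_subset by (auto simp: ropen_def)
  have df: "dderiv f y v \<in> E" by (rule dderiv_mem[OF T f(1) y E(1)]) (use f E in auto)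
  have dg: "dderiv g y v \<in> Z" by (rule dderiv_mem[OF T g(1) y Z g(2)])
  have "dderiv (\<lambda>y. a (f y) (g y)) y v = dderiv ?a (f y, g y) (dderiv (\<lambda>y. (f y, g y)) y v)"
    using dderiv_chain[OF T smooth_on_Pair[OF f(1) g(1)] y SZ sm] f(2) g(2) by (auto simp: image_subset_iff)
  also have "\<dots> = dderiv ?a (f y, g y) ((dderiv f y v, 0) + (0, dderiv g y v))"
    using dderiv_Pair[OF T f(1) g(1) y] by simp
  also have "\<dots> = dderiv ?a (f y, g y) (dderiv f y v, 0) + dderiv ?a (f y, g y) (0, dderiv g y v)"
    using fy df dg E(1) Z by (intro lin_on_add[OF dderiv_lin_on[OF SZ sm]]) (auto simp: subspace_0)
  also have "dderiv ?a (f y, g y) (dderiv f y v, 0) = dderiv (\<lambda>x. a x (g y)) (f y) (dderiv f y v)"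
    using dderiv_fst_slice[of ?a] by simp
  also have "dderiv ?a (f y, g y) (0, dderiv g y v) = a (f y) (dderiv g y v)"
  proof -
    have lin: "lin_on Z (a (f y))" by (rule lform_lin[OF a fy(1)])
    have "a (f y) (g y + s *\<^sub>R dderiv g y v) = a (f y) (g y) + s *\<^sub>R a (f y) (dderiv g y v)" for s
      using lin_onD[OF lin fy(2) dg, of 1 s] by simp
    then show ?thesis
      using dderiv_ident[of "a (f y) (g y)" "a (f y) (dderiv g y v)"] unfolding dderiv_def by simp
  qed
  finally show ?thesis .
qed

section \<open>The exterior derivative of one-forms on model spaces\<close>

definition dform :: "('e::euclidean_space \<Rightarrow> 'e \<Rightarrow> 'w::real_normed_vector) \<Rightarrow> 'e \<Rightarrow> 'e \<Rightarrow> 'e \<Rightarrow> 'w" where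
  "dform a y v w = dderiv (\<lambda>y. a y w) y v - dderiv (\<lambda>y. a y v) y w"

text \<open>By \<open>lform_dderiv\<close> each of the two terms acquires a second derivative of
  \<open>f\<close>; these are equal by symmetry and cancel in the difference.\<close>

lemma dform_pullback:
  fixes f :: "'e::euclidean_space \<Rightarrow> 'f::euclidean_space" and a :: "'f \<Rightarrow> 'f \<Rightarrow> 'w::real_normed_vector"
  assumes S: "ropen E S" and T: "ropen F T" and a: "lform T F a" and f: "smooth_on S f" "f ` S \<subseteq> T"
    and y: "y \<in> S" "v \<in> E" "w \<in> E"
  shows "dform (\<lambda>y z. a (f y) (dderiv f y z)) y v w = dform a (f y) (dderiv f y v) (dderiv f y w)"
proof -
  have F: "subspace F" "f ` S \<subseteq> F" using T f(2) ropen_subset by (auto simp: ropen_def)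
  have *: "dderiv (\<lambda>y. a (f y) (dderiv f y z)) y u =
    dderiv (\<lambda>x. a x (dderiv f y z)) (f y) (dderiv f y u) + a (f y) (dderiv (\<lambda>y. dderiv f y z) y u)"
    if "z \<in> E" "u \<in> E" for z u
    using dderiv_mem[OF S f(1) _ that(1) F]
    by (intro lform_dderiv[OF T F(1) S a f smooth_on_dderiv_const[OF S f(1) that(1)]] that y(1)) auto
  show ?thesis
    unfolding dform_def using *[OF y(3,2)] *[OF y(2,3)] dderiv_commute[OF S f(1) y] by simp
qed

section \<open>Manifolds\<close>

text \<open>No topological condition is imposed: \<open>J^1 P\<close> and \<open>P^1\<close> are handled through their compatible
  atlases alone.\<close>

definition premfd :: "('a, 'e::euclidean_space) mfd \<Rightarrow> bool" where
  "premfd M \<longleftrightarrow> subspace (model M) \<and> (\<forall>c\<in>atlas M. chart_on (model M) c) \<and>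
     (\<forall>c\<in>atlas M. \<forall>c'\<in>atlas M. compat (model M) c (model M) c')"

text \<open>The values may lie in a subspace \<open>F\<close> of another Euclidean space than the
  model of \<open>M\<close>. Fibred charts of \<open>P\<close> need this: they take values in a
  product, while the model of \<open>P\<close> is unrelated to it.\<close>

definition mchart :: "('a, 'e::euclidean_space) mfd \<Rightarrow> 'f::euclidean_space set \<Rightarrow> ('a, 'f) chart \<Rightarrow> bool" where
  "mchart M F c \<longleftrightarrow> premfd M \<and> subspace F \<and> c \<in> charts_in M F"

definition mopen :: "('a, 'e::euclidean_space) mfd \<Rightarrow> 'a set \<Rightarrow> bool" where
  "mopen M U \<longleftrightarrow> U \<subseteq> pts M \<and> (\<forall>c\<in>atlas M. openin (top_of_set (model M)) (snd c ` (U \<inter> fst c)))"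

text \<open>Openness of the domain is part of the notion, so that every construction of a smooth
  function also delivers an open domain.\<close>

definition sfun :: "('a, 'e::euclidean_space) mfd \<Rightarrow> 'a set \<Rightarrow> ('a \<Rightarrow> 'w::real_normed_vector) \<Rightarrow> bool" where
  "sfun M U f \<longleftrightarrow> mopen M U \<and> (\<forall>c\<in>atlas M. smooth_on (snd c ` (U \<inter> fst c)) (\<lambda>y. f (cinv c y)))"

lemma smooth_manifold_premfd: "smooth_manifold M \<Longrightarrow> premfd M"
  by (simp add: smooth_manifold_def premfd_def)

lemma premfd_subspace: "premfd M \<Longrightarrow> subspace (model M)"
  by (simp add: premfd_def)

lemma mchart_premfd: "mchart M F c \<Longrightarrow> premfd M" and mchart_subspace: "mchart M F c \<Longrightarrow> subspace F"
  and mchart_chart_on: "mchart M F c \<Longrightarrow> chart_on F c" and mchart_pts: "mchart M F c \<Longrightarrow> fst c \<subseteq> pts M"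
  by (auto simp: mchart_def charts_in_def)

lemma mchart_compat: "mchart M F c \<Longrightarrow> d \<in> atlas M \<Longrightarrow> compat F c (model M) d"
  by (auto simp: mchart_def charts_in_def)

lemma atlas_mchart: "premfd M \<Longrightarrow> c \<in> atlas M \<Longrightarrow> mchart M (model M) c"
  by (auto simp: mchart_def charts_in_def premfd_def pts_def)

lemma cinv_mem: "y \<in> snd c ` fst c \<Longrightarrow> cinv c y \<in> fst c"
  by (simp add: cinv_def inv_into_into)

lemma snd_cinv [simp]: "y \<in> snd c ` fst c \<Longrightarrow> snd c (cinv c y) = y"
  by (simp add: cinv_def f_inv_into_f)

lemma cinv_snd [simp]: "chart_on F c \<Longrightarrow> x \<in> fst c \<Longrightarrow> cinv c (snd c x) = x"
  by (simp add: cinv_def chart_on_def)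

lemma chart_image_subset: "chart_on F c \<Longrightarrow> x \<in> fst c \<Longrightarrow> snd c x \<in> F"
  unfolding chart_on_def using openin_imp_subset by blast

lemma compat_sym: "compat E c F d \<Longrightarrow> compat F d E c"
  by (simp add: compat_def Int_commute)

text \<open>The image in \<open>c\<close> is the preimage, under the continuous transition map, of
  the image in \<open>d\<close>.\<close>

lemma chart_preimage:
  assumes c: "chart_on F c" and d: "chart_on E d" and cd: "compat F c E d" and F: "subspace F"
    and U: "openin (top_of_set E) (snd d ` (U \<inter> fst d))"
  shows "ropen F (snd c ` (U \<inter> (fst c \<inter> fst d)))"
proof -
  have eq: "snd c ` (U \<inter> (fst c \<inter> fst d)) = snd c ` (fst c \<inter> fst d) \<inter> (snd d \<circ> cinv c) -` (snd d ` (U \<inter> fst d))"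
    (is "?l = ?r")
  proof
    show "?l \<subseteq> ?r" using c by auto
    show "?r \<subseteq> ?l"
    proof
      fix y assume y: "y \<in> ?r"
      then obtain x where x: "x \<in> fst c" "x \<in> fst d" "y = snd c x" by auto
      then have "snd d x \<in> snd d ` (U \<inter> fst d)" using y c by auto
      then have "x \<in> U" using x(2) d by (auto simp: chart_on_def inj_on_def)
      then show "y \<in> ?l" using x by auto
    qed
  qed
  have o: "openin (top_of_set F) (snd c ` (fst c \<inter> fst d))" "smooth_on (snd c ` (fst c \<inter> fst d)) (snd d \<circ> cinv c)"
    using cd by (auto simp: compat_def)
  have "(snd d \<circ> cinv c) ` snd c ` (fst c \<inter> fst d) \<subseteq> snd d ` fst d" using c by auto
  moreover have "openin (top_of_set (snd d ` fst d)) (snd d ` (U \<inter> fst d))"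
    by (rule openin_subset_trans[OF U]) (use chart_image_subset[OF d] in auto)
  ultimately have "openin (top_of_set (snd c ` (fst c \<inter> fst d))) ?r"
    by (intro continuous_openin_preimage[OF smooth_on_continuous[OF o(2)]]) (auto simp: image_subset_iff)
  then show ?thesis unfolding eq ropen_def using F o(1) openin_trans by blast
qed

lemma mopen_chart:
  assumes c: "mchart M F c" and U: "mopen M U"
  shows "ropen F (snd c ` (U \<inter> fst c))"
proof -
  have "\<exists>T. openin (top_of_set F) T \<and> y \<in> T \<and> T \<subseteq> snd c ` (U \<inter> fst c)" if y: "y \<in> snd c ` (U \<inter> fst c)" for y
  proof -
    obtain x where x: "x \<in> U" "x \<in> fst c" "y = snd c x" using y by auto
    obtain d where d: "d \<in> atlas M" "x \<in> fst d" using x mchart_pts[OF c] by (auto simp: pts_def)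
    have "ropen F (snd c ` (U \<inter> (fst c \<inter> fst d)))"
      by (rule chart_preimage[OF mchart_chart_on[OF c] mchart_chart_on[OF atlas_mchart[OF mchart_premfd[OF c] d(1)]]
            mchart_compat[OF c d(1)] mchart_subspace[OF c]])
         (use d(1) U in \<open>simp add: mopen_def\<close>)
    then show ?thesis using x d by (intro exI[of _ "snd c ` (U \<inter> (fst c \<inter> fst d))"]) (auto simp: ropen_def)
  qed
  then have "openin (top_of_set F) (snd c ` (U \<inter> fst c))" by (subst openin_subopen) blast
  then show ?thesis using mchart_subspace[OF c] by (simp add: ropen_def)
qed

lemma mopen_of_chart:
  assumes c: "mchart M F c" and W: "W \<subseteq> fst c" "openin (top_of_set F) (snd c ` W)"
  shows "mopen M W"
  unfolding mopen_def
proof (intro conjI ballI)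
  show "W \<subseteq> pts M" using W(1) mchart_pts[OF c] by blast
  fix d assume d: "d \<in> atlas M"
  have "ropen (model M) (snd d ` (W \<inter> (fst d \<inter> fst c)))"
    by (rule chart_preimage[OF mchart_chart_on[OF atlas_mchart[OF mchart_premfd[OF c] d]] mchart_chart_on[OF c]
          compat_sym[OF mchart_compat[OF c d]] premfd_subspace[OF mchart_premfd[OF c]]])
       (use W in \<open>simp add: Int_absorb2\<close>)
  moreover have "W \<inter> (fst d \<inter> fst c) = W \<inter> fst d" using W(1) by auto
  ultimately show "openin (top_of_set (model M)) (snd d ` (W \<inter> fst d))" by (simp add: ropen_def)
qed

lemma mopen_dom: "mchart M F c \<Longrightarrow> mopen M (fst c)"
  by (rule mopen_of_chart) (auto simp: chart_on_def dest: mchart_chart_on)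

lemma mopen_Un: "(\<And>i. i \<in> I \<Longrightarrow> mopen M (U i)) \<Longrightarrow> mopen M (\<Union>i\<in>I. U i)"
  unfolding mopen_def
proof (intro conjI ballI)
  fix d assume a: "\<And>i. i \<in> I \<Longrightarrow> U i \<subseteq> pts M \<and> (\<forall>c\<in>atlas M. openin (top_of_set (model M)) (snd c ` (U i \<inter> fst c)))" "d \<in> atlas M"
  have "snd d ` ((\<Union>i\<in>I. U i) \<inter> fst d) = \<Union>((\<lambda>i. snd d ` (U i \<inter> fst d)) ` I)" by auto
  then show "openin (top_of_set (model M)) (snd d ` ((\<Union>i\<in>I. U i) \<inter> fst d))"
    using a by (auto intro!: openin_Union)
qed blast

lemma mopen_Int:
  assumes "premfd M" "mopen M U" "mopen M W"
  shows "mopen M (U \<inter> W)"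
  unfolding mopen_def
proof (intro conjI ballI)
  fix d assume d: "d \<in> atlas M"
  have "inj_on (snd d) (fst d)" using mchart_chart_on[OF atlas_mchart[OF assms(1) d]] by (simp add: chart_on_def)
  then have "snd d ` (U \<inter> W \<inter> fst d) = snd d ` (U \<inter> fst d) \<inter> snd d ` (W \<inter> fst d)"
    by (auto simp: inj_on_def)
  then show "openin (top_of_set (model M)) (snd d ` (U \<inter> W \<inter> fst d))"
    using assms d by (auto simp: mopen_def intro!: openin_Int)
qed (use assms in \<open>auto simp: mopen_def\<close>)

lemma mopen_pts: "premfd M \<Longrightarrow> mopen M (pts M)"
  using mopen_Un[of "atlas M" M fst] mopen_dom[OF atlas_mchart] by (auto simp: pts_def)

lemma mopen_local:
  assumes "\<And>x. x \<in> U \<Longrightarrow> \<exists>W. mopen M W \<and> x \<in> W \<and> W \<subseteq> U"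
  shows "mopen M U"
proof -
  have "U = (\<Union>W\<in>{W. mopen M W \<and> W \<subseteq> U}. W)" using assms by blast
  then show ?thesis using mopen_Un[of "{W. mopen M W \<and> W \<subseteq> U}" M "\<lambda>W. W"] by simp
qed

lemma mopen_mtop:
  assumes "premfd M" "openin (mtop M) U"
  shows "mopen M U"
proof -
  have "istopology (mopen M)"
    unfolding istopology_def using mopen_Int[OF assms(1)] mopen_Un[of _ M "\<lambda>x. x"] by auto
  then show ?thesis
    using assms(2) topology_inverse'[of "mopen M"] unfolding mtop_def mopen_def[abs_def] by simp
qed

lemma sfun_mopen: "sfun M U f \<Longrightarrow> mopen M U"
  by (simp add: sfun_def)

lemma sfun_chart:
  assumes c: "mchart M F c" and f: "sfun M U f"
  shows "smooth_on (snd c ` (U \<inter> fst c)) (\<lambda>y. f (cinv c y))"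
proof (rule smooth_on_local_openin)
  fix y assume y: "y \<in> snd c ` (U \<inter> fst c)"
  then obtain x where x: "x \<in> U" "x \<in> fst c" "y = snd c x" by auto
  obtain d where d: "d \<in> atlas M" "x \<in> fst d" using x mchart_pts[OF c] by (auto simp: pts_def)
  have dm: "mchart M (model M) d" by (rule atlas_mchart[OF mchart_premfd[OF c] d(1)])
  note co = mchart_chart_on[OF c] mchart_chart_on[OF dm]
  let ?T = "snd c ` (U \<inter> (fst c \<inter> fst d))"
  have T: "openin (top_of_set F) ?T"
    using chart_preimage[OF co mchart_compat[OF c d(1)] mchart_subspace[OF c]] f d(1)
    by (auto simp: sfun_def mopen_def ropen_def)
  have "smooth_on ?T (\<lambda>y. snd d (cinv c y))"
    by (rule smooth_on_subset[of "snd c ` (fst c \<inter> fst d)"]) (use mchart_compat[OF c d(1)] in \<open>auto simp: compat_def o_def\<close>)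
  moreover have "(\<lambda>y. snd d (cinv c y)) ` ?T \<subseteq> snd d ` (U \<inter> fst d)" using co by auto
  ultimately have "smooth_on ?T (\<lambda>y. f (cinv d (snd d (cinv c y))))"
    using smooth_on_compose[of "snd d ` (U \<inter> fst d)" "\<lambda>y. f (cinv d y)"] f d(1) unfolding sfun_def by blast
  then have "smooth_on ?T (\<lambda>y. f (cinv c y))"
    by (rule smooth_on_cong) (use co in auto)
  moreover have "openin (top_of_set (snd c ` (U \<inter> fst c))) ?T"
    by (rule openin_subset_trans[OF T]) (use ropen_subset[OF mopen_chart[OF c sfun_mopen[OF f]]] in auto)
  ultimately show "\<exists>T. openin (top_of_set (snd c ` (U \<inter> fst c))) T \<and> y \<in> T \<and> smooth_on T (\<lambda>y. f (cinv c y))"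
    using x d by (intro exI[of _ ?T]) auto
qed

lemma sfun_of_chart:
  assumes c: "mchart M F c" and W: "W \<subseteq> fst c" "openin (top_of_set F) (snd c ` W)" "smooth_on (snd c ` W) (\<lambda>y. f (cinv c y))"
  shows "sfun M W f"
  unfolding sfun_def
proof (intro conjI ballI mopen_of_chart[OF c W(1,2)])
  fix d assume d: "d \<in> atlas M"
  have dm: "mchart M (model M) d" by (rule atlas_mchart[OF mchart_premfd[OF c] d])
  note co = mchart_chart_on[OF c] mchart_chart_on[OF dm]
  have "smooth_on (snd d ` (W \<inter> fst d)) (\<lambda>y. snd c (cinv d y))"
    by (rule smooth_on_subset[of "snd d ` (fst c \<inter> fst d)"]) (use W mchart_compat[OF c d] in \<open>auto simp: compat_def o_def\<close>)
  then have "smooth_on (snd d ` (W \<inter> fst d)) (\<lambda>y. f (cinv c (snd c (cinv d y))))"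
    by (rule smooth_on_compose[OF W(3)]) (use co in auto)
  then show "smooth_on (snd d ` (W \<inter> fst d)) (\<lambda>y. f (cinv d y))"
    by (rule smooth_on_cong) (use co W(1) in auto)
qed

lemma sfun_dom: "mchart M F c \<Longrightarrow> sfun M (fst c) (snd c)"
  by (rule sfun_of_chart, assumption)
     (auto simp: chart_on_def dest: mchart_chart_on intro: smooth_on_cong[OF smooth_on_ident])

lemma sfun_subset: "sfun M U f \<Longrightarrow> mopen M W \<Longrightarrow> W \<subseteq> U \<Longrightarrow> sfun M W f"
  unfolding sfun_def by (auto intro: smooth_on_subset[where T="snd _ ` (W \<inter> fst _)"])

lemma sfun_cong:
  assumes "premfd M" "sfun M U f" "\<And>x. x \<in> U \<Longrightarrow> f x = g x"
  shows "sfun M U g"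
  unfolding sfun_def
proof (intro conjI ballI)
  fix c assume c: "c \<in> atlas M"
  show "smooth_on (snd c ` (U \<inter> fst c)) (\<lambda>y. g (cinv c y))"
    by (rule smooth_on_cong[of _ "\<lambda>y. f (cinv c y)"])
       (use assms c mchart_chart_on[OF atlas_mchart[OF assms(1) c]] in \<open>auto simp: sfun_def\<close>)
qed (use assms in \<open>simp add: sfun_def\<close>)

lemma sfun_local:
  assumes "premfd M" "\<And>x. x \<in> U \<Longrightarrow> \<exists>W. x \<in> W \<and> W \<subseteq> U \<and> sfun M W f"
  shows "sfun M U f"
  unfolding sfun_def
proof (intro conjI ballI)
  show U: "mopen M U" by (rule mopen_local) (use assms(2) sfun_mopen in blast)
  fix c assume c: "c \<in> atlas M"
  have cm: "mchart M (model M) c" by (rule atlas_mchart[OF assms(1) c])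
  show "smooth_on (snd c ` (U \<inter> fst c)) (\<lambda>y. f (cinv c y))"
  proof (rule smooth_on_local_openin)
    fix y assume "y \<in> snd c ` (U \<inter> fst c)"
    then obtain x where x: "x \<in> U" "x \<in> fst c" "y = snd c x" by auto
    then obtain W where W: "x \<in> W" "W \<subseteq> U" "sfun M W f" using assms(2) by blast
    have "openin (top_of_set (snd c ` (U \<inter> fst c))) (snd c ` (W \<inter> fst c))"
      by (rule openin_subset_trans[of "model M"])
         (use mopen_chart[OF cm] sfun_mopen[OF W(3)] W(2) chart_image_subset[OF mchart_chart_on[OF cm]] in \<open>auto simp: ropen_def\<close>)
    then show "\<exists>T. openin (top_of_set (snd c ` (U \<inter> fst c))) T \<and> y \<in> T \<and> smooth_on T (\<lambda>y. f (cinv c y))"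
      using x W sfun_chart[OF cm W(3)] by (intro exI[of _ "snd c ` (W \<inter> fst c)"]) auto
  qed
qed

lemma sfun_compose: "sfun M U f \<Longrightarrow> smooth_on T g \<Longrightarrow> premfd M \<Longrightarrow> f ` U \<subseteq> T \<Longrightarrow> sfun M U (\<lambda>x. g (f x))"
  unfolding sfun_def
proof (intro conjI ballI; elim conjE)
  fix c assume a: "c \<in> atlas M" "\<forall>c\<in>atlas M. smooth_on (snd c ` (U \<inter> fst c)) (\<lambda>y. f (cinv c y))"
    "smooth_on T g" "premfd M" "f ` U \<subseteq> T"
  show "smooth_on (snd c ` (U \<inter> fst c)) (\<lambda>y. g (f (cinv c y)))"
    by (rule smooth_on_compose[OF a(3)]) (use a mchart_chart_on[OF atlas_mchart[OF a(4,1)]] in auto)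
qed

lemma sfun_preimage:
  assumes M: "premfd M" and f: "sfun M U f" "f ` U \<subseteq> F" and T: "ropen F T"
  shows "mopen M (U \<inter> f -` T)"
  unfolding mopen_def
proof (intro conjI ballI)
  show "U \<inter> f -` T \<subseteq> pts M" using sfun_mopen[OF f(1)] by (auto simp: mopen_def)
  fix c assume c: "c \<in> atlas M"
  have cm: "mchart M (model M) c" by (rule atlas_mchart[OF M c])
  note co = mchart_chart_on[OF cm]
  have "ropen (model M) (snd c ` (U \<inter> fst c) \<inter> (\<lambda>y. f (cinv c y)) -` T)"
    by (rule ropen_preimage[OF mopen_chart[OF cm sfun_mopen[OF f(1)]] T smooth_on_continuous[OF sfun_chart[OF cm f(1)]]])
       (use f(2) co in auto)
  moreover have "snd c ` (U \<inter> fst c) \<inter> (\<lambda>y. f (cinv c y)) -` T = snd c ` (U \<inter> f -` T \<inter> fst c)"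
    using co by auto
  ultimately show "openin (top_of_set (model M)) (snd c ` (U \<inter> f -` T \<inter> fst c))" by (simp add: ropen_def)
qed

lemma sfun_Pair: "sfun M U f \<Longrightarrow> sfun M U g \<Longrightarrow> sfun M U (\<lambda>x. (f x, g x))"
  unfolding sfun_def by (auto intro: smooth_on_Pair)

lemma sfun_const: "mopen M U \<Longrightarrow> sfun M U (\<lambda>x. k)"
  unfolding sfun_def by (auto intro: smooth_on_const)

lemma smooth_map_iff:
  assumes "premfd M"
  shows "smooth_map M N f \<longleftrightarrow> f ` pts M \<subseteq> pts N \<and> (\<forall>c'\<in>atlas N. sfun M (pts M \<inter> f -` fst c') (\<lambda>x. snd c' (f x)))"
proof -
  have "pts M \<inter> f -` A \<inter> fst c = fst c \<inter> f -` A" if "c \<in> atlas M" for c A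
    using that by (auto simp: pts_def)
  then show ?thesis unfolding smooth_map_def sfun_def mopen_def by (auto simp: o_def)
qed

lemma smooth_map_pts: "smooth_map M N f \<Longrightarrow> x \<in> pts M \<Longrightarrow> f x \<in> pts N"
  by (auto simp: smooth_map_def)

lemma smooth_map_sfun:
  assumes M: "premfd M" and N: "premfd N" and f: "smooth_map M N f" and g: "sfun N V g"
  shows "sfun M (pts M \<inter> f -` V) (\<lambda>x. g (f x))"
proof (rule sfun_local[OF M])
  fix x assume x: "x \<in> pts M \<inter> f -` V"
  then obtain d where d: "d \<in> atlas N" "f x \<in> fst d"
    using smooth_map_pts[OF f, of x] by (auto simp: pts_def)
  have dm: "mchart N (model N) d" by (rule atlas_mchart[OF N d(1)])
  note co = mchart_chart_on[OF dm]
  have sf: "sfun M (pts M \<inter> f -` fst d) (\<lambda>x. snd d (f x))" using f d(1) unfolding smooth_map_iff[OF M] by auto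
  let ?W = "pts M \<inter> f -` fst d \<inter> (\<lambda>x. snd d (f x)) -` (snd d ` (V \<inter> fst d))"
  have "?W = pts M \<inter> f -` (V \<inter> fst d)" using co by (auto simp: chart_on_def inj_on_def)
  have "mopen M ?W"
    by (rule sfun_preimage[OF M sf, of "model N"])
       (use mopen_chart[OF dm sfun_mopen[OF g]] chart_image_subset[OF co] in auto)
  then have W: "sfun M ?W (\<lambda>x. snd d (f x))" by (rule sfun_subset[OF sf]) auto
  have "sfun M ?W (\<lambda>x. g (cinv d (snd d (f x))))"
    by (rule sfun_compose[OF W sfun_chart[OF dm g] M]) auto
  then have "sfun M ?W (\<lambda>x. g (f x))" by (rule sfun_cong[OF M]) (use co in auto)
  then show "\<exists>W. x \<in> W \<and> W \<subseteq> pts M \<inter> f -` V \<and> sfun M W (\<lambda>x. g (f x))"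
    using x d \<open>?W = _\<close> by (intro exI[of _ ?W]) auto
qed

text \<open>\<open>smooth_map\<close> tests all charts of both atlases, but the coordinates of
  \<open>p1\<close> and of the section \<open>hsec\<close> are known only in fibred charts and jet
  charts. One chart around each image point is enough, since all others differ from it by a smooth
  transition.\<close>

lemma smooth_mapI_local:
  assumes M: "premfd M" and pts: "\<And>x. x \<in> pts M \<Longrightarrow> f x \<in> pts N"
    and loc: "\<And>x. x \<in> pts M \<Longrightarrow> \<exists>d W. mchart N F d \<and> x \<in> W \<and> f ` W \<subseteq> fst d \<and> sfun M W (\<lambda>x. snd d (f x))"
  shows "smooth_map M N f"
  unfolding smooth_map_iff[OF M]
proof (intro conjI ballI sfun_local[OF M])
  show "f ` pts M \<subseteq> pts N" using pts by auto
  fix c x assume c: "c \<in> atlas N" and x: "x \<in> pts M \<inter> f -` fst c"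
  then obtain d W where d: "mchart N F d" "x \<in> W" "f ` W \<subseteq> fst d" "sfun M W (\<lambda>x. snd d (f x))"
    using loc by blast
  note co = mchart_chart_on[OF d(1)]
  have cm: "mchart N (model N) c" by (rule atlas_mchart[OF mchart_premfd[OF d(1)] c])
  let ?W = "W \<inter> (\<lambda>x. snd d (f x)) -` (snd d ` (fst c \<inter> fst d))"
  have eq: "?W = W \<inter> f -` fst c" using d(3) co by (auto simp: chart_on_def inj_on_def)
  have "mopen M ?W"
    by (rule sfun_preimage[OF M d(4), of F])
       (use d(3) mopen_chart[OF d(1) mopen_dom[OF cm]] chart_image_subset[OF co] in auto)
  then have W: "sfun M ?W (\<lambda>x. snd d (f x))" by (rule sfun_subset[OF d(4)]) auto
  have "sfun M ?W (\<lambda>x. snd c (cinv d (snd d (f x))))"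
    by (rule sfun_compose[OF W sfun_chart[OF d(1) sfun_dom[OF cm]] M]) auto
  moreover have "cinv d (snd d (f x)) = f x" if "x \<in> ?W" for x
    using that d(3) by (intro cinv_snd[OF co]) blast
  ultimately have "sfun M ?W (\<lambda>x. snd c (f x))"
    using sfun_cong[OF M, of ?W "\<lambda>x. snd c (cinv d (snd d (f x)))" "\<lambda>x. snd c (f x)"] by simp
  then show "\<exists>W. x \<in> W \<and> W \<subseteq> pts M \<inter> f -` fst c \<and> sfun M W (\<lambda>x. snd c (f x))"
    using x d(2) eq sfun_mopen[OF d(4)] by (intro exI[of _ ?W]) (auto simp: mopen_def)
qed

lemma smooth_map_compose:
  assumes "premfd M" "premfd N" "smooth_map M N f" "smooth_map N Q g"
  shows "smooth_map M Q (\<lambda>x. g (f x))"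
  unfolding smooth_map_iff[OF assms(1)]
proof (intro conjI ballI)
  show "(\<lambda>x. g (f x)) ` pts M \<subseteq> pts Q" by (auto intro!: smooth_map_pts[OF assms(4)] smooth_map_pts[OF assms(3)])
  fix c assume "c \<in> atlas Q"
  then have "sfun N (pts N \<inter> g -` fst c) (\<lambda>x. snd c (g x))" using assms(4) unfolding smooth_map_iff[OF assms(2)] by auto
  from smooth_map_sfun[OF assms(1-3) this]
  show "sfun M (pts M \<inter> (\<lambda>x. g (f x)) -` fst c) (\<lambda>x. snd c (g (f x)))"
    using smooth_map_pts[OF assms(3)]
    by (elim back_subst[of "\<lambda>U. sfun M U _"]) auto
qed

lemma smooth_map_const: "premfd M \<Longrightarrow> k \<in> pts N \<Longrightarrow> smooth_map M N (\<lambda>x. k)"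
  unfolding smooth_map_iff
proof (intro conjI ballI sfun_const)
  fix c assume "premfd M"
  then show "mopen M (pts M \<inter> (\<lambda>x. k) -` fst c)"
    using mopen_pts[of M] by (cases "k \<in> fst c") (auto simp: mopen_def)
qed auto

lemma smooth_map_ident: "premfd M \<Longrightarrow> smooth_map M M (\<lambda>x. x)"
  by (auto simp: smooth_map_iff pts_def intro!: back_subst[of "\<lambda>U. sfun M U _", OF sfun_dom[OF atlas_mchart]])

section \<open>Tangent vectors and differentials of maps\<close>

lemma chart_at:
  assumes "x \<in> pts M"
  shows "chart_at M x \<in> atlas M" "x \<in> fst (chart_at M x)"
proof -
  have "\<exists>c. c \<in> atlas M \<and> x \<in> fst c" using assms by (auto simp: pts_def)
  from someI_ex[OF this] show "chart_at M x \<in> atlas M" "x \<in> fst (chart_at M x)"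
    by (auto simp: chart_at_def)
qed

lemma sfun_pts: "sfun M U f \<Longrightarrow> x \<in> U \<Longrightarrow> x \<in> pts M"
  by (auto simp: sfun_def mopen_def)

lemma chart_at_mchart: "premfd M \<Longrightarrow> x \<in> pts M \<Longrightarrow> mchart M (model M) (chart_at M x)"
  by (rule atlas_mchart[OF _ chart_at(1)])

lemma mchart_ropen: "mchart M F c \<Longrightarrow> ropen F (snd c ` fst c)"
  using mopen_chart[OF _ mopen_dom] by fastforce

lemma mchart_trans_ropen: "mchart M F c \<Longrightarrow> mchart M E d \<Longrightarrow> ropen F (snd c ` (fst c \<inter> fst d))"
  using mopen_chart[OF _ mopen_dom] by (metis Int_commute)

lemma mchart_trans_smooth: "mchart M F c \<Longrightarrow> mchart M E d \<Longrightarrow> smooth_on (snd c ` (fst c \<inter> fst d)) (\<lambda>y. snd d (cinv c y))"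
  using sfun_chart[OF _ sfun_dom] by (metis Int_commute)

lemma mchart_trans_deriv_mem:
  assumes c: "mchart M F c" and d: "mchart M E d" and x: "x \<in> fst c" "x \<in> fst d" and v: "v \<in> F"
  shows "dderiv (\<lambda>y. snd d (cinv c y)) (snd c x) v \<in> E"
  by (rule dderiv_mem[OF mchart_trans_ropen[OF c d] mchart_trans_smooth[OF c d] _ v mchart_subspace[OF d]])
     (use x mchart_chart_on[OF c] chart_image_subset[OF mchart_chart_on[OF d]] in auto)

text \<open>The chain rule through the transition map. The chart independence of
  \<open>tder\<close>, \<open>coords\<close> and \<open>uncoords\<close> below is derived from it,
  with \<open>f\<close> often taken to be a chart itself.\<close>

lemma sfun_deriv_trans:
  assumes f: "sfun M U f" and x: "x \<in> U" and c: "mchart M F c" "x \<in> fst c" and d: "mchart M E d" "x \<in> fst d" and v: "v \<in> E"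
  shows "dderiv (\<lambda>y. f (cinv d y)) (snd d x) v =
    dderiv (\<lambda>y. f (cinv c y)) (snd c x) (dderiv (\<lambda>y. snd c (cinv d y)) (snd d x) v)"
proof -
  note co = mchart_chart_on[OF c(1)] mchart_chart_on[OF d(1)]
  let ?S = "snd d ` (U \<inter> fst c \<inter> fst d)"
  have S: "ropen E ?S" by (rule mopen_chart[OF d(1) mopen_Int[OF mchart_premfd[OF c(1)] sfun_mopen[OF f] mopen_dom[OF c(1)]]])
  have sm: "smooth_on ?S (\<lambda>y. snd c (cinv d y))"
    by (rule smooth_on_subset[OF mchart_trans_smooth[OF d(1) c(1)]]) auto
  have im: "(\<lambda>y. snd c (cinv d y)) ` ?S \<subseteq> snd c ` (U \<inter> fst c)" using co by auto
  have xS: "snd d x \<in> ?S" using x c d by auto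
  have smf: "smooth_on ?S (\<lambda>y. f (cinv c (snd c (cinv d y))))"
    by (rule smooth_on_compose[OF sfun_chart[OF c(1) f] sm im])
  have "dderiv (\<lambda>y. f (cinv d y)) (snd d x) v = dderiv (\<lambda>y. f (cinv c (snd c (cinv d y)))) (snd d x) v"
    by (rule dderiv_cong[OF S smf xS v]) (use co in auto)
  also have "\<dots> = dderiv (\<lambda>y. f (cinv c y)) (snd c (cinv d (snd d x))) (dderiv (\<lambda>y. snd c (cinv d y)) (snd d x) v)"
    by (rule dderiv_chain[OF S sm xS v mopen_chart[OF c(1) sfun_mopen[OF f]] sfun_chart[OF c(1) f] im])
  finally show ?thesis using cinv_snd[OF co(2) d(2)] by simp
qed

lemma mchart_trans_self:
  assumes c: "mchart M F c" "x \<in> fst c" and v: "v \<in> F"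
  shows "dderiv (\<lambda>y. snd c (cinv c y)) (snd c x) v = v"
  using dderiv_cong[OF mchart_ropen[OF c(1)] smooth_on_ident _ v, of "snd c x" "\<lambda>y. snd c (cinv c y)"] c(2) by auto

lemma mchart_trans_inverse:
  assumes c: "mchart M F c" "x \<in> fst c" and d: "mchart M E d" "x \<in> fst d" and v: "v \<in> E"
  shows "dderiv (\<lambda>y. snd d (cinv c y)) (snd c x) (dderiv (\<lambda>y. snd c (cinv d y)) (snd d x) v) = v"
  using sfun_deriv_trans[OF sfun_dom[OF d(1)] d(2) c d v] mchart_trans_self[OF d v] by simp

lemma tder_eq: "tder M f x v = dderiv (\<lambda>y. f (cinv (chart_at M x) y)) (snd (chart_at M x) x) v"
  by (simp add: tder_def o_def)

lemma coords_eq: "coords M c x v = dderiv (\<lambda>y. snd c (cinv (chart_at M x) y)) (snd (chart_at M x) x) v"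
  by (simp add: coords_def tder_eq)

lemma uncoords_eq: "uncoords M c x w = dderiv (\<lambda>y. snd (chart_at M x) (cinv c y)) (snd c x) w"
  by (simp add: uncoords_def o_def)

context
  fixes M :: "('a, 'e::euclidean_space) mfd" and F :: "'f::euclidean_space set" and c x
  assumes c: "mchart M F c" and x: "x \<in> fst c"
begin

lemma chart_pt: "x \<in> pts M"
  using mchart_pts[OF c] x by auto

lemma chart_at_chart: "mchart M (model M) (chart_at M x)" "x \<in> fst (chart_at M x)"
  using chart_at_mchart[OF mchart_premfd[OF c] chart_pt] chart_at(2)[OF chart_pt] by auto

lemma coords_mem: "v \<in> model M \<Longrightarrow> coords M c x v \<in> F"
  unfolding coords_eq by (rule mchart_trans_deriv_mem[OF chart_at_chart(1) c chart_at_chart(2) x])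

lemma uncoords_mem: "w \<in> F \<Longrightarrow> uncoords M c x w \<in> model M"
  unfolding uncoords_eq by (rule mchart_trans_deriv_mem[OF c chart_at_chart(1) x chart_at_chart(2)])

lemma coords_uncoords: "w \<in> F \<Longrightarrow> coords M c x (uncoords M c x w) = w"
  unfolding coords_eq uncoords_eq by (rule mchart_trans_inverse[OF chart_at_chart c x])

lemma uncoords_coords: "v \<in> model M \<Longrightarrow> uncoords M c x (coords M c x v) = v"
  unfolding coords_eq uncoords_eq by (rule mchart_trans_inverse[OF c x chart_at_chart])

lemma coords_lin: "lin_on (model M) (coords M c x)"
proof -
  have "coords M c x = dderiv (\<lambda>y. snd c (cinv (chart_at M x) y)) (snd (chart_at M x) x)" by (rule ext) (rule coords_eq)
  then show ?thesis
    using dderiv_lin_on[OF mchart_trans_ropen[OF chart_at_chart(1) c] mchart_trans_smooth[OF chart_at_chart(1) c]] x chart_at_chart(2)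
    by auto
qed

lemma uncoords_lin: "lin_on F (uncoords M c x)"
proof -
  have "uncoords M c x = dderiv (\<lambda>y. snd (chart_at M x) (cinv c y)) (snd c x)" by (rule ext) (rule uncoords_eq)
  then show ?thesis
    using dderiv_lin_on[OF mchart_trans_ropen[OF c chart_at_chart(1)] mchart_trans_smooth[OF c chart_at_chart(1)]] x chart_at_chart(2)
    by auto
qed

lemma tder_chart:
  assumes "sfun M U f" "x \<in> U" "v \<in> model M"
  shows "tder M f x v = dderiv (\<lambda>y. f (cinv c y)) (snd c x) (coords M c x v)"
  unfolding tder_eq coords_eq by (rule sfun_deriv_trans[OF assms(1,2) c x chart_at_chart assms(3)])

lemma uncoords_change:
  assumes d: "mchart M E d" "x \<in> fst d" and w: "w \<in> E"
  shows "uncoords M c x (dderiv (\<lambda>y. snd c (cinv d y)) (snd d x) w) = uncoords M d x w"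
  unfolding uncoords_eq by (rule sfun_deriv_trans[OF sfun_dom[OF chart_at_chart(1)] chart_at_chart(2) c x d w, symmetric])

lemma coords_change:
  assumes d: "mchart M E d" "x \<in> fst d" and v: "v \<in> model M"
  shows "coords M c x v = dderiv (\<lambda>y. snd c (cinv d y)) (snd d x) (coords M d x v)"
  unfolding coords_eq by (rule sfun_deriv_trans[OF sfun_dom[OF c] x d chart_at_chart v])

end

lemma coords_chart_at:
  assumes "premfd M" "x \<in> pts M" "v \<in> model M"
  shows "coords M (chart_at M x) x v = v"
  unfolding coords_eq by (rule mchart_trans_self[OF chart_at_mchart[OF assms(1,2)] chart_at(2)[OF assms(2)] assms(3)])

lemma uncoords_chart_at:
  assumes "premfd M" "x \<in> pts M" "v \<in> model M"
  shows "uncoords M (chart_at M x) x v = v"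
  unfolding uncoords_eq by (rule mchart_trans_self[OF chart_at_mchart[OF assms(1,2)] chart_at(2)[OF assms(2)] assms(3)])

lemma tder_lin:
  assumes "premfd M" "sfun M U f" "x \<in> U"
  shows "lin_on (model M) (tder M f x)"
proof -
  have x: "x \<in> pts M" by (rule sfun_pts[OF assms(2,3)])
  note c = chart_at_mchart[OF assms(1) x]
  have "tder M f x = dderiv (\<lambda>y. f (cinv (chart_at M x) y)) (snd (chart_at M x) x)" by (rule ext) (rule tder_eq)
  then show ?thesis
    using dderiv_lin_on[OF mopen_chart[OF c sfun_mopen[OF assms(2)]] sfun_chart[OF c assms(2)]] assms(3) chart_at(2)[OF x]
    by auto
qed

lemma tder_mem:
  fixes f :: "'a \<Rightarrow> 'w::euclidean_space"
  assumes "premfd M" "sfun M U f" "x \<in> U" "v \<in> model M" "subspace F" "f ` U \<subseteq> F"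
  shows "tder M f x v \<in> F"
proof -
  have x: "x \<in> pts M" by (rule sfun_pts[OF assms(2,3)])
  note c = chart_at_mchart[OF assms(1) x]
  show ?thesis
    unfolding tder_eq
    by (rule dderiv_mem[OF mopen_chart[OF c sfun_mopen[OF assms(2)]] sfun_chart[OF c assms(2)] _ assms(4,5)])
       (use assms(3,6) chart_at(2)[OF x] mchart_chart_on[OF c] in auto)
qed

lemma tder_cong:
  assumes "premfd M" "sfun M U f" "x \<in> U" "v \<in> model M" "\<And>y. y \<in> U \<Longrightarrow> f y = g y"
  shows "tder M g x v = tder M f x v"
proof -
  have x: "x \<in> pts M" by (rule sfun_pts[OF assms(2,3)])
  note c = chart_at_mchart[OF assms(1) x]
  show ?thesis
    unfolding tder_eq
    by (rule dderiv_cong[OF mopen_chart[OF c sfun_mopen[OF assms(2)]] sfun_chart[OF c assms(2)] _ assms(4)])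
       (use assms(3,5) chart_at(2)[OF x] mchart_chart_on[OF c] in auto)
qed

context
  fixes M :: "('a, 'e::euclidean_space) mfd" and N :: "('b, 'f::euclidean_space) mfd" and f
  assumes M: "premfd M" and N: "premfd N" and f: "smooth_map M N f"
begin

lemma smooth_map_chart: "mchart N F d \<Longrightarrow> sfun M (pts M \<inter> f -` fst d) (\<lambda>x. snd d (f x))"
  by (rule smooth_map_sfun[OF M N f sfun_dom])

lemma tmap_mem: "x \<in> pts M \<Longrightarrow> v \<in> model M \<Longrightarrow> tmap M N f x v \<in> model N"
proof -
  assume x: "x \<in> pts M" and v: "v \<in> model M"
  have fx: "f x \<in> pts N" by (rule smooth_map_pts[OF f x])
  note d = chart_at_mchart[OF N fx]
  show ?thesis
    unfolding tmap_def o_def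
    by (rule tder_mem[OF M smooth_map_chart[OF d] _ v premfd_subspace[OF N]])
       (use x fx chart_at(2)[OF fx] chart_image_subset[OF mchart_chart_on[OF d]] in auto)
qed

lemma tmap_lin: "x \<in> pts M \<Longrightarrow> lin_on (model M) (tmap M N f x)"
proof -
  assume x: "x \<in> pts M"
  have fx: "f x \<in> pts N" by (rule smooth_map_pts[OF f x])
  have "tmap M N f x = tder M (\<lambda>y. snd (chart_at N (f x)) (f y)) x"
    by (rule ext) (simp add: tmap_def o_def)
  then show ?thesis
    using tder_lin[OF M smooth_map_chart[OF chart_at_mchart[OF N fx]], of x] x chart_at(2)[OF fx] by simp
qed

text \<open>The chain rule read in the chosen charts at \<open>x\<close> and at \<open>f x\<close>.
  Domains have to be shrunk first, because \<open>f\<close> need not map the first chart into the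
  second.\<close>

lemma tder_tmap:
  assumes g: "sfun N V g" and x: "x \<in> pts M" "f x \<in> V" and v: "v \<in> model M"
  shows "tder N g (f x) (tmap M N f x v) = tder M (\<lambda>x. g (f x)) x v"
proof -
  have fx: "f x \<in> pts N" by (rule smooth_map_pts[OF f x(1)])
  note c = chart_at_mchart[OF M x(1)] chart_at_mchart[OF N fx]
  note ci = chart_at(2)[OF x(1)] chart_at(2)[OF fx]
  let ?c = "chart_at M x" and ?d = "chart_at N (f x)"
  note co = mchart_chart_on[OF c(1)] mchart_chart_on[OF c(2)]
  let ?U = "pts M \<inter> f -` (V \<inter> fst ?d)"
  have VU: "mopen N (V \<inter> fst ?d)" by (rule mopen_Int[OF N sfun_mopen[OF g] mopen_dom[OF c(2)]])
  have U: "mopen M ?U" by (rule sfun_mopen[OF smooth_map_sfun[OF M N f sfun_const[OF VU]]])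
  have S: "ropen (model M) (snd ?c ` (?U \<inter> fst ?c))" (is "ropen _ ?S") by (rule mopen_chart[OF c(1) U])
  have sm: "smooth_on ?S (\<lambda>y. snd ?d (f (cinv ?c y)))"
    by (rule sfun_chart[OF c(1) sfun_subset[OF smooth_map_chart[OF c(2)] U]]) auto
  have im: "(\<lambda>y. snd ?d (f (cinv ?c y))) ` ?S \<subseteq> snd ?d ` (V \<inter> fst ?d)" using co by auto
  have xS: "snd ?c x \<in> ?S" using x fx ci by auto
  have "tder M (\<lambda>x. g (f x)) x v = dderiv (\<lambda>y. g (f (cinv ?c y))) (snd ?c x) v" by (simp add: tder_eq)
  also have "\<dots> = dderiv (\<lambda>y. g (cinv ?d (snd ?d (f (cinv ?c y))))) (snd ?c x) v"
    by (rule dderiv_cong[OF S smooth_on_compose[OF sfun_chart[OF c(2) g] sm im] xS v]) (use co in auto)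
  also have "\<dots> = dderiv (\<lambda>y. g (cinv ?d y)) (snd ?d (f (cinv ?c (snd ?c x)))) (dderiv (\<lambda>y. snd ?d (f (cinv ?c y))) (snd ?c x) v)"
    by (rule dderiv_chain[OF S sm xS v mopen_chart[OF c(2) sfun_mopen[OF g]] sfun_chart[OF c(2) g] im])
  also have "\<dots> = tder N g (f x) (tmap M N f x v)"
    using cinv_snd[OF co(1) ci(1)] by (simp add: tder_eq tmap_def)
  finally show ?thesis by simp
qed

lemma coords_tmap:
  assumes d: "mchart N F d" "f x \<in> fst d" and x: "x \<in> pts M" and v: "v \<in> model M"
  shows "coords N d (f x) (tmap M N f x v) = tder M (\<lambda>x. snd d (f x)) x v"
  unfolding coords_def by (rule tder_tmap[OF sfun_dom[OF d(1)] x d(2) v])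

lemma coords_tmap_chart:
  assumes d: "mchart N F d" "f x \<in> fst d" and c: "mchart M E c" "x \<in> fst c" and v: "v \<in> model M"
  shows "coords N d (f x) (tmap M N f x v) = dderiv (\<lambda>y. snd d (f (cinv c y))) (snd c x) (coords M c x v)"
  using coords_tmap[OF d chart_pt[OF c] v] tder_chart[OF c smooth_map_chart[OF d(1)] _ v] chart_pt[OF c] d(2) by simp

end

lemma tmap_compose:
  assumes "premfd M" "premfd N" "premfd Q" "smooth_map M N f" "smooth_map N Q g" "x \<in> pts M" "v \<in> model M"
  shows "tmap N Q g (f x) (tmap M N f x v) = tmap M Q (\<lambda>x. g (f x)) x v"
proof -
  have fx: "f x \<in> pts N" by (rule smooth_map_pts[OF assms(4,6)])
  have gfx: "g (f x) \<in> pts Q" by (rule smooth_map_pts[OF assms(5) fx])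
  show ?thesis
    using tder_tmap[OF assms(1,2,4) smooth_map_chart[OF assms(2,3,5) chart_at_mchart[OF assms(3) gfx]] assms(6) _ assms(7)] fx chart_at(2)[OF gfx]
    by (simp add: tmap_def[of _ Q] o_def)
qed

lemma tmap_ident: "premfd M \<Longrightarrow> x \<in> pts M \<Longrightarrow> v \<in> model M \<Longrightarrow> tmap M M (\<lambda>x. x) x v = v"
  using coords_chart_at[of M x v] by (simp add: tmap_def coords_def o_def)

lemma tmap_cong:
  assumes "premfd M" "premfd N" "smooth_map M N f" "x \<in> pts M" "v \<in> model M" "\<And>y. y \<in> pts M \<Longrightarrow> f y = g y"
  shows "tmap M N g x v = tmap M N f x v"
proof -
  have fx: "f x \<in> pts N" by (rule smooth_map_pts[OF assms(3,4)])
  show ?thesis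
    unfolding tmap_def assms(6)[OF assms(4), symmetric] o_def
    by (rule tder_cong[OF assms(1) smooth_map_chart[OF assms(1-3) chart_at_mchart[OF assms(2) fx]] _ assms(5)])
       (use assms(4,6) chart_at(2)[OF fx] in auto)
qed

section \<open>Forms in charts\<close>

text \<open>The pullback of \<open>\<alpha>\<close> along the inverse of the chart: a one-form on an
  open subset of the model space.\<close>

definition frep :: "('a, 'e::euclidean_space) mfd \<Rightarrow> ('a, 'f::euclidean_space) chart \<Rightarrow> ('a \<Rightarrow> 'e \<Rightarrow> 'w) \<Rightarrow> 'f \<Rightarrow> 'f \<Rightarrow> 'w" where
  "frep M c \<alpha> y z = \<alpha> (cinv c y) (uncoords M c (cinv c y) z)"

lemma frep_snd: "mchart M F c \<Longrightarrow> x \<in> fst c \<Longrightarrow> frep M c \<alpha> (snd c x) z = \<alpha> x (uncoords M c x z)"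
  by (simp add: frep_def cinv_snd[OF mchart_chart_on])

lemma frep_coords:
  "mchart M F c \<Longrightarrow> x \<in> fst c \<Longrightarrow> v \<in> model M \<Longrightarrow> frep M c \<alpha> (snd c x) (coords M c x v) = \<alpha> x v"
  by (simp add: frep_snd uncoords_coords)

lemma frep_change:
  assumes c: "mchart M F c" "x \<in> fst c" and d: "mchart M E d" "x \<in> fst d" and z: "z \<in> E"
  shows "frep M d \<alpha> (snd d x) z = frep M c \<alpha> (snd c x) (dderiv (\<lambda>y. snd c (cinv d y)) (snd d x) z)"
  by (simp add: uncoords_change[OF c d z] frep_snd[OF c] frep_snd[OF d])

text \<open>\<open>one_form\<close> tests charts of the atlas only. By \<open>frep_change\<close>
  another chart sees the pullback along the transition map, which is again smooth.\<close>

lemma one_form_lform: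
  assumes a: "one_form M \<alpha>" and d: "mchart M E d"
  shows "lform (snd d ` fst d) E (frep M d \<alpha>)"
proof (rule lformI[OF mchart_subspace[OF d]])
  have lin: "lin_on F (frep M c \<alpha> (snd c x))" if "mchart M F c" "x \<in> fst c" for F :: "'z::euclidean_space set" and c x
  proof -
    have "lin_on (model M) (\<alpha> x)" using a chart_pt[OF that] by (simp add: one_form_def)
    then show ?thesis
      using uncoords_lin[OF that] uncoords_mem[OF that] frep_snd[OF that, of \<alpha>] mchart_subspace[OF that(1)]
      by (simp add: lin_on_def subspace_add subspace_scale)
  qed
  show "lin_on E (frep M d \<alpha> y)" if "y \<in> snd d ` fst d" for y using lin[OF d] that by auto
  fix z assume z: "z \<in> E"
  show "smooth_on (snd d ` fst d) (\<lambda>y. frep M d \<alpha> y z)"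
  proof (rule smooth_on_local_openin)
    fix y assume "y \<in> snd d ` fst d"
    then obtain x where x: "x \<in> fst d" "y = snd d x" by auto
    let ?c = "chart_at M x" and ?T = "snd d ` (fst d \<inter> fst (chart_at M x))"
    note c = chart_at_chart[OF d x(1)]
    note co = mchart_chart_on[OF c(1)] mchart_chart_on[OF d]
    have cl: "lform (snd ?c ` fst ?c) (model M) (frep M ?c \<alpha>)"
    proof (rule lformI[OF mchart_subspace[OF c(1)]])
      show "lin_on (model M) (frep M ?c \<alpha> y)" if "y \<in> snd ?c ` fst ?c" for y using lin[OF c(1)] that by auto
      show "smooth_on (snd ?c ` fst ?c) (\<lambda>x. frep M ?c \<alpha> x z)" if "z \<in> model M" for z
        using a chart_at(1)[OF chart_pt[OF d x(1)]] that by (auto simp: one_form_def frep_def)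
    qed
    have "smooth_on ?T (\<lambda>y. frep M ?c \<alpha> (snd ?c (cinv d y)) (dderiv (\<lambda>y. snd ?c (cinv d y)) y z))"
      by (rule lform_smooth[OF cl mchart_trans_smooth[OF d c(1)]
            smooth_on_dderiv_const[OF mchart_trans_ropen[OF d c(1)] mchart_trans_smooth[OF d c(1)] z]])
         (use co mchart_trans_deriv_mem[OF d c(1) _ _ z] in auto)
    then have "smooth_on ?T (\<lambda>y. frep M d \<alpha> y z)"
      by (rule smooth_on_cong) (use co frep_change[OF c(1) _ d _ z, where \<alpha>=\<alpha>] in auto)
    moreover have "openin (top_of_set (snd d ` fst d)) ?T"
      using mchart_trans_ropen[OF d c(1)] mchart_ropen[OF d] ropen_subset unfolding ropen_def
      by (metis image_mono inf_le1 openin_subset_trans openin_imp_subset)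
    ultimately show "\<exists>T. openin (top_of_set (snd d ` fst d)) T \<and> y \<in> T \<and> smooth_on T (\<lambda>y. frep M d \<alpha> y z)"
      using x c(2) by blast
  qed
qed

lemma dform_cong:
  assumes "ropen E S" "\<And>z. z \<in> E \<Longrightarrow> smooth_on S (\<lambda>y. a y z)" "y \<in> S" "v \<in> E" "w \<in> E"
    "\<And>y z. y \<in> S \<Longrightarrow> z \<in> E \<Longrightarrow> a y z = b y z"
  shows "dform b y v w = dform a y v w"
  unfolding dform_def
  using dderiv_cong[OF assms(1,2) assms(3,4), of w "\<lambda>y. b y w"] dderiv_cong[OF assms(1,2) assms(3,5), of v "\<lambda>y. b y v"] assms(4-6)
  by simp

lemma ext_deriv_chart_at: "ext_deriv M \<alpha> x v w = dform (frep M (chart_at M x) \<alpha>) (snd (chart_at M x) x) v w"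
  by (simp add: ext_deriv_def dform_def frep_def Let_def)

text \<open>Naturality of the exterior derivative, from \<open>dform_pullback\<close> for the map
  expressed in the charts chosen at \<open>x\<close> and \<open>f x\<close>. Agreement of
  \<open>\<beta>\<close> with the pullback is asked only on points and tangent vectors, since forms
  are arbitrary elsewhere.\<close>

lemma ext_deriv_pullback:
  fixes M :: "('a, 'e::euclidean_space) mfd" and N :: "('b, 'f::euclidean_space) mfd"
  assumes M: "premfd M" and N: "premfd N" and f: "smooth_map M N f" and a: "one_form N \<alpha>"
    and x: "x \<in> pts M" and v: "v \<in> model M" "w \<in> model M"
    and b: "\<And>x v. x \<in> pts M \<Longrightarrow> v \<in> model M \<Longrightarrow> \<beta> x v = \<alpha> (f x) (tmap M N f x v)"
  shows "ext_deriv M \<beta> x v w = ext_deriv N \<alpha> (f x) (tmap M N f x v) (tmap M N f x w)"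
proof -
  have fx: "f x \<in> pts N" by (rule smooth_map_pts[OF f x(1)])
  note c = chart_at_mchart[OF M x] chart_at_mchart[OF N fx]
  note ci = chart_at(2)[OF x(1)] chart_at(2)[OF fx]
  let ?c = "chart_at M x" and ?d = "chart_at N (f x)"
  note co = mchart_chart_on[OF c(1)] mchart_chart_on[OF c(2)]
  let ?S = "snd ?c ` (pts M \<inter> f -` fst ?d \<inter> fst ?c)" and ?f = "\<lambda>y. snd ?d (f (cinv ?c y))"
  note sf = smooth_map_chart[OF M N f c(2)]
  have S: "ropen (model M) ?S" by (rule mopen_chart[OF c(1) sfun_mopen[OF sf]])
  have sm: "smooth_on ?S ?f" by (rule sfun_chart[OF c(1) sf])
  have im: "?f ` ?S \<subseteq> snd ?d ` fst ?d" using co by auto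
  note l = one_form_lform[OF a c(2)]
  have xS: "snd ?c x \<in> ?S" using x ci fx by auto
  have mem: "dderiv ?f y z \<in> model N" if "y \<in> ?S" "z \<in> model M" for y z
    by (rule dderiv_mem[OF S sm that premfd_subspace[OF N]])
       (use co chart_image_subset[OF co(2)] in auto)
  have "ext_deriv M \<beta> x v w = dform (frep M ?c \<beta>) (snd ?c x) v w" by (rule ext_deriv_chart_at)
  also have "\<dots> = dform (\<lambda>y z. frep N ?d \<alpha> (?f y) (dderiv ?f y z)) (snd ?c x) v w"
  proof (rule dform_cong[OF S _ xS v])
    show "smooth_on ?S (\<lambda>y. frep N ?d \<alpha> (?f y) (dderiv ?f y z))" if "z \<in> model M" for z
      by (rule lform_smooth[OF l sm smooth_on_dderiv_const[OF S sm that] im]) (use mem that in auto)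
    fix y z assume y: "y \<in> ?S" and z: "z \<in> model M"
    then obtain u where u: "u \<in> pts M" "f u \<in> fst ?d" "u \<in> fst ?c" "y = snd ?c u" by auto
    have un: "uncoords M ?c u z \<in> model M" by (rule uncoords_mem[OF c(1) u(3) z])
    have "frep M ?c \<beta> y z = \<alpha> (f u) (tmap M N f u (uncoords M ?c u z))"
      using u frep_snd[OF c(1) u(3), of \<beta>] b[OF u(1) un] by simp
    also have "\<dots> = frep N ?d \<alpha> (snd ?d (f u)) (coords N ?d (f u) (tmap M N f u (uncoords M ?c u z)))"
      by (rule frep_coords[OF c(2) u(2) tmap_mem[OF M N f u(1) un], symmetric])
    also have "coords N ?d (f u) (tmap M N f u (uncoords M ?c u z)) = dderiv ?f (snd ?c u) z"
      using coords_tmap_chart[OF M N f c(2) u(2) c(1) u(3) un] coords_uncoords[OF c(1) u(3) z] by simp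
    finally show "frep N ?d \<alpha> (?f y) (dderiv ?f y z) = frep M ?c \<beta> y z" using u co by simp
  qed
  also have "\<dots> = dform (frep N ?d \<alpha>) (?f (snd ?c x)) (dderiv ?f (snd ?c x) v) (dderiv ?f (snd ?c x) w)"
    by (rule dform_pullback[OF S mchart_ropen[OF c(2)] l sm im xS v])
  also have "\<dots> = ext_deriv N \<alpha> (f x) (tmap M N f x v) (tmap M N f x w)"
    using co ci by (simp add: ext_deriv_chart_at tmap_def tder_eq)
  finally show ?thesis .
qed

text \<open>\<open>ext_deriv\<close> is defined through the chart chosen at \<open>x\<close>;
  invariance under the transition map frees it from that choice.\<close>

lemma ext_deriv_chart:
  assumes a: "one_form M \<alpha>" and c: "mchart M F c" "x \<in> fst c" and v: "v \<in> model M" "w \<in> model M"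
  shows "ext_deriv M \<alpha> x v w = dform (frep M c \<alpha>) (snd c x) (coords M c x v) (coords M c x w)"
proof -
  note d = chart_at_chart[OF c]
  note co = mchart_chart_on[OF c(1)] mchart_chart_on[OF d(1)]
  let ?d = "chart_at M x" and ?f = "\<lambda>y. snd c (cinv (chart_at M x) y)"
  let ?S = "snd ?d ` (fst ?d \<inter> fst c)"
  note S = mchart_trans_ropen[OF d(1) c(1)] and sm = mchart_trans_smooth[OF d(1) c(1)]
  note l = one_form_lform[OF a c(1)]
  have im: "?f ` ?S \<subseteq> snd c ` fst c" using co by auto
  have xS: "snd ?d x \<in> ?S" using c d by auto
  have "ext_deriv M \<alpha> x v w = dform (frep M ?d \<alpha>) (snd ?d x) v w" by (rule ext_deriv_chart_at)
  also have "\<dots> = dform (\<lambda>y z. frep M c \<alpha> (?f y) (dderiv ?f y z)) (snd ?d x) v w"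
  proof (rule dform_cong[OF S _ xS v])
    show "smooth_on ?S (\<lambda>y. frep M c \<alpha> (?f y) (dderiv ?f y z))" if "z \<in> model M" for z
      by (rule lform_smooth[OF l sm smooth_on_dderiv_const[OF S sm that] im])
         (use mchart_trans_deriv_mem[OF d(1) c(1) _ _ that] in auto)
    show "frep M c \<alpha> (?f y) (dderiv ?f y z) = frep M ?d \<alpha> y z" if "y \<in> ?S" "z \<in> model M" for y z
      using that co frep_change[OF c(1) _ d(1) _ that(2), where \<alpha>=\<alpha>] by auto
  qed
  also have "\<dots> = dform (frep M c \<alpha>) (?f (snd ?d x)) (dderiv ?f (snd ?d x) v) (dderiv ?f (snd ?d x) w)"
    by (rule dform_pullback[OF S mchart_ropen[OF c(1)] l sm im xS v])
  finally show ?thesis using co d by (simp add: coords_eq)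
qed

lemma dform_lin:
  assumes S: "ropen E S" and a: "lform S E a" and y: "y \<in> S" "w \<in> E"
  shows "lin_on E (\<lambda>v. dform a y v w)"
  unfolding lin_on_def
proof (intro ballI allI)
  fix v v' r r' assume v: "v \<in> E" "v' \<in> E"
  have sm: "smooth_on S (\<lambda>y. a y z)" if "z \<in> E" for z
    by (rule lform_smooth[OF a smooth_on_ident smooth_on_const]) (use that in auto)
  have E: "subspace E" using S by (simp add: ropen_def)
  have "dderiv (\<lambda>y. a y (r *\<^sub>R v + r' *\<^sub>R v')) y w = dderiv (\<lambda>y. r *\<^sub>R a y v + r' *\<^sub>R a y v') y w"
    by (rule dderiv_cong[OF S _ y])
       (use v lin_onD[OF lform_lin[OF a]] in \<open>auto intro!: smooth_on_add smooth_on_linear[OF sm bounded_linear_scaleR_right]\<close>)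
  also have "\<dots> = r *\<^sub>R dderiv (\<lambda>y. a y v) y w + r' *\<^sub>R dderiv (\<lambda>y. a y v') y w"
  proof -
    have "dderiv (\<lambda>y. (a y v, a y v')) y w = (dderiv (\<lambda>y. a y v) y w, dderiv (\<lambda>y. a y v') y w)"
      by (rule dderiv_Pair[OF S sm[OF v(1)] sm[OF v(2)] y])
    moreover have "bounded_linear (\<lambda>p::'b\<times>'b. r *\<^sub>R fst p + r' *\<^sub>R snd p)"
      by (intro bounded_linear_intros bounded_linear_fst bounded_linear_snd)
    ultimately show ?thesis
      using dderiv_linear[OF S smooth_on_Pair[OF sm[OF v(1)] sm[OF v(2)]] y, of "\<lambda>p. r *\<^sub>R fst p + r' *\<^sub>R snd p"] by simp
  qed
  finally show "dform a y (r *\<^sub>R v + r' *\<^sub>R v') w = r *\<^sub>R dform a y v w + r' *\<^sub>R dform a y v' w"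
    unfolding dform_def lin_onD[OF dderiv_lin_on[OF S sm[OF y(2)] y(1)] v] by (simp add: scaleR_right_diff_distrib)
qed

lemma dform_antisym: "dform a y w v = - dform a y v w"
  by (simp add: dform_def)

lemma ext_deriv_antisym: "ext_deriv M \<alpha> x w v = - ext_deriv M \<alpha> x v w"
  by (simp add: ext_deriv_chart_at dform_antisym[of _ _ w])

lemma ext_deriv_lin:
  assumes "premfd M" "one_form M \<alpha>" "x \<in> pts M" "w \<in> model M"
  shows "lin_on (model M) (\<lambda>v. ext_deriv M \<alpha> x v w)"
  unfolding ext_deriv_chart_at
  by (rule dform_lin[OF mchart_ropen one_form_lform[OF assms(2)] _ assms(4), OF chart_at_mchart[OF assms(1,3)] chart_at_mchart[OF assms(1,3)]])
     (use chart_at(2)[OF assms(3)] in auto)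

text \<open>In the formula \<open>d\<alpha>(Z,W) = Z(\<alpha>(W)) - W(\<alpha>(Z)) -
  \<alpha>([Z,W])\<close> the first two terms vanish, because \<open>\<alpha>\<close> is constant
  along both fields. In coordinates this constancy is differentiated: it trades the derivative of
  the form for that of the field.\<close>

lemma ext_deriv_bracket:
  assumes M: "premfd M" and a: "one_form M \<alpha>" and x: "x \<in> pts M"
    and Z: "\<And>x. x \<in> pts M \<Longrightarrow> Z x \<in> model M" "\<And>x. x \<in> pts M \<Longrightarrow> \<alpha> x (Z x) = z"
      "smooth_on (snd (chart_at M x) ` fst (chart_at M x)) (\<lambda>y. coords M (chart_at M x) (cinv (chart_at M x) y) (Z (cinv (chart_at M x) y)))"
    and W: "\<And>x. x \<in> pts M \<Longrightarrow> W x \<in> model M" "\<And>x. x \<in> pts M \<Longrightarrow> \<alpha> x (W x) = w"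
      "smooth_on (snd (chart_at M x) ` fst (chart_at M x)) (\<lambda>y. coords M (chart_at M x) (cinv (chart_at M x) y) (W (cinv (chart_at M x) y)))"
  shows "ext_deriv M \<alpha> x (Z x) (W x) = - \<alpha> x (lie_bracket M Z W x)" "lie_bracket M Z W x \<in> model M"
proof -
  let ?c = "chart_at M x"
  note c = chart_at_mchart[OF M x] chart_at(2)[OF x]
  note co = mchart_chart_on[OF c(1)]
  let ?S = "snd ?c ` fst ?c"
  let ?r = "\<lambda>Z y. coords M ?c (cinv ?c y) (Z (cinv ?c y))"
  let ?a = "frep M ?c \<alpha>"
  note S = mchart_ropen[OF c(1)] and l = one_form_lform[OF a c(1)]
  have xS: "snd ?c x \<in> ?S" using c by auto
  have pt: "u \<in> pts M" if "u \<in> fst ?c" for u using mchart_pts[OF c(1)] that by auto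
  have rx: "?r Z (snd ?c x) = Z x" if "Z x \<in> model M" for Z
    using co c coords_chart_at[OF M x that] by simp
  have *: "dderiv (\<lambda>y. ?a y (Z x)) (snd ?c x) v = - ?a (snd ?c x) (dderiv (?r Z) (snd ?c x) v) \<and> dderiv (?r Z) (snd ?c x) v \<in> model M"
    if Z: "\<And>x. x \<in> pts M \<Longrightarrow> Z x \<in> model M" "\<And>x. x \<in> pts M \<Longrightarrow> \<alpha> x (Z x) = z" "smooth_on ?S (?r Z)" and v: "v \<in> model M" for Z z v
  proof -
    have im: "?r Z ` ?S \<subseteq> model M" using co pt Z(1) coords_mem[OF c(1)] by auto
    have cst: "z = ?a y (?r Z y)" if "y \<in> ?S" for y
      using that co pt Z(1,2) frep_coords[OF c(1), where \<alpha>=\<alpha>] by auto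
    have "0 = dderiv (\<lambda>y. ?a y (?r Z y)) (snd ?c x) v"
      by (subst dderiv_cong[OF S smooth_on_const[of _ z] xS v cst]) simp_all
    also have "\<dots> = dderiv (\<lambda>y. ?a y (?r Z (snd ?c x))) (snd ?c x) v + ?a (snd ?c x) (dderiv (?r Z) (snd ?c x) v)"
      using lform_dderiv[OF S premfd_subspace[OF M] S l smooth_on_ident _ Z(3) im xS v] by simp
    finally have "dderiv (\<lambda>y. ?a y (Z x)) (snd ?c x) v = - ?a (snd ?c x) (dderiv (?r Z) (snd ?c x) v)"
      using rx[of Z, OF Z(1)[OF x]] by (simp add: eq_neg_iff_add_eq_0)
    then show ?thesis using dderiv_mem[OF S Z(3) xS v premfd_subspace[OF M] im] by simp
  qed
  note 1 = *[OF Z W(1)[OF x]] and 2 = *[OF W Z(1)[OF x]]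
  have br: "lie_bracket M Z W x = dderiv (?r W) (snd ?c x) (Z x) - dderiv (?r Z) (snd ?c x) (W x)"
    by (simp add: lie_bracket_def Let_def)
  then show mem: "lie_bracket M Z W x \<in> model M" using 1 2 premfd_subspace[OF M] by (simp add: subspace_diff)
  have "ext_deriv M \<alpha> x (Z x) (W x) = - ?a (snd ?c x) (lie_bracket M Z W x)"
    unfolding ext_deriv_chart_at dform_def br using 1 2 lin_on_diff[OF lform_lin[OF l xS]] by simp
  then show "ext_deriv M \<alpha> x (Z x) (W x) = - \<alpha> x (lie_bracket M Z W x)"
    using frep_snd[OF c(1,2), of \<alpha>] uncoords_chart_at[OF M x mem] by simp
qed

lemma one_formI:
  assumes M: "premfd M" and lin: "\<And>x. x \<in> pts M \<Longrightarrow> lin_on (model M) (\<alpha> x)"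
    and loc: "\<And>x. x \<in> pts M \<Longrightarrow> \<exists>c. mchart M F c \<and> x \<in> fst c \<and> lform (snd c ` fst c) F (frep M c \<alpha>)"
  shows "one_form M \<alpha>"
  unfolding one_form_def
proof (intro conjI ballI lin)
  fix d z assume d: "d \<in> atlas M" and z: "z \<in> model M"
  have dm: "mchart M (model M) d" by (rule atlas_mchart[OF M d])
  have "smooth_on (snd d ` fst d) (\<lambda>y. frep M d \<alpha> y z)"
  proof (rule smooth_on_local_openin)
    fix y assume "y \<in> snd d ` fst d"
    then obtain x where x: "x \<in> fst d" "y = snd d x" by auto
    obtain c where c: "mchart M F c" "x \<in> fst c" "lform (snd c ` fst c) F (frep M c \<alpha>)"
      using loc[OF chart_pt[OF dm x(1)]] by blast
    note co = mchart_chart_on[OF c(1)] mchart_chart_on[OF dm]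
    let ?T = "snd d ` (fst d \<inter> fst c)"
    have "smooth_on ?T (\<lambda>y. frep M c \<alpha> (snd c (cinv d y)) (dderiv (\<lambda>y. snd c (cinv d y)) y z))"
      by (rule lform_smooth[OF c(3) mchart_trans_smooth[OF dm c(1)]
            smooth_on_dderiv_const[OF mchart_trans_ropen[OF dm c(1)] mchart_trans_smooth[OF dm c(1)] z]])
         (use co mchart_trans_deriv_mem[OF dm c(1) _ _ z] in auto)
    then have "smooth_on ?T (\<lambda>y. frep M d \<alpha> y z)"
      by (rule smooth_on_cong) (use co frep_change[OF c(1) _ dm _ z, where \<alpha>=\<alpha>] in auto)
    moreover have "openin (top_of_set (snd d ` fst d)) ?T"
      using mchart_trans_ropen[OF dm c(1)] mchart_ropen[OF dm] ropen_subset unfolding ropen_def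
      by (metis image_mono inf_le1 openin_subset_trans openin_imp_subset)
    ultimately show "\<exists>T. openin (top_of_set (snd d ` fst d)) T \<and> y \<in> T \<and> smooth_on T (\<lambda>y. frep M d \<alpha> y z)"
      using x c(2) by blast
  qed
  then show "smooth_on (snd d ` fst d) (\<lambda>y. \<alpha> (cinv d y) (uncoords M d (cinv d y) z))"
    by (simp add: frep_def)
qed

section \<open>Products, open subsets and submanifolds\<close>

definition pchart :: "('a, 'e) chart \<Rightarrow> ('b, 'f) chart \<Rightarrow> ('a \<times> 'b, 'e \<times> 'f) chart" where
  "pchart c d = (fst c \<times> fst d, map_prod (snd c) (snd d))"

lemma fst_pchart [simp]: "fst (pchart c d) = fst c \<times> fst d"
  and snd_pchart [simp]: "snd (pchart c d) p = (snd c (fst p), snd d (snd p))"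
  by (auto simp: pchart_def map_prod_def split_beta)

lemma pchart_image [simp]: "(\<lambda>p. (snd c (fst p), snd d (snd p))) ` (A \<times> B) = snd c ` A \<times> snd d ` B"
  by (force simp: image_iff)

lemma chart_on_pchart: "chart_on E c \<Longrightarrow> chart_on F d \<Longrightarrow> chart_on (E \<times> F) (pchart c d)"
  unfolding chart_on_def by (auto simp: pchart_image inj_on_def intro!: openin_Times)

lemma cinv_pchart:
  assumes "chart_on E c" "chart_on F d" "y \<in> snd c ` fst c" "z \<in> snd d ` fst d"
  shows "cinv (pchart c d) (y, z) = (cinv c y, cinv d z)"
proof -
  have "(y, z) = snd (pchart c d) (cinv c y, cinv d z)" using assms by simp
  then show ?thesis
    using cinv_snd[OF chart_on_pchart[OF assms(1,2)], of "(cinv c y, cinv d z)"] cinv_mem[OF assms(3)] cinv_mem[OF assms(4)] by simp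
qed

lemma compat_pchart:
  assumes co: "chart_on E c" "chart_on F d" "chart_on E' c'" "chart_on F' d'"
    and "compat E c E' c'" "compat F d F' d'"
  shows "compat (E \<times> F) (pchart c d) (E' \<times> F') (pchart c' d')"
proof -
  \<comment> \<open>Compatibility consists of two halves that exchange the charts. One half is shown
    for arbitrary spaces and charts and used twice, so the types of the four spaces have to be kept
    independent.\<close>
  have half: "openin (top_of_set (E \<times> F)) (snd (pchart c d) ` (fst (pchart c d) \<inter> fst (pchart c' d'))) \<and>
      smooth_on (snd (pchart c d) ` (fst (pchart c d) \<inter> fst (pchart c' d'))) (snd (pchart c' d') \<circ> cinv (pchart c d))"
    if co: "chart_on E c" "chart_on F d" and cc: "compat E c E' c'" "compat F d F' d'"
    for E :: "'x::euclidean_space set" and F :: "'y::euclidean_space set" and E' :: "'z::euclidean_space set"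
    and F' :: "'w::euclidean_space set" and c d c' d'
  proof -
    have eq: "snd (pchart c d) ` (fst (pchart c d) \<inter> fst (pchart c' d')) = snd c ` (fst c \<inter> fst c') \<times> snd d ` (fst d \<inter> fst d')"
      by (simp add: Times_Int_Times pchart_image)
    let ?S = "snd c ` (fst c \<inter> fst c') \<times> snd d ` (fst d \<inter> fst d')"
    have s1: "smooth_on ?S (\<lambda>p. snd c' (cinv c (fst p)))"
      by (rule smooth_on_compose[of "snd c ` (fst c \<inter> fst c')" "\<lambda>y. snd c' (cinv c y)", OF _ smooth_on_fst[OF smooth_on_ident]])
         (use cc(1) in \<open>auto simp: compat_def o_def\<close>)
    have s2: "smooth_on ?S (\<lambda>p. snd d' (cinv d (snd p)))"
      by (rule smooth_on_compose[of "snd d ` (fst d \<inter> fst d')" "\<lambda>y. snd d' (cinv d y)", OF _ smooth_on_snd[OF smooth_on_ident]])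
         (use cc(2) in \<open>auto simp: compat_def o_def\<close>)
    have "smooth_on ?S (snd (pchart c' d') \<circ> cinv (pchart c d))"
    proof (rule smooth_on_cong[OF smooth_on_Pair[OF s1 s2]])
      fix p assume p: "p \<in> ?S"
      then have "cinv (pchart c d) p = (cinv c (fst p), cinv d (snd p))"
        using cinv_pchart[OF co, of "fst p" "snd p"] by force
      then show "(snd c' (cinv c (fst p)), snd d' (cinv d (snd p))) = (snd (pchart c' d') \<circ> cinv (pchart c d)) p" by simp
    qed
    then show ?thesis unfolding eq using cc by (auto simp: compat_def intro!: openin_Times)
  qed
  show ?thesis
    using half[OF co(1,2) assms(5,6)] half[OF co(3,4) compat_sym[OF assms(5)] compat_sym[OF assms(6)]]
    unfolding compat_def by (auto simp: Int_commute)
qed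

lemma atlas_prod: "atlas (prod_mfd M N) = {pchart c d |c d. c \<in> atlas M \<and> d \<in> atlas N}"
  by (simp add: prod_mfd_def pchart_def)

lemma model_prod [simp]: "model (prod_mfd M N) = model M \<times> model N"
  by (simp add: prod_mfd_def)

lemma pts_prod [simp]: "pts (prod_mfd M N) = pts M \<times> pts N"
  unfolding pts_def atlas_prod by fastforce

lemma premfd_prod:
  assumes "premfd M" "premfd N"
  shows "premfd (prod_mfd M N)"
  using assms unfolding premfd_def atlas_prod
  by (auto intro!: subspace_Times chart_on_pchart compat_pchart)

lemma mchart_prod:
  assumes c: "mchart M E c" and d: "mchart N F d"
  shows "mchart (prod_mfd M N) (E \<times> F) (pchart c d)"
proof -
  have "compat (E \<times> F) (pchart c d) (model M \<times> model N) (pchart c' d')" if "c' \<in> atlas M" "d' \<in> atlas N" for c' d'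
    using mchart_chart_on[OF atlas_mchart[OF mchart_premfd[OF c] that(1)]] mchart_chart_on[OF atlas_mchart[OF mchart_premfd[OF d] that(2)]]
    by (intro compat_pchart mchart_chart_on[OF c] mchart_chart_on[OF d] mchart_compat[OF c that(1)] mchart_compat[OF d that(2)])
  then show ?thesis
    using premfd_prod[OF mchart_premfd[OF c] mchart_premfd[OF d]] mchart_pts[OF c] mchart_pts[OF d]
      mchart_subspace[OF c] mchart_subspace[OF d] chart_on_pchart[OF mchart_chart_on[OF c] mchart_chart_on[OF d]]
    unfolding mchart_def charts_in_def atlas_prod by (auto simp: subspace_Times)
qed

lemma smooth_map_Pair:
  assumes Q: "premfd Q" and f: "smooth_map Q M f" and g: "smooth_map Q N g"
  shows "smooth_map Q (prod_mfd M N) (\<lambda>x. (f x, g x))"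
  unfolding smooth_map_iff[OF Q]
proof (intro conjI ballI)
  show "(\<lambda>x. (f x, g x)) ` pts Q \<subseteq> pts (prod_mfd M N)"
    using smooth_map_pts[OF f] smooth_map_pts[OF g] by auto
  fix e assume "e \<in> atlas (prod_mfd M N)"
  then obtain c d where e: "e = pchart c d" "c \<in> atlas M" "d \<in> atlas N" by (auto simp: atlas_prod)
  have s: "sfun Q (pts Q \<inter> f -` fst c) (\<lambda>x. snd c (f x))" "sfun Q (pts Q \<inter> g -` fst d) (\<lambda>x. snd d (g x))"
    using f g e(2,3) unfolding smooth_map_iff[OF Q] by auto
  have eq: "pts Q \<inter> (\<lambda>x. (f x, g x)) -` fst e = (pts Q \<inter> f -` fst c) \<inter> (pts Q \<inter> g -` fst d)"
    unfolding e by auto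
  have m: "mopen Q (pts Q \<inter> (\<lambda>x. (f x, g x)) -` fst e)"
    unfolding eq by (rule mopen_Int[OF Q sfun_mopen[OF s(1)] sfun_mopen[OF s(2)]])
  have "sfun Q (pts Q \<inter> (\<lambda>x. (f x, g x)) -` fst e) (\<lambda>x. (snd c (f x), snd d (g x)))"
    by (rule sfun_Pair[OF sfun_subset[OF s(1) m] sfun_subset[OF s(2) m]]) (auto simp: e)
  then show "sfun Q (pts Q \<inter> (\<lambda>x. (f x, g x)) -` fst e) (\<lambda>x. snd e (f x, g x))" by (simp add: e)
qed

lemma open_sub_atlas: "c \<in> atlas M \<Longrightarrow> (fst c \<inter> W, snd c) \<in> atlas (open_sub M W)"
proof -
  assume "c \<in> atlas M"
  then show ?thesis unfolding open_sub_def mfd.simps by blast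
qed

lemma open_sub_pts: "W \<subseteq> pts M \<Longrightarrow> pts (open_sub M W) = W"
proof
  assume W: "W \<subseteq> pts M"
  show "pts (open_sub M W) \<subseteq> W" by (auto simp: pts_def open_sub_def)
  show "W \<subseteq> pts (open_sub M W)"
  proof
    fix x assume x: "x \<in> W"
    then obtain c where c: "c \<in> atlas M" "x \<in> fst c" using W by (auto simp: pts_def)
    then show "x \<in> pts (open_sub M W)" unfolding pts_def using open_sub_atlas[OF c(1)] x by fastforce
  qed
qed

lemma sfun_open_sub:
  assumes M: "premfd M" and f: "sfun (open_sub M W) U f" and U: "U \<subseteq> W"
  shows "sfun M U f"
proof -
  have *: "openin (top_of_set (model M)) (snd c ` (U \<inter> fst c)) \<and> smooth_on (snd c ` (U \<inter> fst c)) (\<lambda>y. f (cinv c y))"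
    if c: "c \<in> atlas M" for c
  proof -
    let ?c = "(fst c \<inter> W, snd c)"
    have co: "chart_on (model M) c" by (rule mchart_chart_on[OF atlas_mchart[OF M c]])
    have cW: "?c \<in> atlas (open_sub M W)" by (rule open_sub_atlas[OF c])
    have eq: "U \<inter> fst ?c = U \<inter> fst c" using U by auto
    have inj: "inj_on (snd c) (fst c \<inter> W)" using co unfolding chart_on_def by (meson inf_le1 inj_on_subset)
    have "cinv ?c y = cinv c y" if "y \<in> snd c ` (U \<inter> fst c)" for y
      using that U co inj by (auto simp: cinv_def[of ?c])
    then have "smooth_on (snd c ` (U \<inter> fst c)) (\<lambda>y. f (cinv c y))"
      using f cW eq smooth_on_cong[of "snd c ` (U \<inter> fst c)" "\<lambda>y. f (cinv ?c y)" "\<lambda>y. f (cinv c y)"]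
      unfolding sfun_def by fastforce
    moreover have "openin (top_of_set (model M)) (snd c ` (U \<inter> fst c))"
      using f cW eq unfolding sfun_def mopen_def by (fastforce simp: open_sub_def)
    ultimately show ?thesis by simp
  qed
  have "pts (open_sub M W) \<subseteq> pts M"
  proof
    fix x assume "x \<in> pts (open_sub M W)"
    then obtain c where "c \<in> atlas M" "x \<in> fst c" unfolding pts_def open_sub_def by auto
    then show "x \<in> pts M" unfolding pts_def by blast
  qed
  then have "U \<subseteq> pts M" using f unfolding sfun_def mopen_def by blast
  then show ?thesis using * by (auto simp: sfun_def mopen_def)
qed

lemma premfd_open_sub:
  assumes M: "premfd M" and W: "mopen M W"
  shows "premfd (open_sub M W)"
proof -
  have co: "chart_on (model M) c" "inj_on (snd c) (fst c)" if "c \<in> atlas M" for c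
    using mchart_chart_on[OF atlas_mchart[OF M that]] by (auto simp: chart_on_def)
  have op: "openin (top_of_set (model M)) (snd c ` (W \<inter> fst c))" if "c \<in> atlas M" for c
    using W that by (simp add: mopen_def)
  have 1: "chart_on (model M) (fst c \<inter> W, snd c)" if "c \<in> atlas M" for c
    using co[OF that] op[OF that] unfolding chart_on_def by (auto simp: Int_commute intro: inj_on_subset)
  have ci: "cinv (fst c \<inter> W, snd c) y = cinv c y" if "c \<in> atlas M" "y \<in> snd c ` (fst c \<inter> W)" for c y
    using 1[OF that(1)] co(1)[OF that(1)] that(2) cinv_snd[of "model M" "(fst c \<inter> W, snd c)"] by force
  have half: "openin (top_of_set (model M)) (snd c ` (fst c \<inter> W \<inter> (fst d \<inter> W))) \<and>
      smooth_on (snd c ` (fst c \<inter> W \<inter> (fst d \<inter> W))) (snd d \<circ> cinv (fst c \<inter> W, snd c))"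
    if cd: "c \<in> atlas M" "d \<in> atlas M" for c d
  proof -
    have eq: "fst c \<inter> W \<inter> (fst d \<inter> W) = W \<inter> (fst c \<inter> fst d)" by auto
    have "compat (model M) c (model M) d" using M cd by (simp add: premfd_def)
    then have s: "smooth_on (snd c ` (fst c \<inter> fst d)) (snd d \<circ> cinv c)"
      and o: "ropen (model M) (snd c ` (W \<inter> (fst c \<inter> fst d)))"
      using chart_preimage[OF co(1)[OF cd(1)] co(1)[OF cd(2)] _ premfd_subspace[OF M] op[OF cd(2)]] by (auto simp: compat_def)
    have "smooth_on (snd c ` (W \<inter> (fst c \<inter> fst d))) (snd d \<circ> cinv (fst c \<inter> W, snd c))"
      by (rule smooth_on_transfer[OF s]) (use ci[OF cd(1)] in auto)
    then show ?thesis unfolding eq using o by (simp add: ropen_def)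
  qed
  have "compat (model M) (fst c \<inter> W, snd c) (model M) (fst d \<inter> W, snd d)" if "c \<in> atlas M" "d \<in> atlas M" for c d
    using half[OF that] half[OF that(2,1)] unfolding compat_def by (simp add: Int_commute Int_left_commute Int_assoc)
  then show ?thesis using premfd_subspace[OF M] 1 unfolding premfd_def by (auto simp: open_sub_def)
qed

section \<open>Embedded submanifolds\<close>

context
  fixes N :: "('a, 'e::euclidean_space) mfd" and S K
  assumes N: "premfd N" and K: "slice_model N S K"
begin

lemma slice_chartE:
  assumes "c \<in> slice_charts N S K"
  obtains c0 where "mchart N (model N) c0" "c = (fst c0 \<inter> S, snd c0)" "snd c0 ` (fst c0 \<inter> S) = snd c0 ` fst c0 \<inter> K"
proof -
  from assms obtain c0 where "c = (fst c0 \<inter> S, snd c0)" "c0 \<in> charts_in N (model N)" "snd c0 ` (fst c0 \<inter> S) = snd c0 ` fst c0 \<inter> K"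
    unfolding slice_charts_def by blast
  then show thesis using that N premfd_subspace[OF N] by (simp add: mchart_def)
qed

lemma slice_subspace: "subspace K" "K \<subseteq> model N"
  using K by (auto simp: slice_model_def)

text \<open>A slice chart identifies \<open>S\<close> with the part of its image in
  \<open>K\<close>, so an open set of \<open>N\<close> leaves on \<open>S\<close> the intersection
  of \<open>K\<close> with an open set.\<close>

lemma slice_openin:
  assumes c0: "mchart N (model N) c0" "snd c0 ` (fst c0 \<inter> S) = snd c0 ` fst c0 \<inter> K" and U: "mopen N U"
  shows "ropen K (snd c0 ` (U \<inter> S \<inter> fst c0))"
proof -
  have inj: "inj_on (snd c0) (fst c0)" using mchart_chart_on[OF c0(1)] by (simp add: chart_on_def)
  have "snd c0 ` (U \<inter> S \<inter> fst c0) = snd c0 ` (U \<inter> fst c0) \<inter> snd c0 ` (fst c0 \<inter> S)"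
    using inj by (auto simp: inj_on_def)
  also have "\<dots> = K \<inter> snd c0 ` (U \<inter> fst c0)" unfolding c0(2) by auto
  finally have eq: "snd c0 ` (U \<inter> S \<inter> fst c0) = K \<inter> snd c0 ` (U \<inter> fst c0)" .
  have "ropen (model N) (snd c0 ` (U \<inter> fst c0))" by (rule mopen_chart[OF c0(1) U])
  then obtain T where "open T" "snd c0 ` (U \<inter> fst c0) = model N \<inter> T" unfolding ropen_def openin_open by blast
  then show ?thesis unfolding eq ropen_def using slice_subspace by (auto simp: openin_open intro!: exI[of _ T])
qed

lemma slice_cinv:
  assumes c0: "mchart N (model N) c0" and y: "y \<in> snd c0 ` (fst c0 \<inter> S)"
  shows "cinv (fst c0 \<inter> S, snd c0) y = cinv c0 y"
proof -
  have co: "chart_on (model N) c0" by (rule mchart_chart_on[OF c0])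
  have inj: "inj_on (snd c0) (fst c0 \<inter> S)" using co unfolding chart_on_def by (meson inf_le1 inj_on_subset)
  show ?thesis using y co inj by (auto simp: cinv_def[of "(fst c0 \<inter> S, snd c0)"])
qed

abbreviation "sliced \<equiv> \<lparr>model = K, atlas = slice_charts N S K\<rparr>"

lemma premfd_sliced: "premfd sliced"
proof -
  have ch: "chart_on K (fst c0 \<inter> S, snd c0)"
    if "mchart N (model N) c0" "snd c0 ` (fst c0 \<inter> S) = snd c0 ` fst c0 \<inter> K" for c0
    using slice_openin[OF that mopen_pts[OF N]] mchart_chart_on[OF that(1)] mchart_pts[OF that(1)]
    unfolding chart_on_def ropen_def by (auto intro: inj_on_subset simp: Int_absorb1 Int_absorb2 Int_commute Int_left_commute)
  have half: "openin (top_of_set K) (snd c ` (fst c \<inter> S \<inter> (fst d \<inter> S))) \<and>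
      smooth_on (snd c ` (fst c \<inter> S \<inter> (fst d \<inter> S))) (snd d \<circ> cinv (fst c \<inter> S, snd c))"
    if c: "mchart N (model N) c" "snd c ` (fst c \<inter> S) = snd c ` fst c \<inter> K" and d: "mchart N (model N) d" for c d
  proof -
    have eq: "fst c \<inter> S \<inter> (fst d \<inter> S) = fst d \<inter> S \<inter> fst c" by auto
    have "smooth_on (snd c ` (fst d \<inter> S \<inter> fst c)) (snd d \<circ> cinv (fst c \<inter> S, snd c))"
      by (rule smooth_on_transfer[OF mchart_trans_smooth[OF c(1) d]]) (use slice_cinv[OF c(1)] in \<open>auto simp: o_def\<close>)
    then show ?thesis unfolding eq using slice_openin[OF c mopen_dom[OF d]] by (simp add: ropen_def)
  qed
  show ?thesis
    unfolding premfd_def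
  proof (intro conjI ballI)
    fix c assume "c \<in> atlas sliced"
    then obtain c0 where c: "mchart N (model N) c0" "c = (fst c0 \<inter> S, snd c0)" "snd c0 ` (fst c0 \<inter> S) = snd c0 ` fst c0 \<inter> K"
      by (auto elim: slice_chartE)
    then show "chart_on (model sliced) c" using ch by simp
    fix d assume "d \<in> atlas sliced"
    then obtain d0 where d: "mchart N (model N) d0" "d = (fst d0 \<inter> S, snd d0)" "snd d0 ` (fst d0 \<inter> S) = snd d0 ` fst d0 \<inter> K"
      by (auto elim: slice_chartE)
    show "compat (model sliced) c (model sliced) d"
      using half[OF c(1,3) d(1)] half[OF d(1,3) c(1)] unfolding compat_def c(2) d(2)
      by (simp add: Int_commute Int_left_commute Int_assoc)
  qed (simp add: slice_subspace)
qed

lemma pts_sliced: "pts sliced = S"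
proof
  show "pts sliced \<subseteq> S" by (auto simp: pts_def slice_charts_def)
  show "S \<subseteq> pts sliced" using K by (auto simp: pts_def slice_model_def)
qed

text \<open>Charts of the submanifold are restrictions of charts of \<open>N\<close>, so the
  coordinates of a map with values in \<open>S\<close> are the same functions as before. Together
  with \<open>smooth_map_from_sliced\<close> this gives access to the submanifold for whatever slice
  space \<open>K\<close> has been chosen.\<close>

lemma smooth_map_sliced:
  assumes M: "premfd M" and f: "smooth_map M N f" "f ` pts M \<subseteq> S"
  shows "smooth_map M sliced f"
  unfolding smooth_map_iff[OF M]
proof (intro conjI ballI)
  show "f ` pts M \<subseteq> pts sliced" using f(2) pts_sliced by simp
  fix c assume "c \<in> atlas sliced"
  then obtain c0 where c: "mchart N (model N) c0" "c = (fst c0 \<inter> S, snd c0)"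
    by (auto elim: slice_chartE)
  have "pts M \<inter> f -` fst c = pts M \<inter> f -` fst c0" using f(2) c(2) by auto
  then show "sfun M (pts M \<inter> f -` fst c) (\<lambda>x. snd c (f x))"
    using smooth_map_sfun[OF M N f(1) sfun_dom[OF c(1)]] c(2) by simp
qed

lemma smooth_map_from_sliced:
  assumes f: "smooth_map N Q f"
  shows "smooth_map sliced Q f"
  unfolding smooth_map_iff[OF premfd_sliced]
proof (intro conjI ballI)
  have SN: "S \<subseteq> pts N"
  proof
    fix x assume "x \<in> S"
    then obtain c where "c \<in> slice_charts N S K" "x \<in> fst c" using K by (auto simp: slice_model_def)
    then obtain c0 where "mchart N (model N) c0" "c = (fst c0 \<inter> S, snd c0)" by (auto elim: slice_chartE)
    then show "x \<in> pts N" using mchart_pts \<open>x \<in> fst c\<close> by fastforce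
  qed
  then show "f ` pts sliced \<subseteq> pts Q" using smooth_map_pts[OF f] pts_sliced by auto
  fix e assume e: "e \<in> atlas Q"
  have sf: "sfun N (pts N \<inter> f -` fst e) (\<lambda>x. snd e (f x))" using f e unfolding smooth_map_iff[OF N] by auto
  show "sfun sliced (pts sliced \<inter> f -` fst e) (\<lambda>x. snd e (f x))"
    unfolding sfun_def mopen_def
  proof (intro conjI ballI)
    fix c assume "c \<in> atlas sliced"
    then obtain c0 where c: "mchart N (model N) c0" "c = (fst c0 \<inter> S, snd c0)" "snd c0 ` (fst c0 \<inter> S) = snd c0 ` fst c0 \<inter> K"
      by (auto elim: slice_chartE)
    have eq: "pts sliced \<inter> f -` fst e \<inter> fst c = (pts N \<inter> f -` fst e) \<inter> S \<inter> fst c0"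
      using pts_sliced SN c(2) by auto
    show "openin (top_of_set (model sliced)) (snd c ` (pts sliced \<inter> f -` fst e \<inter> fst c))"
      unfolding eq using slice_openin[OF c(1,3) sfun_mopen[OF sf]] c(2) by (simp add: ropen_def)
    show "smooth_on (snd c ` (pts sliced \<inter> f -` fst e \<inter> fst c)) (\<lambda>y. snd e (f (cinv c y)))"
      unfolding eq by (rule smooth_on_transfer[OF sfun_chart[OF c(1) sf]]) (use slice_cinv[OF c(1)] c(2) in auto)
  qed auto
qed

end

section \<open>Product rules, and smoothness of the exterior derivative\<close>

lemma tder_linear:
  assumes "premfd M" "sfun M U f" "x \<in> U" "v \<in> model M" "bounded_linear L"
  shows "tder M (\<lambda>x. L (f x)) x v = L (tder M f x v)"
proof -
  have x: "x \<in> pts M" by (rule sfun_pts[OF assms(2,3)])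
  note c = chart_at_mchart[OF assms(1) x]
  show ?thesis
    unfolding tder_eq
    by (rule dderiv_linear[OF mopen_chart[OF c sfun_mopen[OF assms(2)]] sfun_chart[OF c assms(2)] _ assms(4,5)])
       (use assms(3) chart_at(2)[OF x] in auto)
qed

lemma tder_bilinear:
  assumes "premfd M" "sfun M U f" "sfun M U g" "x \<in> U" "v \<in> model M" "bounded_bilinear b"
  shows "tder M (\<lambda>x. b (f x) (g x)) x v = b (f x) (tder M g x v) + b (tder M f x v) (g x)"
proof -
  have x: "x \<in> pts M" by (rule sfun_pts[OF assms(2,4)])
  note c = chart_at_mchart[OF assms(1) x]
  show ?thesis
    unfolding tder_eq
    using dderiv_bilinear[OF mopen_chart[OF c sfun_mopen[OF assms(2)]] sfun_chart[OF c assms(2)] sfun_chart[OF c assms(3)] _ assms(5,6), of "snd (chart_at M x) x"]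
      assms(4) chart_at(2)[OF x] cinv_snd[OF mchart_chart_on[OF c]] by auto
qed

lemma sfun_bilinear:
  assumes "premfd M" "sfun M U f" "sfun M U g" "bounded_bilinear b"
  shows "sfun M U (\<lambda>x. b (f x) (g x))"
  using assms unfolding sfun_def by (auto intro: smooth_on_bilinear)

lemma sfun_linear:
  assumes "sfun M U f" "bounded_linear L"
  shows "sfun M U (\<lambda>x. L (f x))"
  using assms unfolding sfun_def by (auto intro: smooth_on_linear)

lemma tder_const: "tder M (\<lambda>x. k) x v = 0"
  by (simp add: tder_eq)

lemma tder_Pair:
  assumes "premfd M" "sfun M U f" "sfun M U g" "x \<in> U" "v \<in> model M"
  shows "tder M (\<lambda>x. (f x, g x)) x v = (tder M f x v, tder M g x v)"
proof -
  have x: "x \<in> pts M" by (rule sfun_pts[OF assms(2,4)])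
  note c = chart_at_mchart[OF assms(1) x]
  show ?thesis
    unfolding tder_eq
    by (rule dderiv_Pair[OF mopen_chart[OF c sfun_mopen[OF assms(2)]] sfun_chart[OF c assms(2)] sfun_chart[OF c assms(3)] _ assms(5)])
      (use assms(4) chart_at(2)[OF x] in auto)
qed

lemma bounded_bilinear_matrix_mult: "bounded_bilinear ((**) :: real^'n^'n \<Rightarrow> real^'n^'n \<Rightarrow> real^'n^'n)"
  unfolding bilinear_conv_bounded_bilinear[symmetric] bilinear_def
  by (auto intro!: linearI simp: matrix_add_ldistrib matrix_scalar_ac scalar_matrix_assoc matrix_matrix_mult_def vec_eq_iff
      distrib_right distrib_left sum.distrib sum_distrib_left ac_simps)

lemma bounded_bilinear_matrix_vector: "bounded_bilinear ((*v) :: real^'n^'n \<Rightarrow> real^'n \<Rightarrow> real^'n)"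
  unfolding bilinear_conv_bounded_bilinear[symmetric] bilinear_def
  by (auto intro!: linearI simp: matrix_vector_mult_def vec_eq_iff
      distrib_right distrib_left sum.distrib sum_distrib_left ac_simps)

lemma smooth_on_vec:
  fixes f :: "'i::finite \<Rightarrow> 'a::euclidean_space \<Rightarrow> 'w::euclidean_space"
  assumes "\<And>i. smooth_on S (f i)"
  shows "smooth_on S (\<lambda>y. \<chi> i. f i y)"
proof -
  have bl: "bounded_linear (\<lambda>w::'w. \<chi> j. if j = i then w else 0)" for i :: 'i
    by (intro linear_conv_bounded_linear[THEN iffD1] linearI) (auto simp: vec_eq_iff)
  have "smooth_on S (\<lambda>y. \<Sum>i\<in>UNIV. \<chi> j. if j = i then f i y else 0)"
    by (intro smooth_on_sum smooth_on_linear[OF assms bl]) auto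
  then show ?thesis
    by (rule smooth_on_cong) (auto simp: vec_eq_iff)
qed

lemma smooth_on_vec_nth: "smooth_on S f \<Longrightarrow> smooth_on S (\<lambda>y. f y $ i)"
  by (rule smooth_on_linear[OF _ bounded_linear_vec_nth])

text \<open>The vectors are frozen while the form is differentiated. Each term is thus a derivative
  of the two-variable map in a direction tangent to the first factor, and such derivatives are
  smooth jointly in point and direction. This is what makes the torsion of a smooth horizontal lift
  smooth.\<close>

lemma dform_smooth:
  assumes S: "ropen E S" and a: "lform S E a" and f: "smooth_on S f" "f ` S \<subseteq> E" and g: "smooth_on S g" "g ` S \<subseteq> E"
  shows "smooth_on S (\<lambda>y. dform a y (f y) (g y))"
proof -
  have E: "subspace E" using S by (simp add: ropen_def)
  have SE: "ropen (E \<times> E) (S \<times> E)" by (rule ropen_Times[OF S ropen_self[OF E]])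
  have sm: "smooth_on (S \<times> E) (\<lambda>p. a (fst p) (snd p))" using a by (simp add: lform_def)
  have *: "smooth_on S (\<lambda>y. dderiv (\<lambda>x. a x (g y)) y (f y))"
    if f: "smooth_on S f" "f ` S \<subseteq> E" and g: "smooth_on S g" "g ` S \<subseteq> E" for f g
  proof -
    have "smooth_on S (\<lambda>y. dderiv (\<lambda>p. a (fst p) (snd p)) (y, g y) (f y, 0))"
      by (rule smooth_on_dderiv'[OF SE sm smooth_on_Pair[OF smooth_on_ident g(1)] smooth_on_Pair[OF f(1) smooth_on_const]])
         (use f g subspace_0[OF E] in auto)
    then show ?thesis
      by (rule smooth_on_cong) (use dderiv_fst_slice[of "\<lambda>p. a (fst p) (snd p)"] in simp)
  qed
  show ?thesis unfolding dform_def by (intro smooth_on_diff * f g)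
qed

lemma ext_deriv_linear:
  assumes "premfd M" "one_form M \<alpha>" "x \<in> pts M" "v \<in> model M" "w \<in> model M" "bounded_linear L"
  shows "ext_deriv M (\<lambda>x v. L (\<alpha> x v)) x v w = L (ext_deriv M \<alpha> x v w)"
proof -
  note c = chart_at_mchart[OF assms(1,3)]
  have xS: "snd (chart_at M x) x \<in> snd (chart_at M x) ` fst (chart_at M x)" using chart_at(2)[OF assms(3)] by auto
  have sm: "smooth_on (snd (chart_at M x) ` fst (chart_at M x)) (\<lambda>y. frep M (chart_at M x) \<alpha> y z)" if "z \<in> model M" for z
    by (rule lform_smooth[OF one_form_lform[OF assms(2) c] smooth_on_ident smooth_on_const]) (use that in auto)
  have "frep M (chart_at M x) (\<lambda>x v. L (\<alpha> x v)) = (\<lambda>y z. L (frep M (chart_at M x) \<alpha> y z))"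
    by (intro ext) (simp add: frep_def)
  then show ?thesis
    unfolding ext_deriv_chart_at dform_def
    using dderiv_linear[OF mchart_ropen[OF c] sm[OF assms(5)] xS assms(4,6)] dderiv_linear[OF mchart_ropen[OF c] sm[OF assms(4)] xS assms(5,6)]
    by (simp add: linear_diff[OF bounded_linear.linear[OF assms(6)]])
qed

section \<open>Linear Lie groups\<close>

locale lin_group =
  fixes G :: "(real^'n^'n, 'k::euclidean_space) mfd"
  assumes lin_group: "linear_lie_group G"
begin

text \<open>The differential at the identity of the inclusion of \<open>G\<close> into the matrices.
  It identifies the abstract tangent space \<open>model G\<close> with the Lie algebra of
  matrices.\<close>

abbreviation "\<iota> \<equiv> tder G (\<lambda>A. A) (mat 1)"

lemma premfd_G: "premfd G"
  by (rule smooth_manifold_premfd) (use lin_group in \<open>simp add: linear_lie_group_def\<close>)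

lemma one_G: "mat 1 \<in> pts G" and mult_G: "A \<in> pts G \<Longrightarrow> B \<in> pts G \<Longrightarrow> A ** B \<in> pts G"
  and inv_G: "A \<in> pts G \<Longrightarrow> matrix_inv A \<in> pts G" and inverse_smooth: "smooth_map G G matrix_inv"
  using lin_group by (auto simp: linear_lie_group_def)

lemma invertible_G: "A \<in> pts G \<Longrightarrow> invertible A"
  using lin_group by (auto simp: linear_lie_group_def)

lemma inv_mult [simp]: "A \<in> pts G \<Longrightarrow> A ** matrix_inv A = mat 1" "A \<in> pts G \<Longrightarrow> matrix_inv A ** A = mat 1"
  using someI_ex[OF invertible_G[unfolded invertible_def]] unfolding matrix_inv_def by auto

lemma inv_unique: "A \<in> pts G \<Longrightarrow> A ** B = mat 1 \<Longrightarrow> matrix_inv A = B"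
  using inv_mult(2)[of A] matrix_mul_assoc[of "matrix_inv A" A B] by simp

lemma inv_inv [simp]: "A \<in> pts G \<Longrightarrow> matrix_inv (matrix_inv A) = A"
  by (rule inv_unique[OF inv_G]) auto

lemma inv_one [simp]: "matrix_inv (mat 1 :: real^'n^'n) = mat 1"
  by (rule inv_unique[OF one_G]) simp

lemma inv_vec [simp]: "A \<in> pts G \<Longrightarrow> A *v (matrix_inv A *v v) = v" "A \<in> pts G \<Longrightarrow> matrix_inv A *v (A *v v) = v"
  by (simp_all add: matrix_vector_mul_assoc)

lemma mult_smooth:
  assumes "premfd M" "smooth_map M G f" "smooth_map M G g"
  shows "smooth_map M G (\<lambda>x. f x ** g x)"
  using smooth_map_compose[OF assms(1) premfd_prod[OF premfd_G premfd_G] smooth_map_Pair[OF assms(1-3)], of G "\<lambda>(A, B). A ** B"] lin_group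
  by (simp add: linear_lie_group_def)

lemma left_mult_smooth: "A \<in> pts G \<Longrightarrow> smooth_map G G (\<lambda>B. A ** B)"
  by (rule mult_smooth[OF premfd_G smooth_map_const[OF premfd_G] smooth_map_ident[OF premfd_G]])

lemma conj_smooth: "A \<in> pts G \<Longrightarrow> smooth_map G G (\<lambda>B. matrix_inv A ** B ** A)"
  by (intro mult_smooth[OF premfd_G] smooth_map_const[OF premfd_G] smooth_map_ident[OF premfd_G] inv_G)

lemma incl_sfun: "sfun G (pts G) (\<lambda>A. A)"
proof -
  have "pts G \<inter> fst c = fst c" if "c \<in> atlas G" for c using that by (auto simp: pts_def)
  then show ?thesis
    using lin_group mopen_pts[OF premfd_G] by (simp add: linear_lie_group_def smooth_fun_def sfun_def o_def)
qed

lemma map_sfun: "smooth_map G G f \<Longrightarrow> sfun G (pts G) f"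
proof -
  assume f: "smooth_map G G f"
  have "pts G \<inter> f -` pts G = pts G" using smooth_map_pts[OF f] by auto
  then show ?thesis using smooth_map_sfun[OF premfd_G premfd_G f incl_sfun] by simp
qed

text \<open>\<open>tmap\<close> yields abstract tangent vectors of \<open>G\<close>, while
  derivatives are computed with matrices; this passes from the first to the second.\<close>

lemma tder_map: "smooth_map G G f \<Longrightarrow> f (mat 1) = mat 1 \<Longrightarrow> k \<in> model G \<Longrightarrow> \<iota> (tmap G G f (mat 1) k) = tder G f (mat 1) k"
  using tder_tmap[OF premfd_G premfd_G _ incl_sfun one_G, of f k] one_G by simp

lemma iota_lin: "lin_on (model G) \<iota>"
  by (rule tder_lin[OF premfd_G incl_sfun one_G])

lemma iota_bij: "bij_betw \<iota> (model G) (lie_alg G)"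
  using lin_group one_G by (auto simp: bij_betw_def lie_alg_def linear_lie_group_def)

lemma iota_mem: "k \<in> model G \<Longrightarrow> \<iota> k \<in> lie_alg G"
  by (simp add: lie_alg_def)

abbreviation "inv_iota \<equiv> the_inv_into (model G) \<iota>"

lemma inv_iota_lin: "lin_on (lie_alg G) inv_iota"
  by (rule lin_on_the_inv_into[OF premfd_subspace[OF premfd_G] iota_lin iota_bij])

lemma inv_iota_mem: "X \<in> lie_alg G \<Longrightarrow> inv_iota X \<in> model G"
  using iota_bij the_inv_into_into[of \<iota> "model G" X "model G"] by (auto simp: bij_betw_def)

lemma iota_inv [simp]: "X \<in> lie_alg G \<Longrightarrow> \<iota> (inv_iota X) = X"
  using iota_bij f_the_inv_into_f[of \<iota> "model G" X] by (auto simp: bij_betw_def)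

lemma inv_iota [simp]: "k \<in> model G \<Longrightarrow> inv_iota (\<iota> k) = k"
  using iota_bij the_inv_into_f_f[of \<iota> "model G" k] by (auto simp: bij_betw_def)

lemma subspace_lie_alg: "subspace (lie_alg G)"
proof -
  have "r *\<^sub>R \<iota> k + s *\<^sub>R \<iota> l \<in> lie_alg G" if "k \<in> model G" "l \<in> model G" for r s k l
    using lin_onD[OF iota_lin that, of r s, symmetric] that premfd_subspace[OF premfd_G]
    by (simp add: iota_mem subspace_add subspace_scale)
  from this[of _ _ 1 1] this[of _ _ _ 0] show ?thesis
    using lin_on_0[OF iota_lin premfd_subspace[OF premfd_G]] iota_mem[OF subspace_0[OF premfd_subspace[OF premfd_G]]]
    unfolding subspace_def by (auto simp: lie_alg_def)
qed

text \<open>Conjugation is the restriction of a linear map on matrices, which is its own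
  derivative.\<close>

lemma tder_conj:
  assumes "A \<in> pts G" "k \<in> model G"
  shows "\<iota> (tmap G G (\<lambda>B. matrix_inv A ** B ** A) (mat 1) k) = matrix_inv A ** \<iota> k ** A"
proof -
  have "bounded_linear (\<lambda>B. matrix_inv A ** B ** A)"
    using bounded_linear_compose[OF bounded_bilinear.bounded_linear_left[OF bounded_bilinear_matrix_mult] bounded_bilinear.bounded_linear_right[OF bounded_bilinear_matrix_mult]]
    by blast
  then show ?thesis
    using tder_map[OF conj_smooth[OF assms(1)] _ assms(2)] tder_linear[OF premfd_G incl_sfun one_G assms(2)] assms(1) by simp
qed

lemma Ad_mem: "A \<in> pts G \<Longrightarrow> X \<in> lie_alg G \<Longrightarrow> matrix_inv A ** X ** A \<in> lie_alg G"
  using tder_conj[of A "inv_iota X"] inv_iota_mem[of X] iota_mem[OF tmap_mem[OF premfd_G premfd_G conj_smooth one_G]] by fastforce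

lemma inv_iota_Ad:
  assumes "A \<in> pts G" "X \<in> lie_alg G"
  shows "inv_iota (matrix_inv A ** X ** A) = tmap G G (\<lambda>B. matrix_inv A ** B ** A) (mat 1) (inv_iota X)"
  using tder_conj[OF assms(1) inv_iota_mem[OF assms(2)]] inv_iota[OF tmap_mem[OF premfd_G premfd_G conj_smooth[OF assms(1)] one_G inv_iota_mem[OF assms(2)]]] assms(2)
  by simp

lemma inv_sfun: "sfun G (pts G) matrix_inv"
  by (rule map_sfun[OF inverse_smooth])

text \<open>Differentiate the constant product of \<open>A\<close> and its inverse at the
  identity.\<close>

lemma tder_inv:
  assumes k: "k \<in> model G"
  shows "tder G matrix_inv (mat 1) k = - \<iota> k"
proof -
  have "tder G (\<lambda>A. A ** matrix_inv A) (mat 1) k = mat 1 ** tder G matrix_inv (mat 1) k + \<iota> k ** matrix_inv (mat 1)"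
    by (rule tder_bilinear[OF premfd_G incl_sfun inv_sfun one_G k bounded_bilinear_matrix_mult])
  moreover have "tder G (\<lambda>A. A ** matrix_inv A) (mat 1) k = 0"
    using tder_cong[OF premfd_G sfun_const[OF mopen_pts[OF premfd_G]] one_G k, of "mat 1" "\<lambda>A. A ** matrix_inv A"]
    by (simp add: tder_const)
  ultimately show ?thesis by (simp add: eq_neg_iff_add_eq_0)
qed

text \<open>With \<open>Y = \<iota> k\<close> the derivative is \<open>-[Y, X]\<close>: the action
  is by inverses, and the sign comes from \<open>tder_inv\<close>.\<close>

lemma tder_inv_conj:
  assumes k: "k \<in> model G"
  shows "sfun G (pts G) (\<lambda>A. matrix_inv A ** X ** A)"
    "tder G (\<lambda>A. matrix_inv A ** X ** A) (mat 1) k = X ** \<iota> k - \<iota> k ** X"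
proof -
  have bl: "bounded_linear (\<lambda>A::real^'n^'n. A ** X)"
    by (rule bounded_bilinear.bounded_linear_left[OF bounded_bilinear_matrix_mult])
  note s = sfun_linear[OF inv_sfun bl]
  show "sfun G (pts G) (\<lambda>A. matrix_inv A ** X ** A)"
    by (rule sfun_bilinear[OF premfd_G s incl_sfun bounded_bilinear_matrix_mult])
  have neg: "(- A) ** X = - (A ** X)" for A :: "real^'n^'n"
    using linear_neg[OF bounded_linear.linear[OF bl]] by simp
  show "tder G (\<lambda>A. matrix_inv A ** X ** A) (mat 1) k = X ** \<iota> k - \<iota> k ** X"
    using tder_bilinear[OF premfd_G s incl_sfun one_G k bounded_bilinear_matrix_mult] tder_linear[OF premfd_G inv_sfun one_G k bl] tder_inv[OF k]
    by (simp add: neg)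
qed

lemma tder_inv_vec:
  assumes k: "k \<in> model G"
  shows "sfun G (pts G) (\<lambda>A. matrix_inv A *v v)" "tder G (\<lambda>A. matrix_inv A *v v) (mat 1) k = - (\<iota> k *v v)"
proof -
  have bl: "bounded_linear (\<lambda>A::real^'n^'n. A *v v)"
    by (rule bounded_bilinear.bounded_linear_left[OF bounded_bilinear_matrix_vector])
  show "sfun G (pts G) (\<lambda>A. matrix_inv A *v v)" by (rule sfun_linear[OF inv_sfun bl])
  show "tder G (\<lambda>A. matrix_inv A *v v) (mat 1) k = - (\<iota> k *v v)"
    using tder_linear[OF premfd_G inv_sfun one_G k bl] tder_inv[OF k] linear_neg[OF bounded_linear.linear[OF bl]] by simp
qed

text \<open>The map \<open>A \<mapsto> A^-1 X A\<close> has values in the Lie algebra, which is a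
  subspace; hence so has its derivative at the identity, and this is the bracket.\<close>

lemma lie_alg_bracket:
  assumes "X \<in> lie_alg G" "Y \<in> lie_alg G"
  shows "X ** Y - Y ** X \<in> lie_alg G"
proof -
  have "tder G (\<lambda>A. matrix_inv A ** X ** A) (mat 1) (inv_iota Y) \<in> lie_alg G"
    by (rule tder_mem[OF premfd_G tder_inv_conj(1)[OF inv_iota_mem[OF assms(2)]] one_G inv_iota_mem[OF assms(2)] subspace_lie_alg])
       (use Ad_mem assms(1) in auto)
  then show ?thesis using tder_inv_conj(2)[OF inv_iota_mem[OF assms(2)]] assms(2) by simp
qed

lemma left_translation_bij:
  assumes A: "A \<in> pts G"
  shows "bij_betw (tmap G G (\<lambda>B. A ** B) (mat 1)) (model G) (model G)"
proof -
  have *: "tmap G G (\<lambda>B. C ** B) (A ** B) (tmap G G (\<lambda>B. A ** B) B k) = k"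
    if "k \<in> model G" "A \<in> pts G" "C \<in> pts G" "C ** A = mat 1" "B \<in> pts G" for A B C k
  proof -
    have "tmap G G (\<lambda>B. C ** B) (A ** B) (tmap G G (\<lambda>B. A ** B) B k) = tmap G G (\<lambda>B. C ** (A ** B)) B k"
      by (rule tmap_compose[OF premfd_G premfd_G premfd_G left_mult_smooth left_mult_smooth]) (use that in auto)
    also have "(\<lambda>B. C ** (A ** B)) = (\<lambda>B. B)" using that(4) by (simp add: matrix_mul_assoc)
    finally show ?thesis using tmap_ident[OF premfd_G that(5,1)] by simp
  qed
  show ?thesis
    using *[OF _ A inv_G[OF A] _ one_G] *[OF _ inv_G[OF A] A _ A] tmap_mem[OF premfd_G premfd_G left_mult_smooth[OF A] one_G]
      tmap_mem[OF premfd_G premfd_G left_mult_smooth[OF inv_G[OF A]] A] A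
    by (intro bij_betw_byWitness[where f'="tmap G G (\<lambda>B. matrix_inv A ** B) A"]) auto
qed

end

section \<open>Principal bundles\<close>

locale principal = lin_group G for G :: "(real^'n^'n, 'k::euclidean_space) mfd" +
  fixes P :: "('p, 'e::euclidean_space) mfd" and M :: "('m, real^'n) mfd" and p :: "'p \<Rightarrow> 'm"
    and act :: "'p \<Rightarrow> real^'n^'n \<Rightarrow> 'p"
  assumes principal: "principal_bundle P p M G act" and model_M: "model M = UNIV"
begin

lemma premfd_P: "premfd P" and premfd_M: "premfd M" and smooth_p: "smooth_map P M p"
  and act_smooth: "smooth_map (prod_mfd P G) P (\<lambda>(u, g). act u g)"
  and act_one: "u \<in> pts P \<Longrightarrow> act u (mat 1) = u"
  and act_act: "u \<in> pts P \<Longrightarrow> g \<in> pts G \<Longrightarrow> h \<in> pts G \<Longrightarrow> act (act u g) h = act u (g ** h)"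
  and p_act: "u \<in> pts P \<Longrightarrow> g \<in> pts G \<Longrightarrow> p (act u g) = p u"
  using principal smooth_manifold_premfd[of P] smooth_manifold_premfd[of M] by (auto simp: principal_bundle_def)

lemma act_mem: "u \<in> pts P \<Longrightarrow> g \<in> pts G \<Longrightarrow> act u g \<in> pts P"
  using smooth_map_pts[OF act_smooth, of "(u, g)"] by simp

lemma act_map_smooth:
  assumes "premfd N" "smooth_map N P f" "smooth_map N G g"
  shows "smooth_map N P (\<lambda>x. act (f x) (g x))"
  using smooth_map_compose[OF assms(1) premfd_prod[OF premfd_P premfd_G] smooth_map_Pair[OF assms] act_smooth] by simp

lemma right_smooth: "g \<in> pts G \<Longrightarrow> smooth_map P P (\<lambda>u. act u g)"
  by (rule act_map_smooth[OF premfd_P smooth_map_ident[OF premfd_P] smooth_map_const[OF premfd_P]])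

lemma orbit_smooth: "u \<in> pts P \<Longrightarrow> smooth_map G P (act u)"
  using act_map_smooth[OF premfd_G smooth_map_const[OF premfd_G] smooth_map_ident[OF premfd_G], of u] by simp

text \<open>A local trivialization followed by a product of charts of \<open>M\<close> and
  \<open>G\<close> is a chart of the maximal atlas of \<open>P\<close>. The last conclusion retains
  equivariance: such a chart sees the action as right multiplication on the group component, as long
  as the product stays in the domain of \<open>k\<close>.\<close>

lemma trivialization:
  assumes u0: "u0 \<in> pts P"
  obtains c b k \<psi> where "mchart P (UNIV \<times> model G) c" "u0 \<in> fst c" "b \<in> atlas M" "k \<in> atlas G"
    "\<And>u. u \<in> fst c \<Longrightarrow> p u \<in> fst b \<and> \<psi> u \<in> fst k \<and> snd c u = (snd b (p u), snd k (\<psi> u))"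
    "\<And>u g. u \<in> fst c \<Longrightarrow> g \<in> pts G \<Longrightarrow> \<psi> u ** g \<in> fst k \<Longrightarrow> act u g \<in> fst c \<and> \<psi> (act u g) = \<psi> u ** g"
proof -
  have pu: "p u0 \<in> pts M" by (rule smooth_map_pts[OF smooth_p u0])
  then obtain U \<psi> where U: "openin (mtop M) U" "p u0 \<in> U"
    and D: "diffeo (open_sub P (pts P \<inter> p -` U)) (prod_mfd (open_sub M U) G) (\<lambda>u. (p u, \<psi> u))"
    and eq: "\<forall>u\<in>pts P \<inter> p -` U. \<forall>g\<in>pts G. \<psi> (act u g) = \<psi> u ** g"
    using principal unfolding principal_bundle_def by blast
  let ?W = "pts P \<inter> p -` U" and ?\<Psi> = "\<lambda>u. (p u, \<psi> u)"
  let ?Pw = "open_sub P ?W" and ?Q = "prod_mfd (open_sub M U) G"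
  have Um: "mopen M U" by (rule mopen_mtop[OF premfd_M U(1)])
  have Wm: "mopen P ?W" by (rule sfun_mopen[OF smooth_map_sfun[OF premfd_P premfd_M smooth_p sfun_const[OF Um]]])
  have ptW: "pts ?Pw = ?W" by (rule open_sub_pts) auto
  have ptU: "pts (open_sub M U) = U" by (rule open_sub_pts) (use Um in \<open>simp add: mopen_def\<close>)
  have Pw: "premfd ?Pw" by (rule premfd_open_sub[OF premfd_P Wm])
  have Mu: "premfd (open_sub M U)" by (rule premfd_open_sub[OF premfd_M Um])
  have Q: "premfd ?Q" by (rule premfd_prod[OF Mu premfd_G])
  have mQ: "model ?Q = UNIV \<times> model G" using model_M by (simp add: open_sub_def)
  have bij: "bij_betw ?\<Psi> ?W (U \<times> pts G)" and sm: "smooth_map ?Pw ?Q ?\<Psi>"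
    and smi: "smooth_map ?Q ?Pw (the_inv_into ?W ?\<Psi>)"
    using D ptW ptU by (auto simp: diffeo_def)
  let ?\<Phi> = "the_inv_into ?W ?\<Psi>"
  have inj: "inj_on ?\<Psi> ?W" and im: "?\<Psi> ` ?W = U \<times> pts G" using bij by (auto simp: bij_betw_def)
  have \<Phi>: "?\<Phi> (p u, \<psi> u) = u" if "u \<in> ?W" for u using the_inv_into_f_f[OF inj that] .
  obtain b where b: "b \<in> atlas M" "p u0 \<in> fst b" using pu by (auto simp: pts_def)
  have "\<psi> u0 \<in> pts G" using im U(2) u0 by blast
  then obtain k where k: "k \<in> atlas G" "\<psi> u0 \<in> fst k" by (auto simp: pts_def)
  define q where "q = pchart (fst b \<inter> U, snd b) k"
  have q: "q \<in> atlas ?Q" unfolding q_def atlas_prod using open_sub_atlas[OF b(1)] k(1) by blast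
  have qm: "mchart ?Q (UNIV \<times> model G) q" using atlas_mchart[OF Q q] mQ by simp
  note qco = mchart_chart_on[OF qm]
  have qpts: "fst q \<subseteq> U \<times> pts G" using mchart_pts[OF qm] ptU by simp
  define W' where "W' = ?W \<inter> ?\<Psi> -` fst q"
  define c where "c = (W', \<lambda>u. (snd b (p u), snd k (\<psi> u)))"
  have sc: "snd c u = snd q (p u, \<psi> u)" for u by (simp add: c_def q_def)
  have fc: "fst c = W'" by (simp add: c_def)
  have s: "sfun P W' (snd c)"
  proof -
    have "sfun ?Pw W' (\<lambda>u. snd q (p u, \<psi> u))"
      using smooth_map_sfun[OF Pw Q sm sfun_dom[OF qm]] ptW by (simp add: W'_def)
    moreover have "W' \<subseteq> ?W" unfolding W'_def by (rule Int_lower1)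
    ultimately have "sfun P W' (\<lambda>u. snd q (p u, \<psi> u))" by (rule sfun_open_sub[OF premfd_P])
    then show ?thesis by (rule sfun_cong[OF premfd_P]) (simp add: sc)
  qed
  have im': "?\<Psi> ` W' = fst q"
  proof -
    have "?\<Psi> ` W' = ?\<Psi> ` ?W \<inter> fst q" unfolding W'_def by (rule set_eqI) (simp add: image_iff, blast)
    then show ?thesis unfolding im using qpts by (simp add: Int_absorb1)
  qed
  have cq: "snd c ` W' = snd q ` fst q"
    unfolding im'[symmetric] image_image using sc by simp
  have injc: "inj_on (snd c) W'"
  proof (rule inj_onI)
    fix u v assume uv: "u \<in> W'" "v \<in> W'" "snd c u = snd c v"
    then have "?\<Psi> u = ?\<Psi> v" using qco unfolding sc chart_on_def inj_on_def W'_def by auto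
    then show "u = v" using inj uv unfolding W'_def inj_on_def by auto
  qed
  have cco: "chart_on (UNIV \<times> model G) c"
    using injc cq qco by (simp add: chart_on_def fc)
  have cinvc: "cinv c y = ?\<Phi> (cinv q y)" if "y \<in> snd c ` W'" for y
  proof -
    obtain u where u: "u \<in> W'" "y = snd c u" using \<open>y \<in> snd c ` W'\<close> by auto
    then have "cinv q y = (p u, \<psi> u)" using cinv_snd[OF qco] by (simp add: sc W'_def)
    moreover have "cinv c y = u" using cinv_snd[OF cco] u by (simp add: fc)
    ultimately show ?thesis using \<Phi>[of u] u(1) by (simp add: W'_def)
  qed
  have "compat (UNIV \<times> model G) c (model P) d" if d: "d \<in> atlas P" for d
    unfolding compat_def
  proof (intro conjI)
    have d': "(fst d \<inter> ?W, snd d) \<in> atlas ?Pw" by (rule open_sub_atlas[OF d])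
    have sd: "openin (top_of_set (UNIV \<times> model G)) (snd q ` (fst q \<inter> ?\<Phi> -` (fst d \<inter> ?W)))"
      "smooth_on (snd q ` (fst q \<inter> ?\<Phi> -` (fst d \<inter> ?W))) (snd d \<circ> ?\<Phi> \<circ> cinv q)"
      using smi q d' mQ unfolding smooth_map_def by fastforce+
    have seq: "snd c ` (fst c \<inter> fst d) = snd q ` (fst q \<inter> ?\<Phi> -` (fst d \<inter> ?W))"
    proof -
      have "fst q \<inter> ?\<Phi> -` (fst d \<inter> ?W) = ?\<Psi> ` (W' \<inter> fst d)"
      proof
        show "fst q \<inter> ?\<Phi> -` (fst d \<inter> ?W) \<subseteq> ?\<Psi> ` (W' \<inter> fst d)"
        proof
          fix r assume r: "r \<in> fst q \<inter> ?\<Phi> -` (fst d \<inter> ?W)"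
          then obtain u where "u \<in> W'" "r = ?\<Psi> u" using im' by blast
          then show "r \<in> ?\<Psi> ` (W' \<inter> fst d)" using r \<Phi>[of u] by (auto simp: W'_def)
        qed
        show "?\<Psi> ` (W' \<inter> fst d) \<subseteq> fst q \<inter> ?\<Phi> -` (fst d \<inter> ?W)" using \<Phi> by (auto simp: W'_def)
      qed
      then show ?thesis unfolding fc using sc by (auto simp: image_image)
    qed
    show "openin (top_of_set (UNIV \<times> model G)) (snd c ` (fst c \<inter> fst d))" unfolding seq by (rule sd(1))
    show "openin (top_of_set (model P)) (snd d ` (fst c \<inter> fst d))"
      using sfun_mopen[OF s] d by (simp add: mopen_def fc)
    show "smooth_on (snd c ` (fst c \<inter> fst d)) (snd d \<circ> cinv c)"
    proof (rule smooth_on_cong[OF sd(2)[folded seq]])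
      fix y assume "y \<in> snd c ` (fst c \<inter> fst d)"
      then have "y \<in> snd c ` W'" using fc by blast
      then show "(snd d \<circ> ?\<Phi> \<circ> cinv q) y = (snd d \<circ> cinv c) y" using cinvc by simp
    qed
    show "smooth_on (snd d ` (fst c \<inter> fst d)) (snd c \<circ> cinv d)"
      using s d by (simp add: sfun_def fc o_def)
  qed
  then have cm: "mchart P (UNIV \<times> model G) c"
    using premfd_P cco Wm mQ premfd_subspace[OF Q] by (auto simp: mchart_def charts_in_def fc W'_def)
  show thesis
  proof (rule that[OF cm _ b(1) k(1), of \<psi>])
    show "u0 \<in> fst c" using u0 U(2) b(2) k(2) by (simp add: fc W'_def q_def)
    show "p u \<in> fst b \<and> \<psi> u \<in> fst k \<and> snd c u = (snd b (p u), snd k (\<psi> u))" if "u \<in> fst c" for u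
      using that by (simp add: fc W'_def q_def c_def)
    show "act u g \<in> fst c \<and> \<psi> (act u g) = \<psi> u ** g" if "u \<in> fst c" "g \<in> pts G" "\<psi> u ** g \<in> fst k" for u g
      using that eq act_mem[of u g] p_act[of u g] by (simp add: fc W'_def q_def)
  qed
qed

abbreviation "FM \<equiv> (UNIV :: (real^'n) set) \<times> model G"

definition fibred :: "('p, (real^'n) \<times> 'k) chart \<Rightarrow> bool" where
  "fibred c \<longleftrightarrow> mchart P FM c \<and> (\<exists>b\<in>atlas M. \<forall>u\<in>fst c. p u \<in> fst b \<and> fst (snd c u) = snd b (p u))"

lemma fibred_iff: "c \<in> fibred_charts P p M G \<longleftrightarrow> fibred c"
  using premfd_P premfd_subspace[OF premfd_G]
  by (auto simp: fibred_charts_def fibred_def mchart_def subspace_Times image_subset_iff)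

lemma fibred_mchart: "fibred c \<Longrightarrow> mchart P FM c"
  by (simp add: fibred_def)

lemma ex_fibred:
  assumes "u \<in> pts P"
  obtains c where "fibred c" "u \<in> fst c"
  using trivialization[OF assms] unfolding fibred_def by (metis fst_conv)

text \<open>The first coordinates of a fibred chart are those of \<open>p u\<close> in a chart of
  \<open>M\<close>, so their differential is the differential of \<open>p\<close> up to an
  isomorphism.\<close>

lemma vert_fibred:
  assumes c: "fibred c" and u: "u \<in> fst c" and \<xi>: "\<xi> \<in> model P"
  shows "\<xi> \<in> vert P p M u \<longleftrightarrow> fst (coords P c u \<xi>) = 0"
proof -
  note cm = fibred_mchart[OF c]
  obtain b where b: "b \<in> atlas M" "\<And>u. u \<in> fst c \<Longrightarrow> p u \<in> fst b" "\<And>u. u \<in> fst c \<Longrightarrow> fst (snd c u) = snd b (p u)"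
    using c unfolding fibred_def by blast
  have bm: "mchart M (model M) b" by (rule atlas_mchart[OF premfd_M b(1)])
  have up: "u \<in> pts P" by (rule chart_pt[OF cm u])
  note t = tmap_mem[OF premfd_P premfd_M smooth_p up \<xi>]
  have "fst (coords P c u \<xi>) = tder P (\<lambda>u. fst (snd c u)) u \<xi>"
    unfolding coords_def by (rule tder_linear[OF premfd_P sfun_dom[OF cm] u \<xi> bounded_linear_fst, symmetric])
  also have "\<dots> = tder P (\<lambda>u. snd b (p u)) u \<xi>"
    by (rule tder_cong[OF premfd_P sfun_linear[OF sfun_dom[OF cm] bounded_linear_fst] u \<xi>, symmetric]) (rule b(3))
  also have "\<dots> = coords M b (p u) (tmap P M p u \<xi>)"
    by (rule coords_tmap[OF premfd_P premfd_M smooth_p bm b(2)[OF u] up \<xi>, symmetric])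
  finally have eq: "fst (coords P c u \<xi>) = coords M b (p u) (tmap P M p u \<xi>)" .
  have "tmap P M p u \<xi> = 0" if "coords M b (p u) (tmap P M p u \<xi>) = 0"
    using uncoords_coords[OF bm b(2)[OF u] t] lin_on_0[OF uncoords_lin[OF bm b(2)[OF u]] premfd_subspace[OF premfd_M]] that by simp
  then show ?thesis
    using lin_on_0[OF coords_lin[OF bm b(2)[OF u]] premfd_subspace[OF premfd_M]] \<xi> unfolding vert_def eq by auto
qed

text \<open>The fundamental field with its parameter in \<open>model G\<close> instead of the matrix
  Lie algebra, where it is just the differential of the orbit map.\<close>

definition fnd :: "'p \<Rightarrow> 'k \<Rightarrow> 'e" where
  "fnd u k = tmap G P (act u) (mat 1) k"

lemma fund_vf_eq: "fund_vf P G act X u = fnd u (inv_iota X)"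
  by (simp add: fund_vf_def fnd_def)

lemma fnd_mem: "u \<in> pts P \<Longrightarrow> k \<in> model G \<Longrightarrow> fnd u k \<in> model P"
  unfolding fnd_def by (rule tmap_mem[OF premfd_G premfd_P orbit_smooth one_G])

lemma fnd_lin: "u \<in> pts P \<Longrightarrow> lin_on (model G) (fnd u)"
  using tmap_lin[OF premfd_G premfd_P orbit_smooth one_G, of u] by (simp add: fnd_def[abs_def])

lemma fnd_vert:
  assumes "u \<in> pts P" "k \<in> model G"
  shows "fnd u k \<in> vert P p M u"
proof -
  have "tmap P M p u (fnd u k) = tmap G M (\<lambda>g. p (act u g)) (mat 1) k"
    using tmap_compose[OF premfd_G premfd_P premfd_M orbit_smooth[OF assms(1)] smooth_p one_G assms(2)] act_one[OF assms(1)]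
    by (simp add: fnd_def)
  also have "\<dots> = tmap G M (\<lambda>g. p u) (mat 1) k"
    by (rule tmap_cong[OF premfd_G premfd_M smooth_map_const[OF premfd_G smooth_map_pts[OF smooth_p assms(1)]] one_G assms(2)])
       (simp add: p_act assms(1))
  also have "\<dots> = 0" by (simp add: tmap_def o_def tder_const)
  finally show ?thesis using fnd_mem[OF assms] by (simp add: vert_def)
qed

text \<open>In a trivialization the base coordinates of a fundamental vector vanish, and its group
  coordinates are obtained from \<open>k\<close> by the differential of a left translation and a
  coordinate isomorphism, both bijective.\<close>

lemma fnd_bij:
  assumes u: "u \<in> pts P"
  shows "bij_betw (fnd u) (model G) (vert P p M u)"
proof -
  obtain c b e \<psi> where c: "mchart P FM c" "u \<in> fst c" "b \<in> atlas M" "e \<in> atlas G"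
    "\<And>u. u \<in> fst c \<Longrightarrow> p u \<in> fst b \<and> \<psi> u \<in> fst e \<and> snd c u = (snd b (p u), snd e (\<psi> u))"
    "\<And>u g. u \<in> fst c \<Longrightarrow> g \<in> pts G \<Longrightarrow> \<psi> u ** g \<in> fst e \<Longrightarrow> act u g \<in> fst c \<and> \<psi> (act u g) = \<psi> u ** g"
    using trivialization[OF u] by blast
  have fib: "fibred c" unfolding fibred_def using c by (metis fst_conv)
  have em: "mchart G (model G) e" by (rule atlas_mchart[OF premfd_G c(4)])
  have \<psi>: "\<psi> u \<in> fst e" using c(5)[OF c(2)] by simp
  have \<psi>G: "\<psi> u \<in> pts G" by (rule chart_pt[OF em \<psi>])
  have \<psi>1: "\<psi> u ** mat 1 \<in> fst e" using \<psi> by simp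
  let ?T = "\<lambda>k. coords G e (\<psi> u) (tmap G G (\<lambda>g. \<psi> u ** g) (mat 1) k)"
  let ?U = "pts G \<inter> (\<lambda>g. \<psi> u ** g) -` fst e"
  have sU: "sfun G ?U (\<lambda>g. snd e (\<psi> u ** g))"
    by (rule smooth_map_chart[OF premfd_G premfd_G left_mult_smooth[OF \<psi>G] em])
  have T: "snd (coords P c u (fnd u k)) = ?T k" if k: "k \<in> model G" for k
  proof -
    have c1: "act u (mat 1) \<in> fst c" using act_one[OF u] c(2) by simp
    have sA: "sfun G (pts G \<inter> act u -` fst c) (\<lambda>g. snd c (act u g))"
      by (rule smooth_map_chart[OF premfd_G premfd_P orbit_smooth[OF u] c(1)])
    have "coords P c u (fnd u k) = tder G (\<lambda>g. snd c (act u g)) (mat 1) k"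
      using coords_tmap[OF premfd_G premfd_P orbit_smooth[OF u] c(1) c1 one_G k] act_one[OF u] by (simp add: fnd_def)
    then have "snd (coords P c u (fnd u k)) = tder G (\<lambda>g. snd (snd c (act u g))) (mat 1) k"
      using tder_linear[OF premfd_G sA _ k bounded_linear_snd] c1 one_G by simp
    also have "\<dots> = tder G (\<lambda>g. snd e (\<psi> u ** g)) (mat 1) k"
      by (rule tder_cong[OF premfd_G sU _ k]) (use \<psi> one_G c(2,5,6) in auto)
    also have "\<dots> = ?T k"
      using coords_tmap[OF premfd_G premfd_G left_mult_smooth[OF \<psi>G] em \<psi>1 one_G k] by simp
    finally show ?thesis .
  qed
  have L: "bij_betw (tmap G G (\<lambda>g. \<psi> u ** g) (mat 1)) (model G) (model G)" by (rule left_translation_bij[OF \<psi>G])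
  have C: "bij_betw (coords G e (\<psi> u)) (model G) (model G)"
    by (rule bij_betw_byWitness[where f'="uncoords G e (\<psi> u)"])
       (use uncoords_coords[OF em \<psi>] coords_uncoords[OF em \<psi>] coords_mem[OF em \<psi>] uncoords_mem[OF em \<psi>] in auto)
  have TB: "bij_betw ?T (model G) (model G)" using bij_betw_trans[OF L C] by (simp add: o_def)
  show ?thesis
    unfolding bij_betw_def
  proof (intro conjI inj_onI equalityI subsetI)
    fix k l assume kl: "k \<in> model G" "l \<in> model G" "fnd u k = fnd u l"
    then have "?T k = ?T l" using T[OF kl(1)] T[OF kl(2)] by simp
    then show "k = l" using TB kl(1,2) unfolding bij_betw_def inj_on_def by blast
  next
    fix \<xi> assume "\<xi> \<in> fnd u ` model G"
    then show "\<xi> \<in> vert P p M u" using fnd_vert[OF u] by blast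
  next
    fix \<xi> assume \<xi>: "\<xi> \<in> vert P p M u"
    then have \<xi>P: "\<xi> \<in> model P" by (simp add: vert_def)
    have "snd (coords P c u \<xi>) \<in> model G" using coords_mem[OF c(1,2) \<xi>P] by (simp add: mem_Times_iff)
    then have "snd (coords P c u \<xi>) \<in> ?T ` model G" using bij_betw_imp_surj_on[OF TB] by simp
    then obtain k where "snd (coords P c u \<xi>) = ?T k" "k \<in> model G" by (rule imageE)
    then have k: "k \<in> model G" "?T k = snd (coords P c u \<xi>)" by simp_all
    have "coords P c u (fnd u k) = coords P c u \<xi>"
      using T[OF k(1)] k(2) vert_fibred[OF fib c(2) \<xi>P] \<xi> vert_fibred[OF fib c(2) fnd_mem[OF u k(1)]] fnd_vert[OF u k(1)]
      by (simp add: prod_eq_iff)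
    then have "fnd u k = \<xi>" using uncoords_coords[OF c(1,2)] fnd_mem[OF u k(1)] \<xi>P by metis
    then show "\<xi> \<in> fnd u ` model G" using k(1) by blast
  qed
qed

text \<open>The action in coordinates, with the group element near the identity, as one map of two
  variables. Its derivative in the second variable is the fundamental field, and its mixed second
  derivatives enter Cartan's formula.\<close>

definition act_rep :: "('p, 'f::euclidean_space) chart \<Rightarrow> 'f \<times> 'k \<Rightarrow> 'f" where
  "act_rep c q = snd c (act (cinv c (fst q)) (cinv (chart_at G (mat 1)) (snd q)))"

definition act_dom :: "('p, 'f::euclidean_space) chart \<Rightarrow> ('f \<times> 'k) set" where
  "act_dom c = (\<lambda>r. (snd c (fst r), snd (chart_at G (mat 1)) (snd r))) ` {r \<in> fst c \<times> fst (chart_at G (mat 1)). act (fst r) (snd r) \<in> fst c}"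

abbreviation "e1 \<equiv> chart_at G (mat 1)"

lemma e1_mchart: "mchart G (model G) e1" and e1_mem: "mat 1 \<in> fst e1"
  using chart_at_mchart[OF premfd_G one_G] chart_at(2)[OF one_G] by auto

lemma act_rep_smooth:
  assumes c: "mchart P F c"
  shows "ropen (F \<times> model G) (act_dom c)" "smooth_on (act_dom c) (act_rep c)"
    "act_rep c ` act_dom c \<subseteq> snd c ` fst c"
    "\<And>u. u \<in> fst c \<Longrightarrow> (snd c u, snd e1 (mat 1)) \<in> act_dom c"
    "\<And>y z. (y, z) \<in> act_dom c \<Longrightarrow> y \<in> snd c ` fst c \<and> z \<in> snd e1 ` fst e1 \<and> act (cinv c y) (cinv e1 z) \<in> fst c"
    "\<And>u g. u \<in> fst c \<Longrightarrow> g \<in> fst e1 \<Longrightarrow> act_rep c (snd c u, snd e1 g) = snd c (act u g)"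
proof -
  note e = e1_mchart e1_mem
  note co = mchart_chart_on[OF c] mchart_chart_on[OF e(1)]
  have pc: "mchart (prod_mfd P G) (F \<times> model G) (pchart c e1)" by (rule mchart_prod[OF c e(1)])
  have sf: "sfun (prod_mfd P G) (pts (prod_mfd P G) \<inter> (\<lambda>(u, g). act u g) -` fst c) (\<lambda>r. snd c ((\<lambda>(u, g). act u g) r))"
    by (rule smooth_map_chart[OF premfd_prod[OF premfd_P premfd_G] premfd_P act_smooth c])
  have dom: "snd (pchart c e1) ` (pts (prod_mfd P G) \<inter> (\<lambda>(u, g). act u g) -` fst c \<inter> fst (pchart c e1)) = act_dom c"
    unfolding act_dom_def using mchart_pts[OF c] mchart_pts[OF e(1)] by (auto simp: image_iff) 
  show "ropen (F \<times> model G) (act_dom c)" using mopen_chart[OF pc sfun_mopen[OF sf]] unfolding dom .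
  show rep: "act_rep c (snd c u, snd e1 g) = snd c (act u g)" if "u \<in> fst c" "g \<in> fst e1" for u g
    using that co by (simp add: act_rep_def)
  show d: "y \<in> snd c ` fst c \<and> z \<in> snd e1 ` fst e1 \<and> act (cinv c y) (cinv e1 z) \<in> fst c" if "(y, z) \<in> act_dom c" for y z
    using that co by (auto simp: act_dom_def)
  show "smooth_on (act_dom c) (act_rep c)"
  proof (rule smooth_on_cong[OF sfun_chart[OF pc sf, unfolded dom]])
    fix q assume "q \<in> act_dom c"
    then have "cinv (pchart c e1) q = (cinv c (fst q), cinv e1 (snd q))"
      using cinv_pchart[OF co, of "fst q" "snd q"] d[of "fst q" "snd q"] by simp
    then show "snd c (case cinv (pchart c e1) q of (u, g) \<Rightarrow> act u g) = act_rep c q" by (simp add: act_rep_def)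
  qed
  show "act_rep c ` act_dom c \<subseteq> snd c ` fst c" using rep by (auto simp: act_dom_def)
  show "(snd c u, snd e1 (mat 1)) \<in> act_dom c" if "u \<in> fst c" for u
    using that act_one[OF chart_pt[OF c that]] e(2) unfolding act_dom_def
    by (intro image_eqI[of _ _ "(u, mat 1)"]) auto
qed

lemma coords_fnd:
  assumes c: "mchart P F c" "u \<in> fst c" and k: "k \<in> model G"
  shows "coords P c u (fnd u k) = dderiv (act_rep c) (snd c u, snd e1 (mat 1)) (0, k)"
proof -
  have u: "u \<in> pts P" by (rule chart_pt[OF c])
  have c1: "act u (mat 1) \<in> fst c" using act_one[OF u] c(2) by simp
  have "coords P c u (fnd u k) = tder G (\<lambda>g. snd c (act u g)) (mat 1) k"
    using coords_tmap[OF premfd_G premfd_P orbit_smooth[OF u] c(1) c1 one_G k] act_one[OF u] by (simp add: fnd_def)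
  also have "\<dots> = dderiv (\<lambda>z. act_rep c (snd c u, z)) (snd e1 (mat 1)) k"
    using cinv_snd[OF mchart_chart_on[OF c(1)] c(2)] by (simp add: tder_eq act_rep_def)
  finally show ?thesis unfolding dderiv_snd_slice .
qed

text \<open>By \<open>coords_fnd\<close> the coordinates of a fundamental field are a partial
  derivative of the smooth map \<open>act_rep\<close>.\<close>

lemma fnd_lform:
  assumes c: "mchart P F c"
  shows "lform (snd c ` fst c) (model G) (\<lambda>y k. coords P c (cinv c y) (fnd (cinv c y) k))"
proof (rule lformI[OF premfd_subspace[OF premfd_G]])
  note co = mchart_chart_on[OF c]
  fix k assume k: "k \<in> model G"
  have "smooth_on (snd c ` fst c) (\<lambda>y. dderiv (act_rep c) (y, snd e1 (mat 1)) (0, k))"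
    by (rule smooth_on_dderiv'[OF act_rep_smooth(1,2)[OF c] smooth_on_Pair[OF smooth_on_ident smooth_on_const] smooth_on_const])
       (use act_rep_smooth(4)[OF c] k subspace_0[OF mchart_subspace[OF c]] in auto)
  then show "smooth_on (snd c ` fst c) (\<lambda>y. coords P c (cinv c y) (fnd (cinv c y) k))"
    by (rule smooth_on_cong) (use co coords_fnd[OF c _ k] in auto)
next
  fix y assume "y \<in> snd c ` fst c"
  then have m: "cinv c y \<in> fst c" by (rule cinv_mem)
  have u: "cinv c y \<in> pts P" by (rule chart_pt[OF c m])
  show "lin_on (model G) (\<lambda>k. coords P c (cinv c y) (fnd (cinv c y) k))"
    using coords_lin[OF c m] fnd_lin[OF u] fnd_mem[OF u] unfolding lin_on_def by simp
qed

text \<open>From \<open>act (act u x) g = act (act u g) (g^-1 x g)\<close>: a right translation maps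
  orbits to orbits and conjugates the parameter.\<close>

lemma fnd_right:
  assumes u: "u \<in> pts P" and g: "g \<in> pts G" and X: "X \<in> lie_alg G"
  shows "tmap P P (\<lambda>u. act u g) u (fnd u (inv_iota X)) = fnd (act u g) (inv_iota (matrix_inv g ** X ** g))"
proof -
  let ?k = "inv_iota X"
  note k = inv_iota_mem[OF X]
  have "tmap P P (\<lambda>u. act u g) u (fnd u ?k) = tmap G P (\<lambda>x. act (act u x) g) (mat 1) ?k"
    using tmap_compose[OF premfd_G premfd_P premfd_P orbit_smooth[OF u] right_smooth[OF g] one_G k] act_one[OF u]
    by (simp add: fnd_def)
  also have "\<dots> = tmap G P (\<lambda>x. act (act u g) (matrix_inv g ** x ** g)) (mat 1) ?k"
  proof (rule tmap_cong[OF premfd_G premfd_P _ one_G k])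
    show "smooth_map G P (\<lambda>x. act (act u g) (matrix_inv g ** x ** g))"
      by (rule smooth_map_compose[OF premfd_G premfd_G conj_smooth[OF g] orbit_smooth[OF act_mem[OF u g]]])
    show "act (act u g) (matrix_inv g ** x ** g) = act (act u x) g" if "x \<in> pts G" for x
    proof -
      have "g ** (matrix_inv g ** x ** g) = x ** g"
        using inv_mult(1)[OF g] by (simp add: matrix_mul_assoc)
      then show ?thesis using act_act[OF u g mult_G[OF mult_G[OF inv_G[OF g] that] g]] act_act[OF u that g] by simp
    qed
  qed
  also have "\<dots> = fnd (act u g) (tmap G G (\<lambda>x. matrix_inv g ** x ** g) (mat 1) ?k)"
    using tmap_compose[OF premfd_G premfd_G premfd_P conj_smooth[OF g] orbit_smooth[OF act_mem[OF u g]] one_G k] g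
    by (simp add: fnd_def)
  finally show ?thesis using inv_iota_Ad[OF g X] by simp
qed

text \<open>Cartan's formula: the Lie derivative of the form along the fundamental field is the derivative
  of the representation, and the contraction with the field is constant.\<close>

lemma ext_deriv_fnd:
  fixes \<alpha> :: "'p \<Rightarrow> 'e \<Rightarrow> 'w::euclidean_space"
  assumes a: "one_form P \<alpha>" and u: "u \<in> pts P" and k: "k \<in> model G" and \<xi>: "\<xi> \<in> model P"
    and equiv: "\<And>g. g \<in> pts G \<Longrightarrow> \<alpha> (act u g) (tmap P P (\<lambda>u. act u g) u \<xi>) = B g (\<alpha> u \<xi>)"
    and const: "\<And>u. u \<in> pts P \<Longrightarrow> \<alpha> u (fnd u k) = w0"
    and B: "sfun G (pts G) (\<lambda>g. B g (\<alpha> u \<xi>))"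
  shows "ext_deriv P \<alpha> u (fnd u k) \<xi> = tder G (\<lambda>g. B g (\<alpha> u \<xi>)) (mat 1) k"
proof -
  let ?c = "chart_at P u"
  note c = chart_at_mchart[OF premfd_P u] chart_at(2)[OF u]
  note co = mchart_chart_on[OF c(1)] mchart_chart_on[OF e1_mchart]
  let ?y = "snd ?c u" and ?k0 = "snd e1 (mat 1)" and ?A = "act_rep ?c" and ?T = "act_dom ?c" and ?E = "model P"
    and ?S = "snd ?c ` fst ?c"
  let ?a = "frep P ?c \<alpha>"
  note ar = act_rep_smooth[OF c(1)]
  note S = mchart_ropen[OF c(1)] and l = one_form_lform[OF a c(1)]
  have E: "subspace ?E" by (rule premfd_subspace[OF premfd_P])
  have K: "subspace (model G)" by (rule premfd_subspace[OF premfd_G])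
  have q0: "(?y, ?k0) \<in> ?T" by (rule ar(4)[OF c(2)])
  have yS: "?y \<in> ?S" using c(2) by auto
  have d1: "(\<xi>, 0) \<in> ?E \<times> model G" and d2: "(0, k) \<in> ?E \<times> model G" using \<xi> k subspace_0[OF E] subspace_0[OF K] by auto
  have A0: "?A (y, ?k0) = y" if "y \<in> ?S" for y
  proof -
    obtain v where v: "v \<in> fst ?c" "y = snd ?c v" using \<open>y \<in> ?S\<close> by auto
    then show ?thesis using ar(6)[OF v(1) e1_mem] act_one[OF chart_pt[OF c(1) v(1)]] by simp
  qed
  let ?\<zeta> = "\<lambda>y. dderiv ?A (y, ?k0) (0, k)"
  have \<zeta>: "?\<zeta> (snd ?c v) = coords P ?c v (fnd v k)" if "v \<in> fst ?c" for v
    using coords_fnd[OF c(1) that k] by simp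
  have \<zeta>0: "?\<zeta> ?y = fnd u k"
    using \<zeta>[OF c(2)] coords_chart_at[OF premfd_P u fnd_mem[OF u k]] by simp
  have \<zeta>s: "smooth_on ?S ?\<zeta>"
    by (rule smooth_on_dderiv'[OF ar(1,2) smooth_on_Pair[OF smooth_on_ident smooth_on_const] smooth_on_const])
       (use ar(4) d2 in auto)
  have \<zeta>E: "?\<zeta> ` ?S \<subseteq> ?E" using \<zeta> coords_mem[OF c(1)] fnd_mem[OF chart_pt[OF c(1)] k] by auto
  have Ad0: "dderiv ?A (?y, ?k0) (\<xi>, 0) = \<xi>"
    unfolding dderiv_fst_slice[symmetric]
    by (subst dderiv_cong[OF S smooth_on_ident yS \<xi>]) (use A0 in auto)
  \<comment> \<open>The contraction of the form with the fundamental field is the constant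
    \<open>w0\<close>; its derivative along \<open>\<xi>\<close> is expanded by the product
    rule.\<close>
  have con: "dderiv (\<lambda>x. ?a x (fnd u k)) ?y \<xi> + ?a ?y (dderiv ?\<zeta> ?y \<xi>) = 0"
  proof -
    have cst: "w0 = ?a y (?\<zeta> y)" if "y \<in> ?S" for y
    proof -
      obtain v where v: "v \<in> fst ?c" "y = snd ?c v" using \<open>y \<in> ?S\<close> by auto
      then show ?thesis
        using \<zeta>[OF v(1)] frep_coords[OF c(1) v(1) fnd_mem[OF chart_pt[OF c(1) v(1)] k], of \<alpha>] const[OF chart_pt[OF c(1) v(1)]] by simp
    qed
    have "dderiv (\<lambda>y. ?a y (?\<zeta> y)) ?y \<xi> = 0"
      by (subst dderiv_cong[OF S smooth_on_const[of _ w0] yS \<xi> cst]) simp_all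
    then show ?thesis
      using lform_dderiv[OF S E S l smooth_on_ident _ \<zeta>s \<zeta>E yS \<xi>] \<zeta>0 by simp
  qed
  \<comment> \<open>In coordinates, \<open>\<alpha>\<close> pulled back along the right translation
    by \<open>g\<close> and evaluated at \<open>\<xi>\<close>. Its derivative in the group variable
    is the Lie derivative along the fundamental field, and by equivariance it is the derivative of
    \<open>B\<close>.\<close>
  let ?H = "\<lambda>q. ?a (?A q) (dderiv ?A q (\<xi>, 0))"
  have Es: "smooth_on ?T (\<lambda>q. dderiv ?A q (\<xi>, 0))" by (rule smooth_on_dderiv_const[OF ar(1,2) d1])
  have EE: "(\<lambda>q. dderiv ?A q (\<xi>, 0)) ` ?T \<subseteq> ?E"
    using dderiv_mem[OF ar(1,2) _ d1 E subset_trans[OF ar(3) ropen_subset[OF S]]] by (rule image_subsetI)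
  \<comment> \<open>Mixed derivatives commute: how the differentials of right translations vary with
    \<open>g\<close> is how the fundamental field varies along \<open>\<xi>\<close>. This term is
    what links \<open>?H\<close> with the equation \<open>con\<close>.\<close>
  have mix: "dderiv (\<lambda>q. dderiv ?A q (\<xi>, 0)) (?y, ?k0) (0, k) = dderiv ?\<zeta> ?y \<xi>"
    using dderiv_commute[OF ar(1,2) q0 d1 d2] dderiv_fst_slice[of "\<lambda>q. dderiv ?A q (0, k)"] by simp
  have "dderiv ?H (?y, ?k0) (0, k) = dderiv (\<lambda>x. ?a x \<xi>) ?y (fnd u k) + ?a ?y (dderiv ?\<zeta> ?y \<xi>)"
    using lform_dderiv[OF S E ar(1) l ar(2,3) Es EE q0 d2] Ad0 A0[OF yS] \<zeta>0 mix by simp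
  moreover have "dderiv ?H (?y, ?k0) (0, k) = tder G (\<lambda>g. B g (\<alpha> u \<xi>)) (mat 1) k"
  proof -
    \<comment> \<open>The coordinates of those group elements that keep \<open>u\<close> inside the
      chart; equivariance can be read in coordinates there.\<close>
    let ?Z = "model G \<inter> (\<lambda>z. (?y, z)) -` ?T"
    have Z: "ropen (model G) ?Z"
      by (rule ropen_preimage[OF ropen_self[OF K] ar(1)]) (use chart_image_subset[OF co(1) c(2)] in \<open>auto intro!: continuous_intros\<close>)
    have k0: "?k0 \<in> ?Z" using q0 chart_image_subset[OF co(2) e1_mem] by auto
    have sm: "smooth_on ?Z (\<lambda>z. B (cinv e1 z) (\<alpha> u \<xi>))"
      by (rule smooth_on_subset[OF sfun_chart[OF e1_mchart B]]) (use ar(5) mchart_pts[OF e1_mchart] in blast)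
    have "dderiv (\<lambda>z. ?H (?y, z)) ?k0 k = dderiv (\<lambda>z. B (cinv e1 z) (\<alpha> u \<xi>)) ?k0 k"
    proof (rule dderiv_cong[OF Z sm k0 k])
      fix z assume z: "z \<in> ?Z"
      define g where "g = cinv e1 z"
      have zz: "z \<in> snd e1 ` fst e1" "act u g \<in> fst ?c" using ar(5)[of ?y z] z co(1) c(2) by (auto simp: g_def)
      have g: "g \<in> fst e1" "z = snd e1 g" using cinv_mem[OF zz(1)] snd_cinv[OF zz(1)] by (simp_all add: g_def)
      have gG: "g \<in> pts G" by (rule chart_pt[OF e1_mchart g(1)])
      have A: "?A (snd ?c v, z) = snd ?c (act v g)" if "v \<in> fst ?c" for v using ar(6)[OF that g(1)] g(2) by simp
      have "dderiv ?A (?y, z) (\<xi>, 0) = dderiv (\<lambda>y. ?A (y, z)) ?y \<xi>" by (rule dderiv_fst_slice[symmetric])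
      also have "(\<lambda>y. ?A (y, z)) = (\<lambda>y. snd ?c (act (cinv ?c y) g))" by (simp add: act_rep_def g_def)
      also have "dderiv (\<lambda>y. snd ?c (act (cinv ?c y) g)) ?y \<xi> = coords P ?c (act u g) (tmap P P (\<lambda>u. act u g) u \<xi>)"
        using coords_tmap_chart[OF premfd_P premfd_P right_smooth[OF gG] c(1) zz(2) c \<xi>] coords_chart_at[OF premfd_P u \<xi>] by simp
      finally have "?H (?y, z) = \<alpha> (act u g) (tmap P P (\<lambda>u. act u g) u \<xi>)"
        using A[OF c(2)] frep_coords[OF c(1) zz(2) tmap_mem[OF premfd_P premfd_P right_smooth[OF gG] u \<xi>], of \<alpha>] by simp
      then show "B (cinv e1 z) (\<alpha> u \<xi>) = ?H (?y, z)" using equiv[OF gG] by (simp add: g_def)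
    qed
    then show ?thesis unfolding dderiv_snd_slice[of ?H] tder_eq by simp
  qed
  moreover have "ext_deriv P \<alpha> u (fnd u k) \<xi> = dderiv (\<lambda>x. ?a x \<xi>) ?y (fnd u k) - dderiv (\<lambda>x. ?a x (fnd u k)) ?y \<xi>"
    by (simp add: ext_deriv_chart_at dform_def)
  ultimately show ?thesis using con by (simp add: add_eq_0_iff)
qed

end

section \<open>Tensors\<close>

lemma bilin_apply:
  fixes f :: "real^'n::finite \<Rightarrow> real^'n \<Rightarrow> real^'n"
  assumes "\<And>v. linear (f v)" "\<And>w. linear (\<lambda>v. f v w)"
  shows "blinfun_apply (blinfun_apply (bilin f) v) w = f v w"
proof -
  have 1: "blinfun_apply (Blinfun (f v)) = f v" for v
    using assms(1) bounded_linear_Blinfun_apply linear_conv_bounded_linear by blast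
  have "linear (\<lambda>v. Blinfun (f v))"
    by (rule linearI; rule blinfun_eqI)
       (simp_all add: 1 plus_blinfun.rep_eq scaleR_blinfun.rep_eq linear_add[OF assms(2)] linear_scale[OF assms(2)])
  then have "blinfun_apply (Blinfun (\<lambda>v. Blinfun (f v))) = (\<lambda>v. Blinfun (f v))"
    using bounded_linear_Blinfun_apply linear_conv_bounded_linear by blast
  then show ?thesis by (simp add: bilin_def 1)
qed

lemma linear_blinfun_apply: "linear (blinfun_apply A)"
  by (rule bounded_linear.linear[OF blinfun.bounded_linear_right])

lemma linear_matrix_vector_left: "linear (\<lambda>A :: real^'n^'n. A *v v)"
  by (rule bounded_linear.linear[OF bounded_bilinear.bounded_linear_left[OF bounded_bilinear_matrix_vector]])

lemma spencer_apply:
  "blinfun_apply (blinfun_apply (spencer A) v) w = blinfun_apply A v *v w - blinfun_apply A w *v v"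
proof -
  have "linear (\<lambda>v. blinfun_apply A v *v w)" for w
    using linear_compose[OF linear_blinfun_apply linear_matrix_vector_left] by (simp add: o_def)
  then show ?thesis
    unfolding spencer_def by (intro bilin_apply linear_compose_sub matrix_vector_mul_linear)
qed

lemma torsion_act_apply:
  "blinfun_apply (blinfun_apply (torsion_act g \<tau>) v) w =
    g *v blinfun_apply (blinfun_apply \<tau> (matrix_inv g *v v)) (matrix_inv g *v w)"
  unfolding torsion_act_def
proof (rule bilin_apply)
  show "linear (\<lambda>w. g *v blinfun_apply (blinfun_apply \<tau> (matrix_inv g *v v)) (matrix_inv g *v w))" for v
    using linear_compose[OF linear_compose[OF matrix_vector_mul_linear linear_blinfun_apply] matrix_vector_mul_linear]
    by (simp add: o_def)
  have "linear (\<lambda>v. blinfun_apply (blinfun_apply \<tau> v) w)" for w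
    by (intro linearI) (simp_all add: blinfun.add_left blinfun.add_right blinfun.scaleR_left blinfun.scaleR_right)
  then show "linear (\<lambda>v. g *v blinfun_apply (blinfun_apply \<tau> (matrix_inv g *v v)) (matrix_inv g *v w))" for w
    using linear_compose[OF linear_compose[OF matrix_vector_mul_linear] matrix_vector_mul_linear]
    by (fastforce simp add: o_def)
qed

lemma spencer_lin: "spencer (r *\<^sub>R A + s *\<^sub>R B) = r *\<^sub>R spencer A + s *\<^sub>R spencer B"
proof (intro blinfun_eqI)
  fix v w
  show "blinfun_apply (blinfun_apply (spencer (r *\<^sub>R A + s *\<^sub>R B)) v) w =
    blinfun_apply (blinfun_apply (r *\<^sub>R spencer A + s *\<^sub>R spencer B) v) w"
    by (simp add: spencer_apply blinfun.add_left blinfun.scaleR_left linear_add[OF linear_matrix_vector_left]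
        linear_scale[OF linear_matrix_vector_left] scaleR_right_diff_distrib)
qed

lemma torsion_spaceD: "\<tau> \<in> torsion_space \<Longrightarrow> blinfun_apply (blinfun_apply \<tau> v) w = - blinfun_apply (blinfun_apply \<tau> w) v"
  unfolding torsion_space_def by blast

lemma subspace_torsion_space: "subspace torsion_space"
proof (rule subspaceI)
  show "0 \<in> torsion_space" by (simp add: torsion_space_def)
  fix \<tau> \<sigma> :: "'n::finite bil" and r
  assume \<tau>: "\<tau> \<in> torsion_space"
  show "r *\<^sub>R \<tau> \<in> torsion_space"
    unfolding torsion_space_def mem_Collect_eq blinfun.scaleR_left
    by (intro allI, subst torsion_spaceD[OF \<tau>]) simp
  assume \<sigma>: "\<sigma> \<in> torsion_space"
  show "\<tau> + \<sigma> \<in> torsion_space"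
    unfolding torsion_space_def mem_Collect_eq blinfun.add_left
    by (intro allI, subst torsion_spaceD[OF \<tau>], subst torsion_spaceD[OF \<sigma>]) simp
qed

text \<open>The components of a bilinear map. This linear injection into a Euclidean space carries
  questions of smoothness on tensors to a place where \<open>lin_on_extend\<close> applies.\<close>

definition tensor_array :: "'n::finite bil \<Rightarrow> real^'n^'n^'n" where
  "tensor_array \<tau> = (\<chi> i. \<chi> j. blinfun_apply (blinfun_apply \<tau> (axis i 1)) (axis j 1))"

lemma tensor_array_linear: "linear tensor_array"
  by (intro linearI) (simp_all add: tensor_array_def vec_eq_iff blinfun.add_left blinfun.scaleR_left)

lemma tensor_array_inj: "inj tensor_array"
proof (rule injI)
  fix \<tau> \<sigma> :: "'n::finite bil"
  assume "tensor_array \<tau> = tensor_array \<sigma>"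
  then have "blinfun_apply (blinfun_apply \<tau> (axis i 1)) (axis j 1) = blinfun_apply (blinfun_apply \<sigma> (axis i 1)) (axis j 1)" for i j
    by (simp add: tensor_array_def vec_eq_iff)
  then show "\<tau> = \<sigma>"
    by (intro blinfun_euclidean_eqI) (auto simp: Basis_vec_def)
qed

section \<open>Horizontal subspaces of a G-structure\<close>

locale gstr = principal G P M p act
  for G :: "(real^'n^'n, 'k::euclidean_space) mfd" and P :: "('p, 'e::euclidean_space) mfd"
    and M :: "('m, real^'n) mfd" and p :: "'p \<Rightarrow> 'm" and act :: "'p \<Rightarrow> real^'n^'n \<Rightarrow> 'p" +
  fixes \<theta> :: "'p \<Rightarrow> 'e \<Rightarrow> real^'n" and \<dd> :: "'n::finite bil set"
  assumes type_one: "type_one G" and submodule: "torsion_submodule G \<dd>" and decomp: "spencer_decomposition G \<dd>"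
    and theta_form: "one_form P \<theta>"
    and theta_equiv: "\<And>g u \<xi>. g \<in> pts G \<Longrightarrow> u \<in> pts P \<Longrightarrow> \<xi> \<in> model P \<Longrightarrow>
      \<theta> (act u g) (tmap P P (\<lambda>u. act u g) u \<xi>) = matrix_inv g *v \<theta> u \<xi>"
    and theta_ker: "\<And>u. u \<in> pts P \<Longrightarrow> {\<xi>\<in>model P. \<theta> u \<xi> = 0} = vert P p M u"
begin

abbreviation "\<gg> \<equiv> lie_alg G"

lemma hom_algD: "A \<in> hom_alg \<gg> \<Longrightarrow> blinfun_apply A v \<in> \<gg>"
  by (simp add: hom_alg_def)

lemma hom_alg_lin: "A \<in> hom_alg \<gg> \<Longrightarrow> B \<in> hom_alg \<gg> \<Longrightarrow> r *\<^sub>R A + s *\<^sub>R B \<in> hom_alg \<gg>"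
  by (simp add: hom_alg_def blinfun.add_left blinfun.scaleR_left subspace_add[OF subspace_lie_alg] subspace_scale[OF subspace_lie_alg])

lemma subspace_dd: "subspace \<dd>" and dd_torsion: "\<dd> \<subseteq> torsion_space"
  and dd_act: "g \<in> pts G \<Longrightarrow> \<tau> \<in> \<dd> \<Longrightarrow> torsion_act g \<tau> \<in> \<dd>"
  using submodule by (auto simp: torsion_submodule_def)

text \<open>The difference of the two images lies in both summands of the decomposition, hence is
  zero. So \<open>A - B\<close> is symmetric in its two arguments and belongs to the first
  prolongation of the Lie algebra.\<close>

lemma spencer_inj:
  assumes A: "A \<in> hom_alg \<gg>" "B \<in> hom_alg \<gg>" and d: "\<tau> - spencer A \<in> \<dd>" "\<tau> - spencer B \<in> \<dd>"
  shows "A = B"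
proof -
  have AB: "A - B \<in> hom_alg \<gg>" using hom_alg_lin[OF A, of 1 "-1"] by simp
  have eq: "spencer (A - B) = spencer A - spencer B" using spencer_lin[of 1 A "-1" B] by simp
  have "(\<tau> - spencer B) - (\<tau> - spencer A) \<in> \<dd>" by (rule subspace_diff[OF subspace_dd d(2,1)])
  then have "spencer (A - B) \<in> \<dd>" by (simp add: eq)
  then have "spencer (A - B) \<in> spencer ` hom_alg \<gg> \<inter> \<dd>" using imageI[OF AB] by blast
  then have "spencer (A - B) = 0" using decomp by (auto simp: spencer_decomposition_def)
  then have "blinfun_apply (A - B) v *v w = blinfun_apply (A - B) w *v v" for v w
    using spencer_apply[of "A - B" v w] by simp
  then have "A - B \<in> alg_prolongation \<gg>" using AB by (simp add: alg_prolongation_def)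
  then show ?thesis using type_one by (simp add: type_one_def)
qed

text \<open>The projection of the torsion space onto the image of \<open>spencer\<close> along
  \<open>\<dd>\<close>, followed by the inverse of \<open>spencer\<close>.\<close>

definition sol :: "'n bil \<Rightarrow> (real^'n) \<Rightarrow>\<^sub>L (real^'n^'n)" where
  "sol \<tau> = (THE A. A \<in> hom_alg \<gg> \<and> \<tau> - spencer A \<in> \<dd>)"

lemma sol_eq: "A \<in> hom_alg \<gg> \<Longrightarrow> \<tau> - spencer A \<in> \<dd> \<Longrightarrow> sol \<tau> = A"
  unfolding sol_def using spencer_inj by (intro the_equality) auto

lemma sol:
  assumes "\<tau> \<in> torsion_space"
  shows "sol \<tau> \<in> hom_alg \<gg>" "\<tau> - spencer (sol \<tau>) \<in> \<dd>"
proof -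
  obtain A \<sigma> where A: "A \<in> hom_alg \<gg>" "\<sigma> \<in> \<dd>" "\<tau> = spencer A + \<sigma>"
    using assms decomp unfolding spencer_decomposition_def by blast
  then have "\<tau> - spencer A \<in> \<dd>" by simp
  then show "sol \<tau> \<in> hom_alg \<gg>" "\<tau> - spencer (sol \<tau>) \<in> \<dd>" using sol_eq[OF A(1)] A(1) by auto
qed

lemma sol_lin: "lin_on torsion_space sol"
  unfolding lin_on_def
proof (intro ballI allI)
  fix \<tau> \<sigma> :: "'n bil" and r s assume a: "\<tau> \<in> torsion_space" "\<sigma> \<in> torsion_space"
  have "r *\<^sub>R (\<tau> - spencer (sol \<tau>)) + s *\<^sub>R (\<sigma> - spencer (sol \<sigma>)) \<in> \<dd>"
    by (intro subspace_add[OF subspace_dd] subspace_scale[OF subspace_dd] sol a)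
  then show "sol (r *\<^sub>R \<tau> + s *\<^sub>R \<sigma>) = r *\<^sub>R sol \<tau> + s *\<^sub>R sol \<sigma>"
    by (intro sol_eq hom_alg_lin sol a) (simp add: spencer_lin algebra_simps)
qed

text \<open>\<open>sol\<close> is linear, so read in tensor components it extends to a linear map of
  a Euclidean space. It thus preserves smooth dependence.\<close>

lemma sol_smooth:
  obtains L where "bounded_linear L" "\<And>\<tau>. \<tau> \<in> torsion_space \<Longrightarrow> L (tensor_array \<tau>) = inv_iota (blinfun_apply (sol \<tau>) v)"
proof -
  let ?Z = "tensor_array ` (torsion_space :: 'n bil set)" and ?r = "the_inv_into (torsion_space :: 'n bil set) tensor_array"
  let ?f = "\<lambda>a. inv_iota (blinfun_apply (sol (?r a)) v)"
  have bij: "bij_betw tensor_array torsion_space ?Z"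
    using inj_on_subset[OF tensor_array_inj] by (auto simp: bij_betw_def)
  have r: "?r a \<in> torsion_space" if "a \<in> ?Z" for a
    using the_inv_into_into[of tensor_array torsion_space a torsion_space] bij that by (auto simp: bij_betw_def)
  have rl: "lin_on ?Z ?r"
    by (rule lin_on_the_inv_into[OF subspace_torsion_space linear_imp_lin_on[OF tensor_array_linear] bij])
  have Z: "subspace ?Z" by (rule linear_subspace_image[OF tensor_array_linear subspace_torsion_space])
  have "lin_on ?Z ?f"
    unfolding lin_on_def
  proof (intro ballI allI)
    fix a b s t assume ab: "a \<in> ?Z" "b \<in> ?Z"
    have "blinfun_apply (sol (?r (s *\<^sub>R a + t *\<^sub>R b))) v = s *\<^sub>R blinfun_apply (sol (?r a)) v + t *\<^sub>R blinfun_apply (sol (?r b)) v"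
      by (simp only: lin_onD[OF rl ab] lin_onD[OF sol_lin r[OF ab(1)] r[OF ab(2)]] blinfun.add_left blinfun.scaleR_left)
    then show "?f (s *\<^sub>R a + t *\<^sub>R b) = s *\<^sub>R ?f a + t *\<^sub>R ?f b"
      using lin_onD[OF inv_iota_lin hom_algD[OF sol(1)[OF r[OF ab(1)]]] hom_algD[OF sol(1)[OF r[OF ab(2)]]]] by simp
  qed
  then obtain L where L: "bounded_linear L" "\<And>a. a \<in> ?Z \<Longrightarrow> L a = ?f a" using lin_on_extend[OF Z] by blast
  show thesis
  proof (rule that[OF L(1)])
    fix \<tau> :: "'n bil" assume "\<tau> \<in> torsion_space"
    then show "L (tensor_array \<tau>) = inv_iota (blinfun_apply (sol \<tau>) v)"
      using L(2)[of "tensor_array \<tau>"] the_inv_into_f_f[of tensor_array torsion_space \<tau>] bij by (auto simp: bij_betw_def)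
  qed
qed

lemma theta_lin: "u \<in> pts P \<Longrightarrow> lin_on (model P) (\<theta> u)"
  using theta_form by (simp add: one_form_def)

lemma theta_fnd: "u \<in> pts P \<Longrightarrow> k \<in> model G \<Longrightarrow> \<theta> u (fnd u k) = 0"
  using theta_ker[of u] fnd_vert[of u k] by blast

lemma dtheta_fnd:
  assumes u: "u \<in> pts P" and k: "k \<in> model G" and \<xi>: "\<xi> \<in> model P"
  shows "ext_deriv P \<theta> u (fnd u k) \<xi> = - (\<iota> k *v \<theta> u \<xi>)"
  using ext_deriv_fnd[OF theta_form u k \<xi>, of "\<lambda>g w. matrix_inv g *v w" 0] theta_equiv[OF _ u \<xi>] theta_fnd[OF _ k]
    tder_inv_vec[OF k, of "\<theta> u \<xi>"] by simp

text \<open>A horizontal subspace at u is recorded by its lift, the inverse of the restriction of \<theta>.\<close>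

definition lft :: "'p \<Rightarrow> (real^'n \<Rightarrow> 'e) \<Rightarrow> bool" where
  "lft u l \<longleftrightarrow> linear l \<and> (\<forall>v. l v \<in> model P \<and> \<theta> u (l v) = v)"

definition tors :: "'p \<Rightarrow> (real^'n \<Rightarrow> 'e) \<Rightarrow> 'n bil" where
  "tors u l = bilin (\<lambda>v w. ext_deriv P \<theta> u (l v) (l w))"

abbreviation "ed \<equiv> ext_deriv P \<theta>"

lemma ed_add:
  assumes "u \<in> pts P" "a \<in> model P" "b \<in> model P" "c \<in> model P"
  shows "ed u (a + b) c = ed u a c + ed u b c" "ed u c (a + b) = ed u c a + ed u c b"
    "ed u (r *\<^sub>R a) c = r *\<^sub>R ed u a c" "ed u c (r *\<^sub>R a) = r *\<^sub>R ed u c a"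
proof -
  have l: "lin_on (model P) (\<lambda>v. ed u v c)" by (rule ext_deriv_lin[OF premfd_P theta_form assms(1,4)])
  show 1: "ed u (a + b) c = ed u a c + ed u b c" "ed u (r *\<^sub>R a) c = r *\<^sub>R ed u a c"
    using lin_on_add[OF l] lin_on_scale[OF l] assms by auto
  show "ed u c (a + b) = ed u c a + ed u c b" "ed u c (r *\<^sub>R a) = r *\<^sub>R ed u c a"
    using 1 ext_deriv_antisym[of P \<theta> u c "a + b"] ext_deriv_antisym[of P \<theta> u c a] ext_deriv_antisym[of P \<theta> u c b]
      ext_deriv_antisym[of P \<theta> u c "r *\<^sub>R a"] by simp_all
qed

lemma tors_apply:
  assumes u: "u \<in> pts P" and l: "lft u l"
  shows "blinfun_apply (blinfun_apply (tors u l) v) w = ed u (l v) (l w)"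
proof -
  have lin: "linear l" and lP: "l v \<in> model P" for v using l by (auto simp: lft_def)
  show ?thesis
    unfolding tors_def
    by (rule bilin_apply; rule linearI) (simp_all add: linear_add[OF lin] linear_scale[OF lin] ed_add[OF u lP lP lP])
qed

lemma tors_torsion:
  assumes "u \<in> pts P" "lft u l"
  shows "tors u l \<in> torsion_space"
  unfolding torsion_space_def mem_Collect_eq tors_apply[OF assms] by (intro allI) (rule ext_deriv_antisym)

lemma lft_add:
  assumes u: "u \<in> pts P" and l: "lft u l" and A: "A \<in> hom_alg \<gg>"
  defines "l' \<equiv> \<lambda>v. l v + fnd u (inv_iota (blinfun_apply A v))"
  shows "lft u l'" "tors u l' = tors u l - spencer A"
proof -
  have lin: "linear l" and lP: "l v \<in> model P" and \<theta>l: "\<theta> u (l v) = v" for v using l by (auto simp: lft_def)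
  let ?f = "\<lambda>v. fnd u (inv_iota (blinfun_apply A v))"
  note Av = hom_algD[OF A]
  have fP: "?f v \<in> model P" for v by (rule fnd_mem[OF u inv_iota_mem[OF Av]])
  have \<theta>f: "\<theta> u (?f v) = 0" for v by (rule theta_fnd[OF u inv_iota_mem[OF Av]])
  have f: "linear ?f"
    by (rule linearI)
       (simp_all add: blinfun.add_right blinfun.scaleR_right lin_on_add[OF inv_iota_lin Av Av] lin_on_scale[OF inv_iota_lin Av]
         lin_on_add[OF fnd_lin[OF u] inv_iota_mem[OF Av] inv_iota_mem[OF Av]] lin_on_scale[OF fnd_lin[OF u] inv_iota_mem[OF Av]])
  show l': "lft u l'"
    unfolding lft_def l'_def
    using linear_compose_add[OF lin f] subspace_add[OF premfd_subspace[OF premfd_P] lP fP] lin_on_add[OF theta_lin[OF u] lP fP] \<theta>l \<theta>f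
    by simp
  have ff: "ed u (?f v) \<xi> = - (blinfun_apply A v *v \<theta> u \<xi>)" if "\<xi> \<in> model P" for v \<xi>
    using dtheta_fnd[OF u inv_iota_mem[OF Av] that] Av by simp
  have lf: "ed u \<xi> (?f v) = blinfun_apply A v *v \<theta> u \<xi>" if "\<xi> \<in> model P" for v \<xi>
    using ext_deriv_antisym[of P \<theta> u \<xi> "?f v"] ff[OF that] by simp
  show "tors u l' = tors u l - spencer A"
  proof (intro blinfun_eqI)
    fix v w
    have "ed u (l' v) (l' w) = ed u (l v) (l w) + ed u (?f v) (l w) + (ed u (l v) (?f w) + ed u (?f v) (?f w))"
      unfolding l'_def ed_add(1)[OF u lP fP subspace_add[OF premfd_subspace[OF premfd_P] lP fP]]
        ed_add(2)[OF u lP fP lP] ed_add(2)[OF u lP fP fP] by simp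
    \<comment> \<open>A fundamental vector in one slot reduces \<open>ed\<close> to the value of
      \<open>\<theta>\<close> in the other. So the term with two vertical vectors vanishes, and the
      two mixed terms give \<open>- spencer A\<close>.\<close>
    also have "\<dots> = ed u (l v) (l w) - blinfun_apply A v *v w + blinfun_apply A w *v v"
      using ff[OF lP] ff[OF fP] lf[OF lP] \<theta>l \<theta>f by simp
    finally show "blinfun_apply (blinfun_apply (tors u l') v) w = blinfun_apply (blinfun_apply (tors u l - spencer A) v) w"
      by (simp add: tors_apply[OF u l'] tors_apply[OF u l] spencer_apply blinfun.diff_left)
  qed
qed

lemma vert_fnd:
  assumes "u \<in> pts P" "\<xi> \<in> model P" "\<theta> u \<xi> = 0"
  obtains k where "k \<in> model G" "\<xi> = fnd u k"
  using theta_ker[OF assms(1)] bij_betw_imp_surj_on[OF fnd_bij[OF assms(1)]] assms(2,3) by blast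

lemma fnd_inj: "u \<in> pts P \<Longrightarrow> k \<in> model G \<Longrightarrow> l \<in> model G \<Longrightarrow> fnd u k = fnd u l \<Longrightarrow> k = l"
  using fnd_bij by (meson bij_betw_imp_inj_on inj_onD)

text \<open>Two lifts differ by a linear map into vertical vectors, and \<open>fnd\<close> with
  \<open>\<iota>\<close> identifies these with the Lie algebra. The lifts at \<open>u\<close>
  therefore form an affine space over \<open>hom_alg \<gg>\<close>, and uniqueness of the standard
  lift becomes injectivity of \<open>spencer\<close> modulo \<open>\<dd>\<close>.\<close>

lemma lft_diff:
  assumes u: "u \<in> pts P" and l: "lft u l" and l': "lft u l'"
  obtains A where "A \<in> hom_alg \<gg>" "l' = (\<lambda>v. l v + fnd u (inv_iota (blinfun_apply A v)))"
proof -
  have lin: "linear l" "linear l'" and lP: "l v \<in> model P" "l' v \<in> model P" and \<theta>l: "\<theta> u (l v) = v" "\<theta> u (l' v) = v" for v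
    using l l' by (auto simp: lft_def)
  have "\<exists>k. k \<in> model G \<and> l' v - l v = fnd u k" for v
    using vert_fnd[OF u subspace_diff[OF premfd_subspace[OF premfd_P] lP(2) lP(1)], of v v] lin_on_diff[OF theta_lin[OF u] lP(2) lP(1), of v v] \<theta>l[of v]
    by (metis cancel_comm_monoid_add_class.diff_cancel)
  then obtain K where K: "\<And>v. K v \<in> model G" "\<And>v. l' v - l v = fnd u (K v)" by metis
  have sK: "subspace (model G)" by (rule premfd_subspace[OF premfd_G])
  have Klin: "linear K"
  proof (rule linearI)
    fix v w r
    show "K (v + w) = K v + K w"
      by (rule fnd_inj[OF u K(1) subspace_add[OF sK K(1) K(1)]])
         (simp add: K(2)[symmetric] lin_on_add[OF fnd_lin[OF u] K(1) K(1)] linear_add[OF lin(1)] linear_add[OF lin(2)])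
    show "K (r *\<^sub>R v) = r *\<^sub>R K v"
      by (rule fnd_inj[OF u K(1) subspace_scale[OF sK K(1)]])
         (simp add: K(2)[symmetric] lin_on_scale[OF fnd_lin[OF u] K(1)] linear_scale[OF lin(1)] linear_scale[OF lin(2)] scaleR_right_diff_distrib)
  qed
  have "linear (\<lambda>v. \<iota> (K v))"
    by (rule linearI) (simp_all add: linear_add[OF Klin] linear_scale[OF Klin] lin_on_add[OF iota_lin K(1) K(1)] lin_on_scale[OF iota_lin K(1)])
  then have A: "blinfun_apply (Blinfun (\<lambda>v. \<iota> (K v))) = (\<lambda>v. \<iota> (K v))"
    using bounded_linear_Blinfun_apply linear_conv_bounded_linear by blast
  show thesis
  proof (rule that)
    show "Blinfun (\<lambda>v. \<iota> (K v)) \<in> hom_alg \<gg>" using iota_mem[OF K(1)] by (simp add: hom_alg_def A)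
    show "l' = (\<lambda>v. l v + fnd u (inv_iota (blinfun_apply (Blinfun (\<lambda>v. \<iota> (K v))) v)))"
      using K by (simp add: A K(2)[symmetric])
  qed
qed

section \<open>The standard horizontal lift\<close>

definition std :: "'p \<Rightarrow> real^'n \<Rightarrow> 'e" where
  "std u = (THE l. lft u l \<and> tors u l \<in> \<dd>)"

lemma std_unique:
  assumes u: "u \<in> pts P" and l: "lft u l" "tors u l \<in> \<dd>" and l': "lft u l'" "tors u l' \<in> \<dd>"
  shows "l = l'"
proof -
  obtain A where A: "A \<in> hom_alg \<gg>" "l' = (\<lambda>v. l v + fnd u (inv_iota (blinfun_apply A v)))"
    using lft_diff[OF u l(1) l'(1)] by blast
  have 1: "tors u l - spencer A \<in> \<dd>" using lft_add(2)[OF u l(1) A(1)] l'(2) A(2) by simp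
  have 2: "0 \<in> hom_alg \<gg>" using hom_alg_lin[OF A(1) A(1), of 0 0] by simp
  have 3: "tors u l - spencer 0 \<in> \<dd>" using l(2) spencer_lin[of 0 A 0 A] by simp
  have "A = 0" by (rule spencer_inj[OF A(1) 2 1 3])
  then show ?thesis
    using A(2) lin_on_0[OF inv_iota_lin subspace_lie_alg] lin_on_0[OF fnd_lin[OF u] premfd_subspace[OF premfd_G]] by simp
qed

lemma std_eq: "u \<in> pts P \<Longrightarrow> lft u l \<Longrightarrow> tors u l \<in> \<dd> \<Longrightarrow> std u = l"
  unfolding std_def using std_unique by (intro the_equality) blast+

text \<open>The correction by \<open>sol\<close> leaves a torsion in \<open>\<dd>\<close>. Applied
  to a lift that is smooth in \<open>u\<close>, the formula exhibits \<open>std\<close> as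
  smooth.\<close>

lemma std_sol:
  assumes u: "u \<in> pts P" and l: "lft u l"
  shows "std u = (\<lambda>v. l v + fnd u (inv_iota (blinfun_apply (sol (tors u l)) v)))"
  using std_eq[OF u lft_add(1)[OF u l sol(1)[OF tors_torsion[OF u l]]]] lft_add(2)[OF u l sol(1)[OF tors_torsion[OF u l]]]
    sol(2)[OF tors_torsion[OF u l]] by simp

text \<open>In a fibred chart the coordinate subspace \<open>UNIV \<times> {0}\<close> is a
  complement of the vertical vectors; this inverts \<open>\<theta>\<close> on it.\<close>

definition base_inv :: "('p, (real^'n) \<times> 'k) chart \<Rightarrow> (real^'n) \<times> 'k \<Rightarrow> real^'n \<Rightarrow> real^'n" where
  "base_inv c y = the_inv_into UNIV (\<lambda>v. frep P c \<theta> y (v, 0))"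

lemma base_bij:
  assumes c: "fibred c" and u: "u \<in> fst c"
  shows "linear (\<lambda>v. frep P c \<theta> (snd c u) (v, 0))" "bij_betw (\<lambda>v. frep P c \<theta> (snd c u) (v, 0)) UNIV UNIV"
proof -
  note cm = fibred_mchart[OF c]
  have up: "u \<in> pts P" by (rule chart_pt[OF cm u])
  have 0: "0 \<in> model G" by (rule subspace_0[OF premfd_subspace[OF premfd_G]])
  have lin: "lin_on FM (frep P c \<theta> (snd c u))" by (rule lform_lin[OF one_form_lform[OF theta_form cm]]) (use u in auto)
  show l: "linear (\<lambda>v. frep P c \<theta> (snd c u) (v, 0))"
    using lin_on_add[OF lin, of "(_, 0)" "(_, 0)"] lin_on_scale[OF lin, of "(_, 0)"] 0 by (intro linearI) auto
  have "v = 0" if "frep P c \<theta> (snd c u) (v, 0) = 0" for v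
  proof -
    have un: "uncoords P c u (v, 0) \<in> model P" by (rule uncoords_mem[OF cm u]) (use 0 in simp)
    then have "uncoords P c u (v, 0) \<in> vert P p M u"
      using theta_ker[OF up] that frep_snd[OF cm u, of \<theta>] by auto
    then show ?thesis using vert_fibred[OF c u un] coords_uncoords[OF cm u, of "(v, 0)"] 0 by simp
  qed
  then have "inj (\<lambda>v. frep P c \<theta> (snd c u) (v, 0))" using linear_injective_0[OF l] by blast
  then show "bij_betw (\<lambda>v. frep P c \<theta> (snd c u) (v, 0)) UNIV UNIV"
    using linear_injective_imp_surjective[OF l] by (auto simp: bij_betw_def)
qed

lemma base_inv_lform:
  assumes c: "fibred c"
  shows "lform (snd c ` fst c) UNIV (base_inv c)"
  unfolding base_inv_def
proof (rule lform_inverse[OF subspace_UNIV subspace_UNIV])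
  note cm = fibred_mchart[OF c]
  have 0: "0 \<in> model G" by (rule subspace_0[OF premfd_subspace[OF premfd_G]])
  show "lform (snd c ` fst c) UNIV (\<lambda>y v. frep P c \<theta> y (v, 0))"
  proof (rule lformI[OF subspace_UNIV])
    show "smooth_on (snd c ` fst c) (\<lambda>y. frep P c \<theta> y (v, 0))" for v
      by (rule lform_smooth[OF one_form_lform[OF theta_form cm] smooth_on_ident smooth_on_const]) (use 0 in auto)
    show "lin_on UNIV (\<lambda>v. frep P c \<theta> y (v, 0))" if "y \<in> snd c ` fst c" for y
      using base_bij(1)[OF c] that linear_imp_lin_on by blast
  qed
  show "bij_betw (\<lambda>v. frep P c \<theta> y (v, 0)) UNIV UNIV" if "y \<in> snd c ` fst c" for y
    using base_bij(2)[OF c] that by blast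
qed

text \<open>An auxiliary lift that is flat in the chart \<open>c\<close>. Its torsion is not
  controlled, but it is smooth and so can be corrected to \<open>std\<close>.\<close>

definition base_lft :: "('p, (real^'n) \<times> 'k) chart \<Rightarrow> 'p \<Rightarrow> real^'n \<Rightarrow> 'e" where
  "base_lft c u v = uncoords P c u (base_inv c (snd c u) v, 0)"

lemma base_lft:
  assumes c: "fibred c" and u: "u \<in> fst c"
  shows "lft u (base_lft c u)" "coords P c u (base_lft c u v) = (base_inv c (snd c u) v, 0)"
proof -
  note cm = fibred_mchart[OF c]
  have 0: "(v, 0) \<in> FM" for v :: "real^'n" using subspace_0[OF premfd_subspace[OF premfd_G]] by simp
  have bl: "lin_on UNIV (base_inv c (snd c u))" by (rule lform_lin[OF base_inv_lform[OF c]]) (use u in auto)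
  note ul = uncoords_lin[OF cm u]
  have "linear (base_lft c u)"
    using lin_on_add[OF bl] lin_on_scale[OF bl] lin_on_add[OF ul 0 0] lin_on_scale[OF ul 0]
    by (intro linearI) (simp_all add: base_lft_def)
  moreover have "base_lft c u v \<in> model P" for v unfolding base_lft_def by (rule uncoords_mem[OF cm u 0])
  moreover have "\<theta> u (base_lft c u v) = v" for v
  proof -
    have "\<theta> u (base_lft c u v) = frep P c \<theta> (snd c u) (base_inv c (snd c u) v, 0)"
      using frep_snd[OF cm u, of \<theta>] by (simp add: base_lft_def)
    also have "\<dots> = v"
      unfolding base_inv_def using base_bij(2)[OF c u] f_the_inv_into_f[of "\<lambda>v. frep P c \<theta> (snd c u) (v, 0)" UNIV v]
      by (simp add: bij_betw_def)
    finally show ?thesis .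
  qed
  ultimately show "lft u (base_lft c u)" by (simp add: lft_def)
  show "coords P c u (base_lft c u v) = (base_inv c (snd c u) v, 0)"
    unfolding base_lft_def by (rule coords_uncoords[OF cm u 0])
qed

lemma std:
  assumes u: "u \<in> pts P"
  shows "lft u (std u)" "tors u (std u) \<in> \<dd>"
proof -
  obtain c where c: "fibred c" "u \<in> fst c" using ex_fibred[OF u] by blast
  note l = base_lft(1)[OF c]
  note s = sol[OF tors_torsion[OF u l]]
  show "lft u (std u)" "tors u (std u) \<in> \<dd>"
    using lft_add[OF u l s(1)] s(2) std_sol[OF u l] by simp_all
qed

lemma std_linear: "u \<in> pts P \<Longrightarrow> linear (std u)" and std_mem: "u \<in> pts P \<Longrightarrow> std u v \<in> model P"
  and theta_std: "u \<in> pts P \<Longrightarrow> \<theta> u (std u v) = v"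
  using std(1) by (auto simp: lft_def)

text \<open>By \<open>std_sol\<close>, \<open>std\<close> is the flat lift plus a fundamental vector
  whose parameter is a linear function of the torsion of the flat lift. All three ingredients are
  smooth in the chart.\<close>

lemma std_lform:
  assumes c: "fibred c"
  shows "lform (snd c ` fst c) UNIV (\<lambda>y v. coords P c (cinv c y) (std (cinv c y) v))"
proof (rule lformI[OF subspace_UNIV])
  note cm = fibred_mchart[OF c]
  note co = mchart_chart_on[OF cm]
  have 0: "(v, 0) \<in> FM" for v :: "real^'n" using subspace_0[OF premfd_subspace[OF premfd_G]] by simp
  let ?S = "snd c ` fst c"
  fix v
  obtain L where L: "bounded_linear L" "\<And>\<tau>. \<tau> \<in> torsion_space \<Longrightarrow> L (tensor_array \<tau>) = inv_iota (blinfun_apply (sol \<tau>) v)"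
    using sol_smooth by blast
  have bs: "smooth_on ?S (\<lambda>y. (base_inv c y w, 0))" for w
    by (rule smooth_on_Pair[OF lform_smooth[OF base_inv_lform[OF c] smooth_on_ident smooth_on_const] smooth_on_const]) auto
  \<comment> \<open>The components of the torsion of \<open>base_lft\<close>, computed from the
    local expression of \<open>\<theta>\<close>.\<close>
  let ?t = "\<lambda>y. \<chi> i. \<chi> j. dform (frep P c \<theta>) y (base_inv c y (axis i 1), 0) (base_inv c y (axis j 1), 0)"
  have "smooth_on ?S ?t"
    by (intro smooth_on_vec dform_smooth[OF mchart_ropen[OF cm] one_form_lform[OF theta_form cm]] bs) (use 0 in auto)
  then have Lt: "smooth_on ?S (\<lambda>y. L (?t y))" by (rule smooth_on_linear[OF _ L(1)])
  have tt: "L (?t (snd c u)) = inv_iota (blinfun_apply (sol (tors u (base_lft c u))) v)" if u: "u \<in> fst c" for u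
  proof -
    note up = chart_pt[OF cm u]
    note l = base_lft(1)[OF c u]
    have "?t (snd c u) = tensor_array (tors u (base_lft c u))"
      using l by (simp add: tensor_array_def tors_apply[OF up l] ext_deriv_chart[OF theta_form cm u] base_lft(2)[OF c u] lft_def)
    then show ?thesis using L(2)[OF tors_torsion[OF up l]] by simp
  qed
  have Lm: "(\<lambda>y. L (?t y)) ` ?S \<subseteq> model G"
    using tt inv_iota_mem[OF hom_algD[OF sol(1)[OF tors_torsion[OF chart_pt[OF cm] base_lft(1)[OF c]]]]] by auto
  have "smooth_on ?S (\<lambda>y. (base_inv c y v, 0) + coords P c (cinv c y) (fnd (cinv c y) (L (?t y))))"
    by (rule smooth_on_add[OF bs lform_smooth[OF fnd_lform[OF cm] smooth_on_ident Lt _ Lm]]) auto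
  then show "smooth_on ?S (\<lambda>y. coords P c (cinv c y) (std (cinv c y) v))"
  proof (rule smooth_on_cong)
    fix y assume "y \<in> ?S"
    then obtain u where u: "u \<in> fst c" "y = snd c u" by auto
    note up = chart_pt[OF cm u(1)]
    note l = base_lft(1)[OF c u(1)]
    have lP: "base_lft c u v \<in> model P" using l by (simp add: lft_def)
    note km = inv_iota_mem[OF hom_algD[OF sol(1)[OF tors_torsion[OF up l]]]]
    have "coords P c u (std u v) = coords P c u (base_lft c u v) + coords P c u (fnd u (inv_iota (blinfun_apply (sol (tors u (base_lft c u))) v)))"
      unfolding std_sol[OF up l] by (rule lin_on_add[OF coords_lin[OF cm u(1)] lP fnd_mem[OF up km]])
    then show "(base_inv c y v, 0) + coords P c (cinv c y) (fnd (cinv c y) (L (?t y))) = coords P c (cinv c y) (std (cinv c y) v)"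
      using u co tt[OF u(1)] base_lft(2)[OF c u(1)] by simp
  qed
next
  note cm = fibred_mchart[OF c]
  fix y assume "y \<in> snd c ` fst c"
  then have m: "cinv c y \<in> fst c" by (rule cinv_mem)
  note up = chart_pt[OF cm m]
  show "lin_on UNIV (\<lambda>v. coords P c (cinv c y) (std (cinv c y) v))"
    using lin_onD[OF coords_lin[OF cm m] std_mem[OF up] std_mem[OF up]]
    by (simp add: lin_on_def linear_add[OF std_linear[OF up]] linear_scale[OF std_linear[OF up]])
qed

text \<open>The translated lift, with its argument multiplied by \<open>g\<close> to restore the
  normalization by \<open>\<theta>\<close>, is a lift at \<open>act u g\<close>. Naturality of the
  exterior derivative shows that its torsion is that of \<open>std u\<close> acted on by the inverse
  of \<open>g\<close>, so it stays in \<open>\<dd>\<close>; uniqueness identifies it.\<close>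

lemma std_right:
  assumes u: "u \<in> pts P" and g: "g \<in> pts G"
  shows "tmap P P (\<lambda>u. act u g) u (std u v) = std (act u g) (matrix_inv g *v v)"
proof -
  let ?T = "tmap P P (\<lambda>u. act u g) u"
  note rs = right_smooth[OF g]
  note tm = tmap_mem[OF premfd_P premfd_P rs u] and tl = tmap_lin[OF premfd_P premfd_P rs u]
  note ug = act_mem[OF u g]
  define l where "l = (\<lambda>v. ?T (std u (g *v v)))"
  note sl = linear_compose[OF matrix_vector_mul_linear std_linear[OF u], of g, unfolded o_def]
  have l: "lft (act u g) l"
    unfolding lft_def
  proof (intro conjI allI)
    show "linear l"
      unfolding l_def
      by (rule linearI) (simp_all add: linear_add[OF sl] linear_scale[OF sl] lin_on_add[OF tl std_mem[OF u] std_mem[OF u]] lin_on_scale[OF tl std_mem[OF u]])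
    show "l v \<in> model P" for v unfolding l_def by (rule tm[OF std_mem[OF u]])
    show "\<theta> (act u g) (l v) = v" for v
      unfolding l_def using theta_equiv[OF g u std_mem[OF u]] theta_std[OF u] g by simp
  qed
  have "tors (act u g) l = torsion_act (matrix_inv g) (tors u (std u))"
  proof (intro blinfun_eqI)
    fix v w
    have "ed (act u g) (l v) (l w) = ext_deriv P (\<lambda>u \<xi>. matrix_inv g *v \<theta> u \<xi>) u (std u (g *v v)) (std u (g *v w))"
      unfolding l_def
      by (rule ext_deriv_pullback[OF premfd_P premfd_P rs theta_form u std_mem[OF u] std_mem[OF u], symmetric])
         (rule theta_equiv[OF g, symmetric])
    also have "\<dots> = matrix_inv g *v ed u (std u (g *v v)) (std u (g *v w))"
      by (rule ext_deriv_linear[OF premfd_P theta_form u std_mem[OF u] std_mem[OF u] matrix_vector_mul_bounded_linear])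
    finally show "blinfun_apply (blinfun_apply (tors (act u g) l) v) w =
        blinfun_apply (blinfun_apply (torsion_act (matrix_inv g) (tors u (std u))) v) w"
      by (simp add: tors_apply[OF ug l] torsion_act_apply tors_apply[OF u std(1)[OF u]] g)
  qed
  then have "std (act u g) = l" using std_eq[OF ug l] dd_act[OF inv_G[OF g] std(2)[OF u]] by simp
  then show ?thesis using g by (simp add: l_def)
qed

end

section \<open>Smooth vector fields, the semidirect product and dimensions\<close>

lemma vfield_smooth:
  assumes d: "mchart M E d" and Z: "\<And>x. x \<in> pts M \<Longrightarrow> Z x \<in> model M"
    and loc: "\<And>x. x \<in> fst d \<Longrightarrow> \<exists>c. mchart M F c \<and> x \<in> fst c \<and> smooth_on (snd c ` fst c) (\<lambda>y. coords M c (cinv c y) (Z (cinv c y)))"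
  shows "smooth_on (snd d ` fst d) (\<lambda>y. coords M d (cinv d y) (Z (cinv d y)))"
proof (rule smooth_on_local_openin)
  fix y assume "y \<in> snd d ` fst d"
  then obtain x where x: "x \<in> fst d" "y = snd d x" by auto
  obtain c where c: "mchart M F c" "x \<in> fst c" "smooth_on (snd c ` fst c) (\<lambda>y. coords M c (cinv c y) (Z (cinv c y)))"
    using loc[OF x(1)] by blast
  note co = mchart_chart_on[OF c(1)] mchart_chart_on[OF d]
  let ?T = "snd d ` (fst d \<inter> fst c)" and ?g = "\<lambda>y. snd c (cinv d y)"
  have g: "smooth_on ?T ?g" by (rule mchart_trans_smooth[OF d c(1)])
  have gT: "?g ` ?T \<subseteq> snd c ` (fst c \<inter> fst d)" using co by auto
  have h: "smooth_on ?T (\<lambda>y. coords M c (cinv c (?g y)) (Z (cinv c (?g y))))"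
    by (rule smooth_on_compose[OF c(3) g]) (use gT in auto)
  have hF: "(\<lambda>y. coords M c (cinv c (?g y)) (Z (cinv c (?g y)))) ` ?T \<subseteq> F"
    using co coords_mem[OF c(1) _ Z] chart_pt[OF c(1)] by auto
  have "smooth_on ?T (\<lambda>y. dderiv (\<lambda>y. snd d (cinv c y)) (?g y) (coords M c (cinv c (?g y)) (Z (cinv c (?g y)))))"
    by (rule smooth_on_dderiv'[OF mchart_trans_ropen[OF c(1) d] mchart_trans_smooth[OF c(1) d] g h gT hF])
  then have "smooth_on ?T (\<lambda>y. coords M d (cinv d y) (Z (cinv d y)))"
    by (rule smooth_on_cong) (use co coords_change[OF d _ c(1) _ Z] chart_pt[OF d] in auto)
  moreover have "openin (top_of_set (snd d ` fst d)) ?T"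
    by (rule openin_subset_trans[of E])
       (use mchart_trans_ropen[OF d c(1)] ropen_subset[OF mchart_ropen[OF d]] in \<open>auto simp: ropen_def\<close>)
  ultimately show "\<exists>T. openin (top_of_set (snd d ` fst d)) T \<and> y \<in> T \<and> smooth_on T (\<lambda>y. coords M d (cinv d y) (Z (cinv d y)))"
    using x c(2) by blast
qed

lemma lform_cong: "lform S Z a \<Longrightarrow> (\<And>x z. x \<in> S \<Longrightarrow> z \<in> Z \<Longrightarrow> a x z = b x z) \<Longrightarrow> subspace Z \<Longrightarrow> lform S Z b"
  unfolding lform_def
  by (auto simp: lin_on_def subspace_add subspace_scale intro: smooth_on_cong)

lemma lie_algebra_semidirect:
  assumes L: "subspace L" and br: "\<And>X Y. X \<in> L \<Longrightarrow> Y \<in> L \<Longrightarrow> X ** Y - Y ** X \<in> L"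
  shows "lie_algebra (L \<times> (UNIV :: (real^'n) set)) semidirect_br" "lie_subalgebra (L \<times> {0}) (L \<times> UNIV) semidirect_br"
proof -
  interpret mm: bounded_bilinear "(**) :: real^'n^'n \<Rightarrow> real^'n^'n \<Rightarrow> real^'n^'n" by (rule bounded_bilinear_matrix_mult)
  interpret mv: bounded_bilinear "(*v) :: real^'n^'n \<Rightarrow> real^'n \<Rightarrow> real^'n" by (rule bounded_bilinear_matrix_vector)
  show "lie_algebra (L \<times> (UNIV :: (real^'n) set)) semidirect_br"
    unfolding lie_algebra_def lin_on_def semidirect_br_def
    using br L
    by (auto simp: subspace_Times mm.add_left mm.add_right mm.diff_left mm.diff_right mm.scaleR_left mm.scaleR_right
        mv.add_left mv.add_right mv.diff_left mv.diff_right mv.scaleR_left mv.scaleR_right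
        matrix_mul_assoc matrix_vector_mul_assoc scaleR_right_diff_distrib zero_prod_def)
  show "lie_subalgebra (L \<times> {0}) (L \<times> UNIV) semidirect_br"
    unfolding lie_subalgebra_def semidirect_br_def using br L by (auto simp: subspace_Times)
qed

lemma semidirect_antisym: "semidirect_br Y X = - semidirect_br X Y"
  by (cases X; cases Y) (simp add: semidirect_br_def)

lemma coords_bij:
  assumes "mchart M F c" "x \<in> fst c"
  shows "bij_betw (coords M c x) (model M) F"
  by (rule bij_betw_byWitness[where f'="uncoords M c x"])
     (use coords_uncoords[OF assms] uncoords_coords[OF assms] coords_mem[OF assms] uncoords_mem[OF assms] in auto)

lemma lin_on_bij_dim:
  fixes E :: "'a::euclidean_space set" and f :: "'a \<Rightarrow> 'b::euclidean_space"
  assumes "subspace E" "lin_on E f" "bij_betw f E F"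
  shows "dim F = dim E"
proof -
  obtain L where L: "bounded_linear L" "\<And>v. v \<in> E \<Longrightarrow> L v = f v" using lin_on_extend[OF assms(1,2)] by blast
  have "inj_on L E" "L ` E = F" using assms(3) L(2) by (auto simp: bij_betw_def inj_on_def image_iff)
  then show ?thesis
    using dim_image_eq[OF bounded_linear.linear[OF L(1)], of E] assms(1) by (metis span_eq_iff)
qed

section \<open>The Cartan connection on \<open>P\<close>\<close>

context gstr
begin

text \<open>The inverse of the connection at \<open>u\<close>: a horizontal lift for the vector and
  a fundamental vector for the matrix. It has explicit smooth ingredients, so it comes first, and
  the smoothness of the connection follows from \<open>lform_inverse\<close>.\<close>

definition lam :: "'p \<Rightarrow> (real^'n^'n) \<times> (real^'n) \<Rightarrow> 'e" where
  "lam u Xv = std u (snd Xv) + fnd u (inv_iota (fst Xv))"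

abbreviation "\<hh> \<equiv> \<gg> \<times> (UNIV :: (real^'n) set)"

definition kap :: "'p \<Rightarrow> 'e \<Rightarrow> (real^'n^'n) \<times> (real^'n)" where
  "kap u = the_inv_into \<hh> (lam u)"

lemma subspace_hh: "subspace \<hh>"
  by (simp add: subspace_Times subspace_lie_alg)

lemma lam_mem: "u \<in> pts P \<Longrightarrow> Xv \<in> \<hh> \<Longrightarrow> lam u Xv \<in> model P"
  unfolding lam_def by (auto intro!: subspace_add[OF premfd_subspace[OF premfd_P]] std_mem fnd_mem inv_iota_mem)

lemma lam_lin: "u \<in> pts P \<Longrightarrow> lin_on \<hh> (lam u)"
  unfolding lin_on_def lam_def
  by (auto simp: linear_add[OF std_linear] linear_scale[OF std_linear] lin_onD[OF inv_iota_lin]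
      lin_onD[OF fnd_lin inv_iota_mem inv_iota_mem] scaleR_right_distrib)

lemma theta_lam: "u \<in> pts P \<Longrightarrow> Xv \<in> \<hh> \<Longrightarrow> \<theta> u (lam u Xv) = snd Xv"
  unfolding lam_def
  by (subst lin_on_add[OF theta_lin]) (auto simp: std_mem fnd_mem inv_iota_mem theta_std theta_fnd)

lemma lam_bij:
  assumes u: "u \<in> pts P"
  shows "bij_betw (lam u) \<hh> (model P)"
  unfolding bij_betw_def
proof (intro conjI inj_onI equalityI subsetI)
  fix a b assume ab: "a \<in> \<hh>" "b \<in> \<hh>" "lam u a = lam u b"
  then have s: "snd a = snd b" using theta_lam[OF u ab(1)] theta_lam[OF u ab(2)] by simp
  then have "fnd u (inv_iota (fst a)) = fnd u (inv_iota (fst b))" using ab(3) by (simp add: lam_def)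
  then have "inv_iota (fst a) = inv_iota (fst b)"
    using fnd_inj[OF u inv_iota_mem inv_iota_mem] ab by auto
  then have "fst a = fst b" using iota_inv[of "fst a"] iota_inv[of "fst b"] ab(1,2) by (simp add: mem_Times_iff)
  with s show "a = b" by (simp add: prod_eq_iff)
next
  fix \<xi> assume "\<xi> \<in> lam u ` \<hh>"
  then show "\<xi> \<in> model P" using lam_mem[OF u] by blast
next
  fix \<xi> assume \<xi>: "\<xi> \<in> model P"
  let ?v = "\<theta> u \<xi>"
  have "\<theta> u (\<xi> - std u ?v) = 0"
    using lin_on_diff[OF theta_lin[OF u] \<xi> std_mem[OF u]] theta_std[OF u] by simp
  then obtain k where k: "k \<in> model G" "\<xi> - std u ?v = fnd u k"
    using vert_fnd[OF u subspace_diff[OF premfd_subspace[OF premfd_P] \<xi> std_mem[OF u]]] by blast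
  then have "\<xi> = lam u (\<iota> k, ?v)" by (simp add: lam_def algebra_simps)
  then show "\<xi> \<in> lam u ` \<hh>" using iota_mem[OF k(1)] by blast
qed

lemma kap_lam: "u \<in> pts P \<Longrightarrow> Xv \<in> \<hh> \<Longrightarrow> kap u (lam u Xv) = Xv"
  unfolding kap_def by (rule the_inv_into_f_f[OF bij_betw_imp_inj_on[OF lam_bij]])

lemma lam_kap: "u \<in> pts P \<Longrightarrow> \<xi> \<in> model P \<Longrightarrow> lam u (kap u \<xi>) = \<xi>"
  unfolding kap_def using lam_bij by (intro f_the_inv_into_f) (auto simp: bij_betw_def)

lemma kap_bij: "u \<in> pts P \<Longrightarrow> bij_betw (kap u) (model P) \<hh>"
  unfolding kap_def by (rule bij_betw_the_inv_into[OF lam_bij])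

lemma kap_mem: "u \<in> pts P \<Longrightarrow> \<xi> \<in> model P \<Longrightarrow> kap u \<xi> \<in> \<hh>"
  using kap_bij by (rule bij_betwE[THEN bspec])

lemma kap_lin: "u \<in> pts P \<Longrightarrow> lin_on (model P) (kap u)"
  unfolding kap_def by (rule lin_on_the_inv_into[OF subspace_hh lam_lin lam_bij])

lemma lam_lform:
  assumes c: "fibred c"
  shows "lform (snd c ` fst c) \<hh> (\<lambda>y Xv. coords P c (cinv c y) (lam (cinv c y) Xv))"
proof (rule lformI[OF subspace_hh])
  note cm = fibred_mchart[OF c]
  note co = mchart_chart_on[OF cm]
  let ?S = "snd c ` fst c"
  fix Xv assume Xv: "Xv \<in> \<hh>"
  have X: "fst Xv \<in> \<gg>" using Xv by auto
  have "smooth_on ?S (\<lambda>y. coords P c (cinv c y) (std (cinv c y) (snd Xv)) + coords P c (cinv c y) (fnd (cinv c y) (inv_iota (fst Xv))))"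
    by (rule smooth_on_add[OF lform_smooth[OF std_lform[OF c] smooth_on_ident smooth_on_const]
          lform_smooth[OF fnd_lform[OF cm] smooth_on_ident smooth_on_const]]) (use inv_iota_mem[OF X] in auto)
  then show "smooth_on ?S (\<lambda>y. coords P c (cinv c y) (lam (cinv c y) Xv))"
  proof (rule smooth_on_cong)
    fix y assume "y \<in> ?S"
    then have m: "cinv c y \<in> fst c" by (rule cinv_mem)
    note up = chart_pt[OF cm m]
    show "coords P c (cinv c y) (std (cinv c y) (snd Xv)) + coords P c (cinv c y) (fnd (cinv c y) (inv_iota (fst Xv))) =
        coords P c (cinv c y) (lam (cinv c y) Xv)"
      unfolding lam_def by (rule lin_on_add[OF coords_lin[OF cm m] std_mem[OF up] fnd_mem[OF up inv_iota_mem[OF X]], symmetric])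
  qed
next
  note cm = fibred_mchart[OF c]
  fix y assume "y \<in> snd c ` fst c"
  then have m: "cinv c y \<in> fst c" by (rule cinv_mem)
  note up = chart_pt[OF cm m]
  show "lin_on \<hh> (\<lambda>Xv. coords P c (cinv c y) (lam (cinv c y) Xv))"
    using lin_onD[OF lam_lin[OF up]] lin_onD[OF coords_lin[OF cm m] lam_mem[OF up] lam_mem[OF up]] unfolding lin_on_def by simp
qed

lemma kap_form: "one_form P kap"
proof (rule one_formI[OF premfd_P kap_lin])
  fix u assume "u \<in> pts P"
  then obtain c where c: "fibred c" "u \<in> fst c" using ex_fibred by blast
  note cm = fibred_mchart[OF c(1)]
  have F: "subspace FM" by (rule mchart_subspace[OF cm])
  let ?a = "\<lambda>y Xv. coords P c (cinv c y) (lam (cinv c y) Xv)"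
  have b: "bij_betw (?a y) \<hh> FM" if "y \<in> snd c ` fst c" for y
  proof -
    have m: "cinv c y \<in> fst c" using that by (rule cinv_mem)
    show ?thesis using bij_betw_trans[OF lam_bij[OF chart_pt[OF cm m]] coords_bij[OF cm m]] by (simp add: o_def)
  qed
  have "lform (snd c ` fst c) FM (frep P c kap)"
  proof (rule lform_cong[OF lform_inverse[OF subspace_hh F lam_lform[OF c(1)] b] _ F])
    fix y z assume yz: "y \<in> snd c ` fst c" "z \<in> FM"
    have m: "cinv c y \<in> fst c" using yz(1) by (rule cinv_mem)
    note up = chart_pt[OF cm m]
    have un: "uncoords P c (cinv c y) z \<in> model P" by (rule uncoords_mem[OF cm m yz(2)])
    have "z = ?a y (kap (cinv c y) (uncoords P c (cinv c y) z))"
      using lam_kap[OF up un] coords_uncoords[OF cm m yz(2)] by simp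
    then show "the_inv_into \<hh> (?a y) z = frep P c kap y z"
      unfolding frep_def using the_inv_into_f_f[OF bij_betw_imp_inj_on[OF b[OF yz(1)]] kap_mem[OF up un]] by metis
  qed
  then show "\<exists>c. mchart P FM c \<and> u \<in> fst c \<and> lform (snd c ` fst c) FM (frep P c kap)"
    using cm c(2) by blast
qed

text \<open>The adjoint action of the inverse of \<open>g\<close> on the semidirect product, as is
  appropriate for a right action on \<open>P\<close>.\<close>

definition Ad :: "real^'n^'n \<Rightarrow> (real^'n^'n) \<times> (real^'n) \<Rightarrow> (real^'n^'n) \<times> (real^'n)" where
  "Ad g Xv = (matrix_inv g ** fst Xv ** g, matrix_inv g *v snd Xv)"

lemma Ad_hh: "g \<in> pts G \<Longrightarrow> Xv \<in> \<hh> \<Longrightarrow> Ad g Xv \<in> \<hh>"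
  using Ad_mem by (auto simp: Ad_def)

lemma lam_right:
  assumes u: "u \<in> pts P" and g: "g \<in> pts G" and Xv: "Xv \<in> \<hh>"
  shows "tmap P P (\<lambda>u. act u g) u (lam u Xv) = lam (act u g) (Ad g Xv)"
proof -
  have X: "fst Xv \<in> \<gg>" using Xv by auto
  show ?thesis
    unfolding lam_def lin_on_add[OF tmap_lin[OF premfd_P premfd_P right_smooth[OF g] u] std_mem[OF u] fnd_mem[OF u inv_iota_mem[OF X]]]
    by (simp add: std_right[OF u g] fnd_right[OF u g X] Ad_def)
qed

lemma kap_right:
  assumes u: "u \<in> pts P" and g: "g \<in> pts G" and \<xi>: "\<xi> \<in> model P"
  shows "kap (act u g) (tmap P P (\<lambda>u. act u g) u \<xi>) = Ad g (kap u \<xi>)"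
  using lam_right[OF u g kap_mem[OF u \<xi>]] lam_kap[OF u \<xi>] kap_lam[OF act_mem[OF u g] Ad_hh[OF g kap_mem[OF u \<xi>]]] by simp

lemma fnd_eq_lam: "u \<in> pts P \<Longrightarrow> k \<in> model G \<Longrightarrow> fnd u k = lam u (\<iota> k, 0)"
  by (simp add: lam_def linear_0[OF std_linear])

lemma dkap_fnd:
  assumes u: "u \<in> pts P" and k: "k \<in> model G" and \<xi>: "\<xi> \<in> model P"
  shows "ext_deriv P kap u (fnd u k) \<xi> = - semidirect_br (\<iota> k, 0) (kap u \<xi>)"
proof -
  obtain X v where Xv: "kap u \<xi> = (X, v)" by fastforce
  have s: "sfun G (pts G) (\<lambda>g. Ad g (X, v))"
    unfolding Ad_def using sfun_Pair[OF tder_inv_conj(1)[OF k] tder_inv_vec(1)[OF k]] by simp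
  have "ext_deriv P kap u (fnd u k) \<xi> = tder G (\<lambda>g. Ad g (kap u \<xi>)) (mat 1) k"
    by (rule ext_deriv_fnd[OF kap_form u k \<xi> _, where ?w0.0="(\<iota> k, 0)" and B=Ad])
       (use kap_right[OF u _ \<xi>] kap_lam[of _ "(\<iota> k, 0)"] fnd_eq_lam[OF _ k] iota_mem[OF k] s Xv in auto)
  also have "\<dots> = (tder G (\<lambda>g. matrix_inv g ** X ** g) (mat 1) k, tder G (\<lambda>g. matrix_inv g *v v) (mat 1) k)"
    unfolding Ad_def Xv fst_conv snd_conv
    by (rule tder_Pair[OF premfd_G tder_inv_conj(1)[OF k] tder_inv_vec(1)[OF k] one_G k])
  also have "\<dots> = - semidirect_br (\<iota> k, 0) (X, v)"
    using tder_inv_conj(2)[OF k] tder_inv_vec(2)[OF k] by (simp add: semidirect_br_def)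
  finally show ?thesis using Xv by simp
qed

text \<open>The form obtained from \<open>theta1\<close> coincides with \<open>kap\<close> on
  tangent vectors but may differ on vectors outside \<open>model P\<close>; hence the formulation
  for every such \<open>\<kappa>\<close>. The fields \<open>\<zeta> X\<close> have constant value
  under \<open>kap\<close>, so brackets can be read off from the exterior derivative.\<close>

lemma cartan:
  assumes \<kappa>: "\<And>u \<xi>. u \<in> pts P \<Longrightarrow> \<xi> \<in> model P \<Longrightarrow> \<kappa> u \<xi> = kap u \<xi>"
  shows "cartan_connection P \<hh> semidirect_br (\<gg> \<times> {0}) \<kappa>"
proof -
  have bij: "bij_betw (\<kappa> u) (model P) \<hh>" if "u \<in> pts P" for u
    using kap_bij[OF that] bij_betw_cong[of "model P" "\<kappa> u" "kap u" \<hh>] \<kappa>[OF that] by blast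
  have form: "one_form P \<kappa>"
    unfolding one_form_def
  proof (intro conjI ballI)
    show "lin_on (model P) (\<kappa> u)" if u: "u \<in> pts P" for u
      using kap_lin[OF u] \<kappa>[OF u] premfd_subspace[OF premfd_P] by (simp add: lin_on_def subspace_add subspace_scale)
    fix c v assume c: "c \<in> atlas P" and v: "v \<in> model P"
    have cm: "mchart P (model P) c" by (rule atlas_mchart[OF premfd_P c])
    have "smooth_on (snd c ` fst c) (\<lambda>y. kap (cinv c y) (uncoords P c (cinv c y) v))"
      using kap_form c v by (simp add: one_form_def)
    then show "smooth_on (snd c ` fst c) (\<lambda>y. \<kappa> (cinv c y) (uncoords P c (cinv c y) v))"
      by (rule smooth_on_cong) (use \<kappa>[OF chart_pt[OF cm cinv_mem] uncoords_mem[OF cm cinv_mem v]] in simp)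
  qed
  define \<zeta> where "\<zeta> = (\<lambda>X x. the_inv_into (model P) (\<kappa> x) X)"
  have \<zeta>: "\<zeta> X u = lam u X" if "u \<in> pts P" "X \<in> \<hh>" for X u
    unfolding \<zeta>_def using the_inv_into_f_f[OF bij_betw_imp_inj_on[OF bij[OF that(1)]] lam_mem[OF that]] \<kappa>[OF that(1) lam_mem[OF that]] kap_lam[OF that]
    by simp
  have br: "lie_bracket P (\<zeta> X) (\<zeta> Y) u = \<zeta> (semidirect_br X Y) u" if X: "X \<in> \<hh>" and Y: "Y \<in> \<gg> \<times> {0}" and u: "u \<in> pts P" for X Y u
  proof -
    obtain Y' where Y': "Y = (Y', 0)" "Y' \<in> \<gg>" using Y by auto
    have Yh: "Y \<in> \<hh>" using Y' by simp
    have sm: "smooth_on (snd (chart_at P u) ` fst (chart_at P u)) (\<lambda>y. coords P (chart_at P u) (cinv (chart_at P u) y) (\<zeta> X (cinv (chart_at P u) y)))"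
      if X: "X \<in> \<hh>" for X
    proof (rule vfield_smooth[OF chart_at_mchart[OF premfd_P u]])
      show "\<zeta> X x \<in> model P" if "x \<in> pts P" for x using \<zeta>[OF that X] lam_mem[OF that X] by simp
      fix x assume "x \<in> fst (chart_at P u)"
      then have "x \<in> pts P" by (rule chart_pt[OF chart_at_mchart[OF premfd_P u]])
      then obtain c where c: "fibred c" "x \<in> fst c" using ex_fibred by blast
      note cm = fibred_mchart[OF c(1)]
      have "smooth_on (snd c ` fst c) (\<lambda>y. coords P c (cinv c y) (lam (cinv c y) X))"
        by (rule lform_smooth[OF lam_lform[OF c(1)] smooth_on_ident smooth_on_const]) (use X in auto)
      then have "smooth_on (snd c ` fst c) (\<lambda>y. coords P c (cinv c y) (\<zeta> X (cinv c y)))"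
        by (rule smooth_on_cong) (use \<zeta>[OF chart_pt[OF cm cinv_mem] X] in simp)
      then show "\<exists>c. mchart P FM c \<and> x \<in> fst c \<and> smooth_on (snd c ` fst c) (\<lambda>y. coords P c (cinv c y) (\<zeta> X (cinv c y)))"
        using cm c(2) by blast
    qed
    note eb = ext_deriv_bracket[OF premfd_P kap_form u, of "\<zeta> X" X "\<zeta> Y" Y]
    have eb1: "ext_deriv P kap u (\<zeta> X u) (\<zeta> Y u) = - kap u (lie_bracket P (\<zeta> X) (\<zeta> Y) u)"
      and eb2: "lie_bracket P (\<zeta> X) (\<zeta> Y) u \<in> model P"
      using eb \<zeta> lam_mem kap_lam sm X Yh by simp_all
    \<comment> \<open>\<open>\<zeta> Y\<close> is the fundamental field of \<open>Y'\<close>, so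
      \<open>dkap_fnd\<close> applies after exchanging the two arguments; the sign of that exchange
      cancels the sign in \<open>dkap_fnd\<close>.\<close>
    have "ext_deriv P kap u (\<zeta> X u) (\<zeta> Y u) = semidirect_br Y X"
      using ext_deriv_antisym[of P kap u "\<zeta> X u" "\<zeta> Y u"] dkap_fnd[OF u inv_iota_mem[OF Y'(2)] lam_mem[OF u X]]
        \<zeta>[OF u X] \<zeta>[OF u Yh] fnd_eq_lam[OF u inv_iota_mem[OF Y'(2)]] Y' kap_lam[OF u X] by simp
    then have "kap u (lie_bracket P (\<zeta> X) (\<zeta> Y) u) = semidirect_br X Y"
      using eb1 semidirect_antisym[of Y X] by simp
    moreover have "semidirect_br X Y \<in> \<hh>"
      using X Y' lie_alg_bracket by (auto simp: semidirect_br_def)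
    ultimately show ?thesis using lam_kap[OF u eb2] \<zeta>[OF u] by metis
  qed
  have dim: "pts P \<noteq> {} \<longrightarrow> dim (model P) = dim \<hh>"
    using lin_on_bij_dim[OF subspace_hh lam_lin lam_bij] by blast
  show ?thesis
    unfolding cartan_connection_def Let_def
    using lie_algebra_semidirect[OF subspace_lie_alg lie_alg_bracket] dim form bij br unfolding \<zeta>_def by blast
qed

end

text \<open>Serves to straighten a section of the jet bundle by a translation in the fibre
  coordinates. \<open>\<rho>\<close> is the smooth inverse of \<open>\<tau>\<close>, so all
  transitions with the new chart are compositions of smooth maps.\<close>

lemma mchart_recoordinatize:
  assumes c: "mchart M F c" and F': "ropen F' T"
    and \<tau>: "smooth_on (snd c ` fst c) \<tau>" "\<tau> ` (snd c ` fst c) = T"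
    and \<rho>: "smooth_on T \<rho>" "\<And>y. y \<in> snd c ` fst c \<Longrightarrow> \<rho> (\<tau> y) = y"
  shows "mchart M F' (fst c, \<lambda>x. \<tau> (snd c x))"
proof -
  note co = mchart_chart_on[OF c]
  let ?c = "(fst c, \<lambda>x. \<tau> (snd c x))"
  have im: "snd ?c ` A = \<tau> ` (snd c ` A)" for A by auto
  have inj: "inj_on (snd ?c) (fst ?c)"
  proof (rule inj_onI)
    fix x y assume "x \<in> fst ?c" "y \<in> fst ?c" and eq: "snd ?c x = snd ?c y"
    then have xy: "x \<in> fst c" "y \<in> fst c" by simp_all
    have "\<rho> (\<tau> (snd c x)) = \<rho> (\<tau> (snd c y))" using eq by simp
    then have "snd c x = snd c y" using \<rho>(2)[OF imageI[OF xy(1)]] \<rho>(2)[OF imageI[OF xy(2)]] by simp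
    then show "x = y" using co xy unfolding chart_on_def inj_on_def by blast
  qed
  have "openin (top_of_set F') (snd ?c ` fst ?c)" using F' \<tau>(2) im[of "fst c"] by (simp add: ropen_def)
  then have ch: "chart_on F' ?c" using inj by (simp add: chart_on_def)
  have ci: "cinv ?c (\<tau> (snd c x)) = x" if "x \<in> fst c" for x using cinv_snd[OF ch, of x] that by simp
  have "compat F' ?c (model M) d" if d: "d \<in> atlas M" for d
    unfolding compat_def
  proof (intro conjI)
    have dm: "mchart M (model M) d" by (rule atlas_mchart[OF mchart_premfd[OF c] d])
    let ?S = "snd c ` (fst c \<inter> fst d)"
    have eq: "snd ?c ` (fst ?c \<inter> fst d) = T \<inter> \<rho> -` ?S"
    proof
      show "snd ?c ` (fst ?c \<inter> fst d) \<subseteq> T \<inter> \<rho> -` ?S" using \<rho>(2) \<tau>(2) by auto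
      show "T \<inter> \<rho> -` ?S \<subseteq> snd ?c ` (fst ?c \<inter> fst d)"
      proof
        fix t assume t: "t \<in> T \<inter> \<rho> -` ?S"
        then obtain x where x: "x \<in> fst c" "t = \<tau> (snd c x)" using \<tau>(2) by auto
        then obtain x' where "x' \<in> fst c" "x' \<in> fst d" "snd c x = snd c x'" using t \<rho>(2)[of "snd c x"] by auto
        then have "x = x'" using co x(1) by (auto simp: chart_on_def inj_on_def)
        then show "t \<in> snd ?c ` (fst ?c \<inter> fst d)" using x \<open>x' \<in> fst d\<close> by auto
      qed
    qed
    have \<rho>F: "\<rho> ` T \<subseteq> F" using \<rho>(2) chart_image_subset[OF co] \<tau>(2) by auto
    show "openin (top_of_set F') (snd ?c ` (fst ?c \<inter> fst d))"
      using ropen_preimage[OF F' mchart_trans_ropen[OF c dm] smooth_on_continuous[OF \<rho>(1)] \<rho>F] unfolding eq ropen_def by simp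
    show "openin (top_of_set (model M)) (snd d ` (fst ?c \<inter> fst d))"
      using mchart_trans_ropen[OF dm c] by (simp add: ropen_def Int_commute)
    have "smooth_on (T \<inter> \<rho> -` ?S) (\<lambda>t. snd d (cinv c (\<rho> t)))"
      by (rule smooth_on_compose[OF mchart_trans_smooth[OF c dm] smooth_on_subset[OF \<rho>(1)]]) auto
    then have "smooth_on (snd ?c ` (fst ?c \<inter> fst d)) (\<lambda>t. snd d (cinv c (\<rho> t)))" unfolding eq .
    then show "smooth_on (snd ?c ` (fst ?c \<inter> fst d)) (snd d \<circ> cinv ?c)"
      by (rule smooth_on_cong) (use ci \<rho>(2) co in auto)
    have "smooth_on (snd d ` (fst d \<inter> fst c)) (\<lambda>y. \<tau> (snd c (cinv d y)))"
      by (rule smooth_on_compose[OF \<tau>(1) mchart_trans_smooth[OF dm c]]) (use mchart_chart_on[OF dm] in auto)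
    then show "smooth_on (snd d ` (fst ?c \<inter> fst d)) (snd ?c \<circ> cinv d)"
      by (simp add: Int_commute o_def)
  qed
  then show ?thesis using ch c F' by (simp add: mchart_def charts_in_def ropen_def)
qed

lemma smooth_map_cong:
  assumes M: "premfd M" and f: "smooth_map M N f" and eq: "\<And>x. x \<in> pts M \<Longrightarrow> g x = f x"
  shows "smooth_map M N g"
  unfolding smooth_map_iff[OF M]
proof (intro conjI ballI)
  show "g ` pts M \<subseteq> pts N" using smooth_map_pts[OF f] eq by auto
  fix c assume "c \<in> atlas N"
  then have "sfun M (pts M \<inter> f -` fst c) (\<lambda>x. snd c (f x))" using f unfolding smooth_map_iff[OF M] by auto
  moreover have "pts M \<inter> g -` fst c = pts M \<inter> f -` fst c" using eq by auto
  ultimately show "sfun M (pts M \<inter> g -` fst c) (\<lambda>x. snd c (g x))"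
    using sfun_cong[OF M, of "pts M \<inter> f -` fst c" "\<lambda>x. snd c (f x)" "\<lambda>x. snd c (g x)"] eq by simp
qed

section \<open>Jet coordinates\<close>

context principal
begin

abbreviation "KL \<equiv> {L :: 'k^'n. \<forall>i. L $ i \<in> model G}"

text \<open>In a fibred chart the horizontal subspaces are the graphs of linear maps, and the columns of
  the matrix of such a map are the jet coordinates.\<close>

definition gph :: "('p, (real^'n) \<times> 'k) chart \<Rightarrow> 'p \<Rightarrow> 'k^'n \<Rightarrow> real^'n \<Rightarrow> 'e" where
  "gph c u L w = uncoords P c u (w, \<Sum>i\<in>UNIV. w $ i *\<^sub>R L $ i)"

abbreviation "J1s \<equiv> J1_set P p M"
abbreviation "jc \<equiv> jet_chart P p M"

lemma J1_setD:
  assumes "(u, H) \<in> J1s"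
  shows "u \<in> pts P" "subspace H" "H \<subseteq> model P" "\<And>\<xi>. \<xi> \<in> H \<Longrightarrow> \<xi> \<in> vert P p M u \<Longrightarrow> \<xi> = 0"
    "\<And>\<xi>. \<xi> \<in> model P \<Longrightarrow> \<exists>h a. h \<in> H \<and> a \<in> vert P p M u \<and> \<xi> = h + a"
proof -
  show "u \<in> pts P" "subspace H" "H \<subseteq> model P" using assms by (auto simp: J1_set_def)
  show "\<xi> = 0" if "\<xi> \<in> H" "\<xi> \<in> vert P p M u" for \<xi> using assms that by (auto simp: J1_set_def)
  show "\<exists>h a. h \<in> H \<and> a \<in> vert P p M u \<and> \<xi> = h + a" if "\<xi> \<in> model P" for \<xi>
  proof -
    have "\<xi> \<in> {h + a |h a. h \<in> H \<and> a \<in> vert P p M u}" using assms that by (simp add: J1_set_def)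
    then show ?thesis by blast
  qed
qed

lemma subspace_sum_scale: "\<forall>i. L $ i \<in> model G \<Longrightarrow> (\<Sum>i\<in>UNIV. w $ i *\<^sub>R L $ i) \<in> model G"
  using premfd_subspace[OF premfd_G] by (auto intro!: subspace_sum subspace_scale)

lemma gph_arg: "L \<in> KL \<Longrightarrow> (w, \<Sum>i\<in>UNIV. w $ i *\<^sub>R L $ i) \<in> FM"
  using subspace_sum_scale by auto

context
  fixes c u
  assumes c: "fibred c" and u: "u \<in> fst c"
begin

private lemma cm: "mchart P FM c" by (rule fibred_mchart[OF c])

lemma gph_mem: "L \<in> KL \<Longrightarrow> gph c u L w \<in> model P"
  unfolding gph_def by (rule uncoords_mem[OF cm u gph_arg])

lemma coords_gph: "L \<in> KL \<Longrightarrow> coords P c u (gph c u L w) = (w, \<Sum>i\<in>UNIV. w $ i *\<^sub>R L $ i)"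
  unfolding gph_def by (rule coords_uncoords[OF cm u gph_arg])

lemma gph_linear:
  assumes L: "L \<in> KL"
  shows "linear (gph c u L)"
proof (rule linearI)
  note ul = uncoords_lin[OF cm u]
  show "gph c u L (v + w) = gph c u L v + gph c u L w" for v w
    unfolding gph_def lin_on_add[OF ul gph_arg[OF L] gph_arg[OF L], symmetric]
    by (simp add: scaleR_left_distrib sum.distrib)
  show "gph c u L (r *\<^sub>R w) = r *\<^sub>R gph c u L w" for r w
    unfolding gph_def lin_on_scale[OF ul gph_arg[OF L], symmetric]
    by (simp add: scaleR_sum_right)
qed

lemma J1_gph:
  assumes L: "L \<in> KL"
  shows "(u, range (gph c u L)) \<in> J1s"
  unfolding J1_set_def mem_Collect_eq prod.case
proof (intro conjI)
  have vP: "vert P p M u \<subseteq> model P" by (auto simp: vert_def)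
  note sP = premfd_subspace[OF premfd_P]
  show "u \<in> pts P" by (rule chart_pt[OF cm u])
  show "subspace (range (gph c u L))" by (rule linear_subspace_image[OF gph_linear[OF L] subspace_UNIV])
  show sub: "range (gph c u L) \<subseteq> model P" using gph_mem[OF L] by auto
  have "w = 0" if "gph c u L w \<in> vert P p M u" for w
    using vert_fibred[OF c u gph_mem[OF L]] that coords_gph[OF L] by simp
  moreover have "gph c u L 0 = 0" by (rule linear_0[OF gph_linear[OF L]])
  moreover have "0 \<in> vert P p M u"
    using vert_fibred[OF c u subspace_0[OF sP]] lin_on_0[OF coords_lin[OF cm u] sP] by simp
  ultimately show "range (gph c u L) \<inter> vert P p M u = {0}" by (auto intro: rev_image_eqI[of 0])
  show "{h + a |h a. h \<in> range (gph c u L) \<and> a \<in> vert P p M u} = model P"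
  proof (intro equalityI subsetI)
    fix \<xi> assume "\<xi> \<in> {h + a |h a. h \<in> range (gph c u L) \<and> a \<in> vert P p M u}"
    then show "\<xi> \<in> model P" using sub vP subspace_add[OF sP] by blast
  next
    fix \<xi> assume \<xi>: "\<xi> \<in> model P"
    let ?h = "gph c u L (fst (coords P c u \<xi>))"
    have d: "\<xi> - ?h \<in> model P" by (rule subspace_diff[OF sP \<xi> gph_mem[OF L]])
    have "fst (coords P c u (\<xi> - ?h)) = 0"
      using lin_on_diff[OF coords_lin[OF cm u] \<xi> gph_mem[OF L]] coords_gph[OF L] by simp
    then have "\<xi> - ?h \<in> vert P p M u" using vert_fibred[OF c u d] by simp
    then have "?h + (\<xi> - ?h) \<in> {h + a |h a. h \<in> range (gph c u L) \<and> a \<in> vert P p M u}" by blast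
    then show "\<xi> \<in> {h + a |h a. h \<in> range (gph c u L) \<and> a \<in> vert P p M u}" by simp
  qed
qed

text \<open>The difference of the two vectors is both horizontal and vertical. This makes the
  \<open>THE\<close> in \<open>jet_chart\<close> well determined.\<close>

lemma J1_unique:
  assumes "(u, H) \<in> J1s" "\<xi> \<in> H" "\<eta> \<in> H" "fst (coords P c u \<xi>) = fst (coords P c u \<eta>)"
  shows "\<xi> = \<eta>"
proof -
  note J = J1_setD[OF assms(1)]
  have P: "\<xi> \<in> model P" "\<eta> \<in> model P" using J(3) assms(2,3) by auto
  have "fst (coords P c u (\<xi> - \<eta>)) = 0" using lin_on_diff[OF coords_lin[OF cm u] P] assms(4) by simp
  then have "\<xi> - \<eta> \<in> vert P p M u"
    using vert_fibred[OF c u subspace_diff[OF premfd_subspace[OF premfd_P] P]] by simp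
  then show ?thesis using J(4)[OF subspace_diff[OF J(2) assms(2,3)]] by simp
qed

text \<open>Complementarity provides, over every \<open>w\<close>, a vector of \<open>H\<close> with
  base coordinates \<open>w\<close>: split any vector over \<open>w\<close> and drop the vertical
  part. The fibre coordinates over the standard basis form \<open>L\<close>.\<close>

lemma J1_ex_gph:
  assumes H: "(u, H) \<in> J1s"
  obtains L where "L \<in> KL" "H = range (gph c u L)"
proof -
  note J = J1_setD[OF H]
  have 0: "(w, 0) \<in> FM" for w :: "real^'n" using subspace_0[OF premfd_subspace[OF premfd_G]] by simp
  have "\<exists>\<xi>. \<xi> \<in> H \<and> fst (coords P c u \<xi>) = w" for w
  proof -
    obtain h a where ha: "h \<in> H" "a \<in> vert P p M u" "uncoords P c u (w, 0) = h + a"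
      using J(5)[OF uncoords_mem[OF cm u 0]] by blast
    have aP: "a \<in> model P" using ha(2) by (simp add: vert_def)
    have hP: "h \<in> model P" using ha(1) J(3) by auto
    have "(w, 0) = coords P c u h + coords P c u a"
      using coords_uncoords[OF cm u 0[of w]] ha(3) lin_on_add[OF coords_lin[OF cm u] hP aP] by simp
    then have "w = fst (coords P c u h) + fst (coords P c u a)" by (metis fst_add fst_conv)
    then show ?thesis using ha(1) vert_fibred[OF c u aP] ha(2) by auto
  qed
  then obtain x where x: "\<And>w. x w \<in> H" "\<And>w. fst (coords P c u (x w)) = w" by metis
  have xP: "x w \<in> model P" for w using x(1) J(3) by auto
  define L where "L = (\<chi> i. snd (coords P c u (x (axis i 1))))"
  have L: "L \<in> KL" using coords_mem[OF cm u xP] by (auto simp: L_def mem_Times_iff)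
  have gH: "gph c u L w \<in> H" for w
  proof -
    let ?\<xi> = "\<Sum>i\<in>UNIV. w $ i *\<^sub>R x (axis i 1)"
    have \<xi>P: "?\<xi> \<in> model P" by (intro subspace_sum subspace_scale premfd_subspace[OF premfd_P] xP)
    have "coords P c u ?\<xi> = (\<Sum>i\<in>UNIV. w $ i *\<^sub>R coords P c u (x (axis i 1)))"
      by (rule lin_on_sum[OF coords_lin[OF cm u] premfd_subspace[OF premfd_P]]) (auto simp: xP)
    also have "\<dots> = (\<Sum>i\<in>UNIV. w $ i *\<^sub>R (axis i 1, L $ i))"
      by (intro sum.cong refl arg_cong2[of _ _ _ _ "(*\<^sub>R)"]) (simp add: L_def prod_eq_iff x(2))
    also have "\<dots> = (\<Sum>i\<in>UNIV. w $ i *\<^sub>R axis i 1, \<Sum>i\<in>UNIV. w $ i *\<^sub>R L $ i)"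
      by (simp add: sum_prod)
    also have "(\<Sum>i\<in>UNIV. w $ i *\<^sub>R axis i (1::real)) = w"
      using basis_expansion[of w] by (simp add: scalar_mult_eq_scaleR)
    finally have "gph c u L w = ?\<xi>" unfolding gph_def using uncoords_coords[OF cm u \<xi>P] by simp
    then show ?thesis using J(2) x(1) by (auto intro!: subspace_sum subspace_scale)
  qed
  have "H \<subseteq> range (gph c u L)"
  proof
    fix \<xi> assume "\<xi> \<in> H"
    then have "\<xi> = gph c u L (fst (coords P c u \<xi>))"
      by (intro J1_unique[OF H _ gH]) (auto simp: coords_gph[OF L])
    then show "\<xi> \<in> range (gph c u L)" by blast
  qed
  then show thesis using that[OF L] gH by blast
qed

lemma jet_snd:
  assumes H: "(u, H) \<in> J1s" and \<xi>: "\<And>i. \<xi> i \<in> H" "\<And>i. fst (coords P c u (\<xi> i)) = axis i 1"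
  shows "snd (jc c) (u, H) = (snd c u, \<chi> i. snd (coords P c u (\<xi> i)))"
proof -
  have "(THE \<eta>. \<eta> \<in> H \<and> fst (coords P c u \<eta>) = axis i 1) = \<xi> i" for i
    using \<xi> J1_unique[OF H] by (intro the_equality) auto
  then show ?thesis by (simp add: jet_chart_def)
qed

lemma jet_gph:
  assumes L: "L \<in> KL"
  shows "snd (jc c) (u, range (gph c u L)) = (snd c u, L)"
proof -
  have "(\<Sum>j\<in>UNIV. axis i (1::real) $ j *\<^sub>R L $ j) = L $ i" for i
    by (subst sum.remove[of _ i]) (auto simp: axis_def intro!: sum.neutral)
  then show ?thesis
    using jet_snd[OF J1_gph[OF L], of "\<lambda>i. gph c u L (axis i 1)"] coords_gph[OF L] by (simp add: vec_eq_iff)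
qed

end

lemma fst_jet: "fst (jc c) = {j \<in> J1s. fst j \<in> fst c}"
  by (simp add: jet_chart_def)

lemma jet_image:
  assumes c: "fibred c"
  shows "snd (jc c) ` {j \<in> J1s. fst j \<in> fst c \<inter> A} = snd c ` (fst c \<inter> A) \<times> KL"
proof (intro equalityI subsetI)
  fix z assume "z \<in> snd (jc c) ` {j \<in> J1s. fst j \<in> fst c \<inter> A}"
  then obtain u H where j: "(u, H) \<in> J1s" "u \<in> fst c" "u \<in> A" "z = snd (jc c) (u, H)" by auto
  obtain L where "L \<in> KL" "H = range (gph c u L)" using J1_ex_gph[OF c j(2,1)] by blast
  then have "z = (snd c u, L)" using jet_gph[OF c j(2)] j(4) by simp
  then show "z \<in> snd c ` (fst c \<inter> A) \<times> KL" using j \<open>L \<in> KL\<close> by auto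
next
  fix z assume "z \<in> snd c ` (fst c \<inter> A) \<times> KL"
  then obtain u L where u: "u \<in> fst c" "u \<in> A" "L \<in> KL" "z = (snd c u, L)" by auto
  then have "z = snd (jc c) (u, range (gph c u L))" using jet_gph[OF c] by simp
  moreover have "(u, range (gph c u L)) \<in> {j \<in> J1s. fst j \<in> fst c \<inter> A}" using J1_gph[OF c u(1,3)] u by simp
  ultimately show "z \<in> snd (jc c) ` {j \<in> J1s. fst j \<in> fst c \<inter> A}" by (rule image_eqI)
qed

abbreviation "JM \<equiv> FM \<times> KL"

lemma subspace_KL: "subspace KL"
  using premfd_subspace[OF premfd_G] by (auto simp: subspace_def)

lemma subspace_JM: "subspace JM"
  by (intro subspace_Times subspace_KL) (use premfd_subspace[OF premfd_G] in \<open>auto intro: subspace_Times\<close>)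

lemma chart_on_jet:
  assumes c: "fibred c"
  shows "chart_on JM (jc c)"
  unfolding chart_on_def
proof
  note co = mchart_chart_on[OF fibred_mchart[OF c]]
  show "inj_on (snd (jc c)) (fst (jc c))"
  proof (rule inj_onI)
    fix i j assume a: "i \<in> fst (jc c)" "j \<in> fst (jc c)" "snd (jc c) i = snd (jc c) j"
    obtain u H v I where ij: "i = (u, H)" "j = (v, I)" by fastforce
    have J: "(u, H) \<in> J1s" "u \<in> fst c" "(v, I) \<in> J1s" "v \<in> fst c" using a ij by (auto simp: fst_jet)
    obtain L where L: "L \<in> KL" "H = range (gph c u L)" using J1_ex_gph[OF c J(2,1)] by blast
    obtain L' where L': "L' \<in> KL" "I = range (gph c v L')" using J1_ex_gph[OF c J(4,3)] by blast
    have "snd c u = snd c v" "L = L'" using a(3) ij jet_gph[OF c J(2) L(1)] jet_gph[OF c J(4) L'(1)] L(2) L'(2) by auto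
    then show "i = j" using co J L L' ij by (auto simp: chart_on_def inj_on_def)
  qed
  have "snd (jc c) ` fst (jc c) = snd c ` fst c \<times> KL" using jet_image[OF c, of UNIV] by (simp add: fst_jet)
  moreover have "openin (top_of_set FM) (snd c ` fst c)" using co by (simp add: chart_on_def)
  ultimately show "openin (top_of_set JM) (snd (jc c) ` fst (jc c))" by (simp add: openin_Times)
qed

lemma cinv_jet:
  assumes c: "fibred c" and u: "u \<in> fst c" and L: "L \<in> KL"
  shows "cinv (jc c) (snd c u, L) = (u, range (gph c u L))"
  using cinv_snd[OF chart_on_jet[OF c], of "(u, range (gph c u L))"] jet_gph[OF c u L] J1_gph[OF c u L] u
  by (simp add: fst_jet)

text \<open>\<open>w i\<close> is the base vector \<open>axis i 1\<close> of \<open>d\<close>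
  written in the base coordinates of \<open>c\<close>. Both charts have the same vertical vectors,
  so the graph vector over \<open>w i\<close> lies over \<open>axis i 1\<close> in \<open>d\<close>,
  and its fibre coordinates in \<open>d\<close> are the new jet coordinates.\<close>

lemma jet_transition:
  assumes c: "fibred c" "u \<in> fst c" and d: "fibred d" "u \<in> fst d" and L: "L \<in> KL"
  defines "w \<equiv> \<lambda>i. fst (dderiv (\<lambda>y. snd c (cinv d y)) (snd d u) (axis i 1, 0))"
  shows "snd (jc d) (u, range (gph c u L)) =
    (snd d u, \<chi> i. snd (dderiv (\<lambda>y. snd d (cinv c y)) (snd c u) (w i, \<Sum>j\<in>UNIV. w i $ j *\<^sub>R L $ j)))"
proof -
  note cm = fibred_mchart[OF c(1)] and dm = fibred_mchart[OF d(1)]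
  have 0: "(v, 0) \<in> FM" for v :: "real^'n" using subspace_0[OF premfd_subspace[OF premfd_G]] by simp
  have "fst (coords P d u (gph c u L (w i))) = axis i 1" for i
  proof -
    let ?e = "uncoords P d u (axis i 1, 0)"
    have eP: "?e \<in> model P" by (rule uncoords_mem[OF dm d(2) 0])
    have gP: "gph c u L (w i) \<in> model P" by (rule gph_mem[OF c L])
    have dP: "gph c u L (w i) - ?e \<in> model P" by (rule subspace_diff[OF premfd_subspace[OF premfd_P] gP eP])
    have "coords P c u ?e = dderiv (\<lambda>y. snd c (cinv d y)) (snd d u) (axis i 1, 0)"
      using coords_change[OF cm c(2) dm d(2) eP] coords_uncoords[OF dm d(2) 0] by simp
    then have "fst (coords P c u (gph c u L (w i) - ?e)) = 0"
      using lin_on_diff[OF coords_lin[OF cm c(2)] gP eP] coords_gph[OF c L] by (simp add: w_def)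
    then have "fst (coords P d u (gph c u L (w i) - ?e)) = 0"
      using vert_fibred[OF c dP] vert_fibred[OF d dP] by simp
    then show ?thesis
      using lin_on_diff[OF coords_lin[OF dm d(2)] gP eP] coords_uncoords[OF dm d(2) 0] by simp
  qed
  moreover have "coords P d u (gph c u L (w i)) = dderiv (\<lambda>y. snd d (cinv c y)) (snd c u) (w i, \<Sum>j\<in>UNIV. w i $ j *\<^sub>R L $ j)" for i
    using coords_change[OF dm d(2) cm c(2) gph_mem[OF c L]] coords_gph[OF c L] by simp
  ultimately show ?thesis
    using jet_snd[OF d J1_gph[OF c L], of "\<lambda>i. gph c u L (w i)"] by simp
qed

text \<open>The formula of \<open>jet_transition\<close> is composed of first derivatives of the two
  transition maps at smoothly varying arguments, hence is smooth jointly in the point and in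
  \<open>L\<close>.\<close>

lemma jet_compat:
  assumes c: "fibred c" and d: "fibred d"
  shows "compat JM (jc c) JM (jc d)"
proof -
  have half: "openin (top_of_set JM) (snd (jc c) ` (fst (jc c) \<inter> fst (jc d))) \<and>
    smooth_on (snd (jc c) ` (fst (jc c) \<inter> fst (jc d))) (snd (jc d) \<circ> cinv (jc c))"
    if c: "fibred c" and d: "fibred d" for c d
  proof -
    note cm = fibred_mchart[OF c] and dm = fibred_mchart[OF d]
    note co = mchart_chart_on[OF cm] mchart_chart_on[OF dm]
    let ?S = "snd c ` (fst c \<inter> fst d)"
    have S: "ropen FM ?S" "ropen FM (snd d ` (fst d \<inter> fst c))"
      by (rule mchart_trans_ropen[OF cm dm], rule mchart_trans_ropen[OF dm cm])
    have "fst (jc c) \<inter> fst (jc d) = {j \<in> J1s. fst j \<in> fst c \<inter> fst d}" by (auto simp: fst_jet)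
    then have eq: "snd (jc c) ` (fst (jc c) \<inter> fst (jc d)) = ?S \<times> KL" using jet_image[OF c, of "fst d"] by simp
    have 0: "(v, 0) \<in> FM" for v :: "real^'n" using subspace_0[OF premfd_subspace[OF premfd_G]] by simp
    define \<phi> where "\<phi> = (\<lambda>y. snd d (cinv c y))"
    define \<psi> where "\<psi> = (\<lambda>y. snd c (cinv d y))"
    have s\<phi>: "smooth_on ?S \<phi>" unfolding \<phi>_def by (rule mchart_trans_smooth[OF cm dm])
    have s\<psi>: "smooth_on (snd d ` (fst d \<inter> fst c)) \<psi>" unfolding \<psi>_def by (rule mchart_trans_smooth[OF dm cm])
    have im: "\<phi> ` ?S \<subseteq> snd d ` (fst d \<inter> fst c)" using co by (auto simp: \<phi>_def)
    define w where "w i y = fst (dderiv \<psi> (\<phi> y) (axis i 1, 0))" for i :: 'n and y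
    have sw: "smooth_on (?S \<times> KL) (\<lambda>p. w i (fst p))" for i
      unfolding w_def
      by (intro smooth_on_fst smooth_on_dderiv'[OF S(2) s\<psi> smooth_on_compose[OF s\<phi> smooth_on_fst[OF smooth_on_ident]] smooth_on_const])
         (use im 0 in \<open>auto simp del: Times_Int_Times\<close>)
    have sL: "smooth_on (?S \<times> KL) (\<lambda>p. (w i (fst p), \<Sum>j\<in>UNIV. w i (fst p) $ j *\<^sub>R snd p $ j))" for i
      by (intro smooth_on_Pair smooth_on_sum smooth_on_scaleR sw smooth_on_vec_nth smooth_on_snd smooth_on_ident finite_UNIV) auto
    have sD: "smooth_on (?S \<times> KL) (\<lambda>p. dderiv \<phi> (fst p) (w i (fst p), \<Sum>j\<in>UNIV. w i (fst p) $ j *\<^sub>R snd p $ j))" for i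
      by (rule smooth_on_dderiv'[OF S(1) s\<phi> smooth_on_fst[OF smooth_on_ident] sL]) (use subspace_sum_scale in auto)
    have sF: "smooth_on (?S \<times> KL) (\<lambda>p. (\<phi> (fst p), \<chi> i. snd (dderiv \<phi> (fst p) (w i (fst p), \<Sum>j\<in>UNIV. w i (fst p) $ j *\<^sub>R snd p $ j))))"
      by (intro smooth_on_Pair smooth_on_vec smooth_on_snd[OF sD] smooth_on_compose[OF s\<phi> smooth_on_fst[OF smooth_on_ident]]) auto
    have "smooth_on (?S \<times> KL) (snd (jc d) \<circ> cinv (jc c))"
    proof (rule smooth_on_cong[OF sF])
      fix p assume "p \<in> ?S \<times> KL"
      then obtain u L where u: "u \<in> fst c" "u \<in> fst d" "L \<in> KL" "p = (snd c u, L)" by auto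
      show "(\<phi> (fst p), \<chi> i. snd (dderiv \<phi> (fst p) (w i (fst p), \<Sum>j\<in>UNIV. w i (fst p) $ j *\<^sub>R snd p $ j))) = (snd (jc d) \<circ> cinv (jc c)) p"
        using cinv_jet[OF c u(1,3)] jet_transition[OF c u(1) d u(2,3)] u co
        by (simp add: w_def \<phi>_def \<psi>_def)
    qed
    then show ?thesis unfolding eq using S by (auto simp: ropen_def openin_Times)
  qed
  show ?thesis using half[OF c d] half[OF d c] by (simp add: compat_def Int_commute)
qed

abbreviation "JJ \<equiv> J1 P p M G"

lemma model_JJ: "model JJ = JM" and atlas_JJ: "atlas JJ = jc ` {c. fibred c}"
  by (auto simp: J1_def fibred_iff)

lemma premfd_JJ: "premfd JJ"
  unfolding premfd_def model_JJ atlas_JJ using subspace_JM chart_on_jet jet_compat by auto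

lemma pts_JJ: "pts JJ = J1s"
proof (intro equalityI subsetI)
  fix j assume "j \<in> pts JJ"
  then show "j \<in> J1s" by (auto simp: pts_def atlas_JJ fst_jet)
next
  fix j assume j: "j \<in> J1s"
  obtain u H where uH: "j = (u, H)" by fastforce
  have "u \<in> pts P" using J1_setD(1) j uH by blast
  then obtain c where "fibred c" "u \<in> fst c" using ex_fibred by blast
  then show "j \<in> pts JJ" using j uH unfolding pts_def atlas_JJ by (intro UN_I[of "jc c"]) (auto simp: fst_jet)
qed

lemma jet_mchart: "fibred c \<Longrightarrow> mchart JJ JM (jc c)"
  using atlas_mchart[OF premfd_JJ, of "jc c"] by (simp add: atlas_JJ model_JJ)

lemma fst_snd_jet: "fst (snd (jc c) j) = snd c (fst j)"
  by (cases j) (simp add: jet_chart_def)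

lemma p1_smooth: "smooth_map JJ P p1"
  unfolding p1_def
proof (rule smooth_mapI_local[OF premfd_JJ, where F=FM])
  show "fst j \<in> pts P" if "j \<in> pts JJ" for j
    using that J1_setD(1)[of "fst j" "snd j"] by (simp add: pts_JJ)
  fix j assume "j \<in> pts JJ"
  then have j: "j \<in> J1s" "fst j \<in> pts P" using J1_setD(1)[of "fst j" "snd j"] by (simp_all add: pts_JJ)
  obtain c where c: "fibred c" "fst j \<in> fst c" using ex_fibred[OF j(2)] by blast
  have "sfun JJ (fst (jc c)) (\<lambda>j. snd c (fst j))"
    using sfun_linear[OF sfun_dom[OF jet_mchart[OF c(1)]] bounded_linear_fst] by (simp add: fst_snd_jet)
  then show "\<exists>d W. mchart P FM d \<and> j \<in> W \<and> fst ` W \<subseteq> fst d \<and> sfun JJ W (\<lambda>x. snd d (fst x))"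
    using c j(1) fibred_mchart[OF c(1)] by (intro exI[of _ c] exI[of _ "fst (jc c)"]) (auto simp: fst_jet)
qed

end

section \<open>The first prolongation\<close>

context gstr
begin

lemma lft_J1:
  assumes u: "u \<in> pts P" and l: "lft u l"
  shows "(u, range l) \<in> J1s"
  unfolding J1_set_def mem_Collect_eq prod.case
proof (intro conjI u)
  have lin: "linear l" and lP: "l v \<in> model P" and \<theta>l: "\<theta> u (l v) = v" for v using l by (auto simp: lft_def)
  note sP = premfd_subspace[OF premfd_P]
  show "subspace (range l)" by (rule linear_subspace_image[OF lin subspace_UNIV])
  show sub: "range l \<subseteq> model P" using lP by auto
  have ker: "\<xi> \<in> vert P p M u \<longleftrightarrow> \<xi> \<in> model P \<and> \<theta> u \<xi> = 0" for \<xi> using theta_ker[OF u] by auto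
  have "v = 0" if "l v \<in> vert P p M u" for v using that ker \<theta>l[of v] by simp
  moreover have "0 \<in> vert P p M u" using ker subspace_0[OF sP] lin_on_0[OF theta_lin[OF u] sP] by simp
  ultimately show "range l \<inter> vert P p M u = {0}" using linear_0[OF lin] by (auto intro: rev_image_eqI[of 0])
  show "{h + a |h a. h \<in> range l \<and> a \<in> vert P p M u} = model P"
  proof (intro equalityI subsetI)
    fix \<xi> assume "\<xi> \<in> {h + a |h a. h \<in> range l \<and> a \<in> vert P p M u}"
    then show "\<xi> \<in> model P" using sub ker subspace_add[OF sP] by blast
  next
    fix \<xi> assume \<xi>: "\<xi> \<in> model P"
    have "\<xi> - l (\<theta> u \<xi>) \<in> vert P p M u"
      using ker subspace_diff[OF sP \<xi> lP] lin_on_diff[OF theta_lin[OF u] \<xi> lP] \<theta>l by simp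
    then have "l (\<theta> u \<xi>) + (\<xi> - l (\<theta> u \<xi>)) \<in> {h + a |h a. h \<in> range l \<and> a \<in> vert P p M u}" by blast
    then show "\<xi> \<in> {h + a |h a. h \<in> range l \<and> a \<in> vert P p M u}" by simp
  qed
qed

lemma J1_lft:
  assumes H: "(u, H) \<in> J1s"
  obtains l where "lft u l" "H = range l"
proof -
  note J = J1_setD[OF H]
  note u = J(1)
  have ker: "\<xi> \<in> vert P p M u \<longleftrightarrow> \<xi> \<in> model P \<and> \<theta> u \<xi> = 0" for \<xi> using theta_ker[OF u] by auto
  have bij: "bij_betw (\<theta> u) H UNIV"
    unfolding bij_betw_def
  proof (intro conjI inj_onI)
    fix \<xi> \<eta> assume a: "\<xi> \<in> H" "\<eta> \<in> H" "\<theta> u \<xi> = \<theta> u \<eta>"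
    have P: "\<xi> \<in> model P" "\<eta> \<in> model P" using a J(3) by auto
    have "\<xi> - \<eta> \<in> vert P p M u"
      using ker subspace_diff[OF premfd_subspace[OF premfd_P] P] lin_on_diff[OF theta_lin[OF u] P] a(3) by simp
    then show "\<xi> = \<eta>" using J(4)[OF subspace_diff[OF J(2) a(1,2)]] by simp
  next
    have "v \<in> \<theta> u ` H" for v
    proof -
      \<comment> \<open>A vector with \<open>\<theta>\<close>-value \<open>v\<close> is split along
        \<open>H\<close>; the vertical part does not contribute to \<open>\<theta>\<close>, so
        \<open>h\<close> has the same value.\<close>
      obtain h a where ha: "h \<in> H" "a \<in> vert P p M u" "std u v = h + a" using J(5)[OF std_mem[OF u]] by blast
      have "\<theta> u (h + a) = \<theta> u h + \<theta> u a"
        by (rule lin_on_add[OF theta_lin[OF u]]) (use ha J(3) ker in auto)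
      then have "v = \<theta> u h" using theta_std[OF u, of v] ha ker by simp
      then show ?thesis using ha(1) by blast
    qed
    then show "\<theta> u ` H = UNIV" by blast
  qed
  define l where "l = the_inv_into H (\<theta> u)"
  have "lin_on H (\<theta> u)" using theta_lin[OF u] J(3) by (simp add: lin_on_def subset_iff)
  then have "lin_on UNIV l" unfolding l_def by (rule lin_on_the_inv_into[OF J(2) _ bij])
  then have "linear l" using lin_on_add[of UNIV l] lin_on_scale[of UNIV l] by (intro linearI) auto
  moreover have lb: "bij_betw l UNIV H" unfolding l_def by (rule bij_betw_the_inv_into[OF bij])
  moreover have "\<theta> u (l v) = v" for v
    unfolding l_def using bij by (intro f_the_inv_into_f) (auto simp: bij_betw_def)
  ultimately have "lft u l" using J(3) by (auto simp: lft_def bij_betw_def)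
  then show thesis using that lb by (auto simp: bij_betw_def)
qed

lemma torsion_fun_lft:
  assumes l: "lft u l"
  shows "torsion_fun P \<theta> (u, range l) = tors u l"
proof -
  have "the_inv_into (range l) (\<theta> u) v = l v" for v
    by (rule the_inv_into_f_eq) (use l in \<open>auto simp: lft_def inj_on_def\<close>)
  then show ?thesis by (simp add: torsion_fun_def tors_def)
qed

abbreviation "P1s \<equiv> P1_set P p M \<theta> \<dd>"

text \<open>The section of the jet bundle with image \<open>P1_set\<close>, and thus the inverse of
  \<open>p1\<close>.\<close>

definition hsec :: "'p \<Rightarrow> 'p \<times> 'e set" where
  "hsec u = (u, range (std u))"

lemma hsec_J1: "u \<in> pts P \<Longrightarrow> hsec u \<in> J1s"
  unfolding hsec_def by (rule lft_J1[OF _ std(1)])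

lemma P1_set_eq: "P1s = hsec ` pts P"
proof (intro equalityI subsetI)
  fix j assume "j \<in> P1s"
  moreover obtain u H where j: "j = (u, H)" by fastforce
  ultimately have H: "(u, H) \<in> J1s" "torsion_fun P \<theta> (u, H) \<in> \<dd>" by (auto simp: P1_set_def)
  obtain l where l: "lft u l" "H = range l" using J1_lft[OF H(1)] by blast
  have u: "u \<in> pts P" by (rule J1_setD(1)[OF H(1)])
  have "std u = l" using std_eq[OF u l(1)] H(2) l(2) torsion_fun_lft[OF l(1)] by simp
  then show "j \<in> hsec ` pts P" using u l(2) j by (auto simp: hsec_def)
next
  fix j assume "j \<in> hsec ` pts P"
  then obtain u where u: "u \<in> pts P" "j = hsec u" by auto
  then show "j \<in> P1s"
    using hsec_J1[OF u(1)] std(2)[OF u(1)] torsion_fun_lft[OF std(1)[OF u(1)]] by (simp add: P1_set_def hsec_def)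
qed

text \<open>The jet coordinates of the section over the base point with coordinates
  \<open>y\<close>. To find the vector of the standard subspace over \<open>axis i 1\<close>, take
  any vector over it and apply \<open>std\<close> to its \<open>\<theta>\<close>-value: this changes
  it only by a vertical vector.\<close>

definition jcoord :: "('p, (real^'n) \<times> 'k) chart \<Rightarrow> (real^'n) \<times> 'k \<Rightarrow> 'k^'n" where
  "jcoord c y = (\<chi> i. snd (coords P c (cinv c y) (std (cinv c y) (frep P c \<theta> y (axis i 1, 0)))))"

text \<open>The jet chart sheared fibrewise so that the section becomes the zero section.\<close>

definition slc :: "('p, (real^'n) \<times> 'k) chart \<Rightarrow> ('p \<times> 'e set, ((real^'n) \<times> 'k) \<times> ('k^'n)) chart" where
  "slc c = (fst (jc c), \<lambda>j. (fst (snd (jc c) j), snd (snd (jc c) j) - jcoord c (fst (snd (jc c) j))))"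

context
  fixes c
  assumes c: "fibred c"
begin

private lemma cm: "mchart P FM c" by (rule fibred_mchart[OF c])

private lemma co: "chart_on FM c" by (rule mchart_chart_on[OF cm])

private lemma zero_FM: "(v, 0) \<in> FM" for v :: "real^'n"
  using subspace_0[OF premfd_subspace[OF premfd_G]] by simp

lemma jet_hsec:
  assumes u: "u \<in> fst c"
  shows "snd (jc c) (hsec u) = (snd c u, jcoord c (snd c u))"
proof -
  note up = chart_pt[OF cm u]
  note sP = premfd_subspace[OF premfd_P]
  let ?e = "\<lambda>i. uncoords P c u (axis i 1, 0)"
  have eP: "?e i \<in> model P" for i by (rule uncoords_mem[OF cm u zero_FM])
  let ?s = "\<lambda>i. std u (\<theta> u (?e i))"
  have "fst (coords P c u (?s i)) = axis i 1" for i
  proof -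
    have dP: "?s i - ?e i \<in> model P" by (rule subspace_diff[OF sP std_mem[OF up] eP])
    have "\<theta> u (?s i - ?e i) = 0"
      using lin_on_diff[OF theta_lin[OF up] std_mem[OF up] eP] theta_std[OF up] by simp
    then have "?s i - ?e i \<in> vert P p M u" using theta_ker[OF up] dP by blast
    then show ?thesis
      using vert_fibred[OF c u dP] lin_on_diff[OF coords_lin[OF cm u] std_mem[OF up] eP] coords_uncoords[OF cm u zero_FM]
      by simp
  qed
  then have "snd (jc c) (u, range (std u)) = (snd c u, \<chi> i. snd (coords P c u (?s i)))"
    using hsec_J1[OF up] by (intro jet_snd[OF c u]) (auto simp: hsec_def)
  then show ?thesis using cinv_snd[OF co u] frep_snd[OF cm u, of \<theta>] by (simp add: hsec_def jcoord_def)
qed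

lemma jcoord_mem: "y \<in> snd c ` fst c \<Longrightarrow> jcoord c y \<in> KL"
  using coords_mem[OF cm cinv_mem std_mem[OF chart_pt[OF cm cinv_mem]]] by (auto simp: jcoord_def mem_Times_iff)

lemma jcoord_smooth: "smooth_on (snd c ` fst c) (jcoord c)"
  unfolding jcoord_def
  by (intro smooth_on_vec smooth_on_snd[OF lform_smooth[OF std_lform[OF c] smooth_on_ident
        lform_smooth[OF one_form_lform[OF theta_form cm] smooth_on_ident smooth_on_const]]])
     (use zero_FM in auto)

lemma slc_mchart: "mchart JJ JM (slc c)"
proof -
  let ?S = "snd c ` fst c \<times> KL"
  have im: "snd (jc c) ` fst (jc c) = ?S" using jet_image[OF c, of UNIV] by (simp add: fst_jet)
  let ?\<tau> = "\<lambda>y. (fst y, snd y - jcoord c (fst y))" and ?\<rho> = "\<lambda>y. (fst y, snd y + jcoord c (fst y))"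
  have js: "smooth_on ?S (\<lambda>y. jcoord c (fst y))"
    by (rule smooth_on_compose[OF jcoord_smooth smooth_on_fst[OF smooth_on_ident]]) auto
  have \<tau>: "smooth_on ?S ?\<tau>" and \<rho>: "smooth_on ?S ?\<rho>"
    by (intro smooth_on_Pair smooth_on_fst smooth_on_snd smooth_on_ident smooth_on_diff smooth_on_add js)+
  have K: "L - jcoord c y \<in> KL" "L + jcoord c y \<in> KL" if "y \<in> snd c ` fst c" "L \<in> KL" for y L
    using subspace_diff[OF subspace_KL that(2) jcoord_mem[OF that(1)]] subspace_add[OF subspace_KL that(2) jcoord_mem[OF that(1)]] by auto
  have \<tau>S: "?\<tau> ` ?S = ?S"
  proof (intro equalityI subsetI)
    fix z assume "z \<in> ?\<tau> ` ?S"
    then obtain y where y: "z = ?\<tau> y" "y \<in> ?S" by (rule imageE)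
    have "fst y \<in> snd c ` fst c" "snd y \<in> KL" using y(2) by (simp_all only: mem_Times_iff)
    then show "z \<in> ?S" using K(1)[of "fst y" "snd y"] unfolding y(1) by simp
  next
    fix z assume "z \<in> ?S"
    then obtain y L where z: "y \<in> snd c ` fst c" "L \<in> KL" "z = (y, L)" by blast
    then have "(y, L + jcoord c y) \<in> ?S" using K(2) by blast
    then show "z \<in> ?\<tau> ` ?S" by (rule rev_image_eqI) (simp add: z)
  qed
  have S: "ropen JM ?S" using mchart_ropen[OF jet_mchart[OF c]] im by simp
  show ?thesis
    unfolding slc_def
    by (rule mchart_recoordinatize[OF jet_mchart[OF c] S, of ?\<tau> ?\<rho>, unfolded im]) (use \<tau> \<rho> \<tau>S in auto)
qed

lemma slc_slice: "snd (slc c) ` (fst (slc c) \<inter> P1s) = snd (slc c) ` fst (slc c) \<inter> (FM \<times> {0})"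
proof (intro equalityI subsetI)
  fix z assume "z \<in> snd (slc c) ` (fst (slc c) \<inter> P1s)"
  then obtain j where j: "j \<in> fst (jc c)" "j \<in> P1s" "z = snd (slc c) j" by (auto simp: slc_def)
  then obtain u where u: "u \<in> pts P" "j = hsec u" by (auto simp: P1_set_eq)
  then have uc: "u \<in> fst c" using j(1) by (simp add: fst_jet hsec_def)
  have "z = (snd c u, 0)" using jet_hsec[OF uc] j(3) u(2) by (simp add: slc_def)
  moreover have "snd c u \<in> FM" by (rule chart_image_subset[OF co uc])
  moreover have "z \<in> snd (slc c) ` fst (slc c)" using j(1,3) by (auto simp: slc_def)
  ultimately show "z \<in> snd (slc c) ` fst (slc c) \<inter> (FM \<times> {0})" by simp
next
  fix z assume z: "z \<in> snd (slc c) ` fst (slc c) \<inter> (FM \<times> {0})"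
  then obtain j where j: "j \<in> fst (jc c)" "z = snd (slc c) j" by (auto simp: slc_def)
  obtain u H where uH: "j = (u, H)" by fastforce
  have u: "u \<in> fst c" using j(1) uH by (simp add: fst_jet)
  have fj: "fst (snd (jc c) j) = snd c u" using fst_snd_jet[of c j] uH by simp
  have "snd (snd (jc c) j) = jcoord c (snd c u)" using z j(2) fj by (auto simp: slc_def)
  then have "snd (jc c) j = snd (jc c) (hsec u)" using jet_hsec[OF u] fj by (simp add: prod_eq_iff)
  moreover have "hsec u \<in> fst (jc c)" using hsec_J1[OF chart_pt[OF cm u]] u by (simp add: fst_jet hsec_def)
  ultimately have "j = hsec u" using chart_on_jet[OF c] j(1) unfolding chart_on_def inj_on_def by blast
  then have "j \<in> P1s" using chart_pt[OF cm u] by (auto simp: P1_set_eq)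
  then show "z \<in> snd (slc c) ` (fst (slc c) \<inter> P1s)" using j by (auto simp: slc_def)
qed

end

lemma hsec_smooth: "smooth_map P JJ hsec"
proof (rule smooth_mapI_local[OF premfd_P, where F=JM])
  show "hsec u \<in> pts JJ" if "u \<in> pts P" for u using hsec_J1[OF that] by (simp add: pts_JJ)
  fix u assume "u \<in> pts P"
  then obtain c where c: "fibred c" "u \<in> fst c" using ex_fibred by blast
  note cm = fibred_mchart[OF c(1)]
  have "smooth_on (snd c ` fst c) (\<lambda>y. (y, jcoord c y))"
    by (rule smooth_on_Pair[OF smooth_on_ident jcoord_smooth[OF c(1)]])
  then have "smooth_on (snd c ` fst c) (\<lambda>y. snd (jc c) (hsec (cinv c y)))"
  proof (rule smooth_on_cong)
    fix y assume y: "y \<in> snd c ` fst c"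
    show "(y, jcoord c y) = snd (jc c) (hsec (cinv c y))"
      using jet_hsec[OF c(1) cinv_mem[OF y]] snd_cinv[OF y] by simp
  qed
  then have "sfun P (fst c) (\<lambda>u. snd (jc c) (hsec u))"
    using mchart_chart_on[OF cm] by (intro sfun_of_chart[OF cm subset_refl]) (auto simp: chart_on_def)
  moreover have "hsec ` fst c \<subseteq> fst (jc c)" using hsec_J1[OF chart_pt[OF cm]] by (auto simp: fst_jet hsec_def)
  ultimately show "\<exists>d W. mchart JJ JM d \<and> u \<in> W \<and> hsec ` W \<subseteq> fst d \<and> sfun P W (\<lambda>x. snd d (hsec x))"
    using jet_mchart[OF c(1)] c(2) by blast
qed

text \<open>In the sheared charts \<open>slc\<close> the image of the section is exactly where the
  fibre coordinates vanish. This is the witness behind the choice of a model space in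
  \<open>sub_mfd\<close>.\<close>

lemma slice_model_P1: "slice_model JJ P1s (FM \<times> {0})"
  unfolding slice_model_def
proof (intro conjI)
  show "subspace (FM \<times> {0 :: 'k^'n})" by (auto intro!: subspace_Times premfd_subspace[OF premfd_G])
  show "FM \<times> {0} \<subseteq> model JJ" using subspace_0[OF premfd_subspace[OF premfd_G]] by (auto simp: model_JJ)
  show "P1s \<subseteq> (\<Union>c\<in>slice_charts JJ P1s (FM \<times> {0}). fst c)"
  proof
    fix j assume j: "j \<in> P1s"
    then obtain u where u: "u \<in> pts P" "j = hsec u" by (auto simp: P1_set_eq)
    obtain c where c: "fibred c" "u \<in> fst c" using ex_fibred[OF u(1)] by blast
    have "(fst (slc c) \<inter> P1s, snd (slc c)) \<in> slice_charts JJ P1s (FM \<times> {0})"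
      unfolding slice_charts_def mem_Collect_eq
      using slc_mchart[OF c(1)] slc_slice[OF c(1)] by (intro exI[of _ "slc c"]) (simp add: mchart_def model_JJ)
    moreover have "j \<in> fst (slc c)" using hsec_J1[OF u(1)] u(2) c(2) by (simp add: slc_def fst_jet hsec_def)
    ultimately show "j \<in> (\<Union>c\<in>slice_charts JJ P1s (FM \<times> {0}). fst c)" using j
      by (intro UN_I[of "(fst (slc c) \<inter> P1s, snd (slc c))"]) simp_all
  qed
qed

lemma embedded_P1: "embedded_submanifold JJ P1s"
  unfolding embedded_submanifold_def pts_JJ using slice_model_P1 by (auto simp: P1_set_def)

section \<open>The smooth structure of \<open>P1\<close> and the form \<open>theta1\<close>\<close>

abbreviation "PP \<equiv> P1 P p M G \<theta> \<dd>"

definition KK :: "(((real^'n) \<times> 'k) \<times> ('k^'n)) set" where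
  "KK = (SOME K. slice_model JJ P1s K)"

lemma KK: "slice_model JJ P1s KK"
  unfolding KK_def by (rule someI[where P="slice_model JJ P1s", OF slice_model_P1])

lemma PP_eq: "PP = \<lparr>model = KK, atlas = slice_charts JJ P1s KK\<rparr>"
  by (simp add: P1_def sub_mfd_def KK_def Let_def)

lemma premfd_PP: "premfd PP" and pts_PP: "pts PP = P1s"
  unfolding PP_eq by (rule premfd_sliced[OF premfd_JJ KK], rule pts_sliced[OF premfd_JJ KK])

lemma p1_PP_smooth: "smooth_map PP P p1"
  unfolding PP_eq by (rule smooth_map_from_sliced[OF premfd_JJ KK p1_smooth])

lemma p1_hsec [simp]: "p1 (hsec u) = u"
  by (simp add: p1_def hsec_def)

abbreviation "p1_inv \<equiv> the_inv_into (pts PP) p1"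

lemma p1_bij: "bij_betw p1 (pts PP) (pts P)"
  unfolding pts_PP P1_set_eq by (auto simp: bij_betw_def inj_on_def image_image)

lemma p1_inv: "u \<in> pts P \<Longrightarrow> p1_inv u = hsec u"
  using bij_betw_imp_inj_on[OF p1_bij] by (intro the_inv_into_f_eq) (auto simp: pts_PP P1_set_eq)

lemma p1_inv_smooth: "smooth_map P PP p1_inv"
proof (rule smooth_map_cong[OF premfd_P _ p1_inv])
  show "smooth_map P PP hsec"
    unfolding PP_eq by (rule smooth_map_sliced[OF premfd_JJ KK premfd_P hsec_smooth]) (simp add: P1_set_eq)
qed

lemma diffeo_P1: "diffeo PP P p1"
  by (simp add: diffeo_def p1_bij p1_PP_smooth p1_inv_smooth)

text \<open>The equation \<open>lam_kap\<close> is the splitting of \<open>\<xi>\<close> into its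
  part in the standard subspace and its vertical part.\<close>

lemma vert_proj_hsec:
  assumes u: "u \<in> pts P" and \<xi>: "\<xi> \<in> model P"
  shows "vert_proj P p M (hsec u) \<xi> = fnd u (inv_iota (fst (kap u \<xi>)))"
  unfolding vert_proj_def hsec_def prod.case
proof (rule the_equality)
  have X: "fst (kap u \<xi>) \<in> \<gg>" using kap_mem[OF u \<xi>] by auto
  note kX = inv_iota_mem[OF X]
  have "\<xi> - fnd u (inv_iota (fst (kap u \<xi>))) = std u (snd (kap u \<xi>))"
    using lam_kap[OF u \<xi>] by (simp add: lam_def algebra_simps)
  then show "fnd u (inv_iota (fst (kap u \<xi>))) \<in> vert P p M u \<and> \<xi> - fnd u (inv_iota (fst (kap u \<xi>))) \<in> range (std u)"
    using fnd_vert[OF u kX] by simp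
  fix a assume a: "a \<in> vert P p M u \<and> \<xi> - a \<in> range (std u)"
  then obtain v where v: "\<xi> - a = std u v" by blast
  have aP: "a \<in> model P" "\<theta> u a = 0" using a theta_ker[OF u] by auto
  then obtain k where k: "k \<in> model G" "a = fnd u k" using vert_fnd[OF u] by blast
  have "\<xi> = lam u (\<iota> k, v)" using v k by (simp add: lam_def algebra_simps)
  then show "a = fnd u (inv_iota (fst (kap u \<xi>)))" using kap_lam[OF u, of "(\<iota> k, v)"] iota_mem[OF k(1)] k by simp
qed

lemma theta_snd_kap: "u \<in> pts P \<Longrightarrow> \<xi> \<in> model P \<Longrightarrow> \<theta> u \<xi> = snd (kap u \<xi>)"
  using theta_lam[OF _ kap_mem] lam_kap by metis

text \<open>The differential of \<open>p1\<close> undoes that of its inverse, so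
  \<open>theta1\<close> is evaluated on \<open>\<xi>\<close> itself. Its first component reads the
  vertical part of \<open>\<xi>\<close> along the standard subspace, its second is
  \<open>\<theta>\<close>: these are the two components of \<open>kap\<close>.\<close>

lemma pullback_theta1:
  assumes u: "u \<in> pts P" and \<xi>: "\<xi> \<in> model P"
  shows "pullback_form P PP p1_inv (theta1 P p M G act \<theta> \<dd>) u \<xi> = kap u \<xi>"
proof -
  let ?\<eta> = "tmap P PP p1_inv u \<xi>"
  have "tmap PP P p1 (p1_inv u) ?\<eta> = tmap P P (\<lambda>u. p1 (p1_inv u)) u \<xi>"
    by (rule tmap_compose[OF premfd_P premfd_PP premfd_P p1_inv_smooth p1_PP_smooth u \<xi>])
  also have "\<dots> = tmap P P (\<lambda>u. u) u \<xi>"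
    by (rule tmap_cong[OF premfd_P premfd_P smooth_map_ident[OF premfd_P] u \<xi>]) (simp add: p1_inv)
  also have "\<dots> = \<xi>" by (rule tmap_ident[OF premfd_P u \<xi>])
  finally have t: "tmap PP P p1 (hsec u) ?\<eta> = \<xi>" using p1_inv[OF u] by simp
  have X: "fst (kap u \<xi>) \<in> \<gg>" using kap_mem[OF u \<xi>] by auto
  have "omega P p M G act \<theta> \<dd> (hsec u) ?\<eta> = fst (kap u \<xi>)"
    unfolding omega_def t vert_proj_hsec[OF u \<xi>] fund_vf_eq p1_hsec
  proof (rule the_equality)
    fix Y assume Y: "Y \<in> \<gg> \<and> fnd u (inv_iota Y) = fnd u (inv_iota (fst (kap u \<xi>)))"
    then have "inv_iota Y = inv_iota (fst (kap u \<xi>))" using fnd_inj[OF u inv_iota_mem inv_iota_mem[OF X]] by blast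
    then have "\<iota> (inv_iota Y) = \<iota> (inv_iota (fst (kap u \<xi>)))" by (rule arg_cong)
    then show "Y = fst (kap u \<xi>)" by (simp only: iota_inv[OF X] iota_inv[OF conjunct1[OF Y]])
  qed (simp add: X)
  then show ?thesis
    unfolding pullback_form_def theta1_def p1_inv[OF u] using t theta_snd_kap[OF u \<xi>] by simp
qed

end

theorem proposition6p3:
  fixes G :: "(real^'n^'n, 'k::euclidean_space) mfd"
    and \<dd> :: "'n::finite bil set"
    and P :: "('p, 'e::euclidean_space) mfd"
    and M :: "('m, real^'n) mfd"
    and p :: "'p \<Rightarrow> 'm"
    and act :: "'p \<Rightarrow> real^'n^'n \<Rightarrow> 'p"
    and \<theta> :: "'p \<Rightarrow> 'e \<Rightarrow> real^'n"
  assumes "linear_lie_group G"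
    and "type_one G"
    and "torsion_submodule G \<dd>"
    and "spencer_decomposition G \<dd>"
    and "G_structure P p M G act \<theta>"
  shows "embedded_submanifold (J1 P p M G) (P1_set P p M \<theta> \<dd>) \<and>
    diffeo (P1 P p M G \<theta> \<dd>) P p1 \<and>
    cartan_connection P (lie_alg G \<times> UNIV) semidirect_br (lie_alg G \<times> {0})
      (pullback_form P (P1 P p M G \<theta> \<dd>) (the_inv_into (pts (P1 P p M G \<theta> \<dd>)) p1)
        (theta1 P p M G act \<theta> \<dd>))"
proof -
  interpret gstr G P M p act \<theta> \<dd>
  proof
    show "linear_lie_group G" "type_one G" "torsion_submodule G \<dd>" "spencer_decomposition G \<dd>" by fact+
    show "principal_bundle P p M G act" "model M = UNIV" "one_form P \<theta>"
      using assms(5) unfolding G_structure_def by blast+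
    show "\<theta> (act u g) (tmap P P (\<lambda>u. act u g) u \<xi>) = matrix_inv g *v \<theta> u \<xi>"
      if "g \<in> pts G" "u \<in> pts P" "\<xi> \<in> model P" for g u \<xi>
      using assms(5) that unfolding G_structure_def pullback_form_def by blast
    show "{\<xi>\<in>model P. \<theta> u \<xi> = 0} = vert P p M u" if "u \<in> pts P" for u
      using assms(5) that unfolding G_structure_def by blast
  qed
  show ?thesis
    using embedded_P1 diffeo_P1 cartan[OF pullback_theta1] by blast
qed

end
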